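(* Let $n,N\ge 1$, let $-\infty<T<t_0<0$, and let $h\in C_0^\infty(\mathbb{R}^n)$. Consider the Cauchy problem for the variable coefficient wave equation $$\Big(-\frac{2t}{N}\,\frac{\partial^2}{\partial t^2}-\Delta_{x,y}\Big)u=0,\qquad (t,x,y)\in[T,t_0]\times\mathbb{R}^n_x\times\mathbb{R}^N_y,\qquad u(T,x,y)=h(x),$$ where $\Delta_{x,y}=\sum_{i=1}^n\partial_{x_i}^2+\sum_{j=1}^N\partial_{y_j}^2$. Then for each $N$ there exists a solution $u=u^{(N)}(t,x,y)$ of this Cauchy problem which is radial in the $y$-coordinates, i.e. $u^{(N)}(t,x,y)=u^{(N)}(t,x,Ay)$ for all $A\in SO(N)$, such that the limit $$u(t,x):=\lim_{N\to\infty}u^{(N)}(t,x,y)\big|_{\{t=-|y|^2/(2N)\}}$$ exists at all points of $[T,t_0]\times\mathbb{R}^n_x$. Moreover $u\in C^\infty([T,t_0]\times\mathbb{R}^n_x)$ and $u$ solves the forward heat equation $$\partial_t u-\Delta_x u=0,\qquad u(T,x)=h(x),\qquad (t,x)\in[T,t_0]\times\mathbb{R}^n_x.$$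
   Context: Here $\mathbb{R}^n_x\times\mathbb{R}^N_y$ carries the Euclidean metric $dx^2+dy^2$. The restriction $u^{(N)}|_{\{t=-|y|^2/(2N)\}}$ means: since $u^{(N)}$ depends on $y$ only through $|y|$, one evaluates $u^{(N)}(t,x,y)$ at $|y|=\sqrt{-2Nt}$, giving a function of $(t,x)$. *)

theory Defs
  imports "HOL-Analysis.Analysis" "HOL-Combinatorics.Permutations"
begin

text \<open>Points of [T,t0] x R^n_x x R^N_y.  The y-variable is a function nat => real
  which vanishes at all indices >= N (so it lives in R^N); this is needed since
  the dimension N varies inside the statement.  Topology: product topology
  (coincides with the Euclidean one on the finite-dimensional slice).\<close>

type_synonym ('n) pt = "real \<times> (real^'n) \<times> (nat \<Rightarrow> real)"

datatype 'n dir = Dt | Dx 'n | Dy nat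

fun shift :: "('n::finite) dir \<Rightarrow> 'n pt \<Rightarrow> real \<Rightarrow> 'n pt" where
  "shift Dt (t, x, y) s = (s, x, y)"
| "shift (Dx i) (t, x, y) s = (t, (\<chi> k. if k = i then s else x $ k), y)"
| "shift (Dy j) (t, x, y) s = (t, x, y(j := s))"

fun coord :: "('n::finite) dir \<Rightarrow> 'n pt \<Rightarrow> real" where
  "coord Dt (t, x, y) = t"
| "coord (Dx i) (t, x, y) = x $ i"
| "coord (Dy j) (t, x, y) = y j"

text \<open>Partial derivative in coordinate direction d, relative to the domain \<Omega>
  (one-sided at boundary points, e.g. at t = T and t = t0).\<close>
definition pdiff :: "('n::finite) pt set \<Rightarrow> 'n dir \<Rightarrow> ('n pt \<Rightarrow> real) \<Rightarrow> 'n pt \<Rightarrow> real" where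
  "pdiff \<Omega> d f p =
     vector_derivative (\<lambda>s. f (shift d p s)) (at (coord d p) within {s. shift d p s \<in> \<Omega>})"

definition has_pdiff :: "('n::finite) pt set \<Rightarrow> 'n dir \<Rightarrow> ('n pt \<Rightarrow> real) \<Rightarrow> 'n pt \<Rightarrow> bool" where
  "has_pdiff \<Omega> d f p \<longleftrightarrow>
     (\<lambda>s. f (shift d p s)) differentiable (at (coord d p) within {s. shift d p s \<in> \<Omega>})"

definition iter_pdiff :: "('n::finite) pt set \<Rightarrow> 'n dir list \<Rightarrow> ('n pt \<Rightarrow> real) \<Rightarrow> 'n pt \<Rightarrow> real" where
  "iter_pdiff \<Omega> ds f = foldr (pdiff \<Omega>) ds f"

definition smooth_on_dom :: "('n::finite) dir set \<Rightarrow> 'n pt set \<Rightarrow> ('n pt \<Rightarrow> real) \<Rightarrow> bool" where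
  "smooth_on_dom D \<Omega> f \<longleftrightarrow>
     (\<forall>ds. set ds \<subseteq> D \<longrightarrow>
        continuous_on \<Omega> (iter_pdiff \<Omega> ds f) \<and>
        (\<forall>d\<in>D. \<forall>p\<in>\<Omega>. has_pdiff \<Omega> d (iter_pdiff \<Omega> ds f) p))"

definition RN :: "nat \<Rightarrow> (nat \<Rightarrow> real) set" where
  "RN N = {y. \<forall>j\<ge>N. y j = 0}"

definition dom :: "real \<Rightarrow> real \<Rightarrow> nat \<Rightarrow> 'n pt set" where
  "dom T t0 N = {T..t0} \<times> UNIV \<times> RN N"

definition dirs :: "nat \<Rightarrow> 'n dir set" where
  "dirs N = {Dt} \<union> range Dx \<union> Dy ` {..<N}"

definition smooth_Rn :: "(real^'n \<Rightarrow> real) \<Rightarrow> bool" where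
  "smooth_Rn h \<longleftrightarrow> smooth_on_dom (range Dx) ({0} \<times> UNIV \<times> {\<lambda>_. 0}) (\<lambda>(t, x, y). h x)"

definition C0_inf :: "(real^'n \<Rightarrow> real) \<Rightarrow> bool" where
  "C0_inf h \<longleftrightarrow> smooth_Rn h \<and> compact (closure {x. h x \<noteq> 0})"

definition mat_vec :: "nat \<Rightarrow> (nat \<Rightarrow> nat \<Rightarrow> real) \<Rightarrow> (nat \<Rightarrow> real) \<Rightarrow> (nat \<Rightarrow> real)" where
  "mat_vec N A y = (\<lambda>i. if i < N then (\<Sum>k<N. A i k * y k) else 0)"

definition det_N :: "nat \<Rightarrow> (nat \<Rightarrow> nat \<Rightarrow> real) \<Rightarrow> real" where
  "det_N N A = (\<Sum>p\<in>{p. p permutes {..<N}}. of_int (sign p) * (\<Prod>i<N. A i (p i)))"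

definition SO :: "nat \<Rightarrow> (nat \<Rightarrow> nat \<Rightarrow> real) set" where
  "SO N = {A. (\<forall>i<N. \<forall>j<N. (\<Sum>k<N. A i k * A j k) = (if i = j then 1 else 0)) \<and> det_N N A = 1}"

definition radial_y :: "real \<Rightarrow> real \<Rightarrow> nat \<Rightarrow> (('n::finite) pt \<Rightarrow> real) \<Rightarrow> bool" where
  "radial_y T t0 N u \<longleftrightarrow>
     (\<forall>A\<in>SO N. \<forall>t\<in>{T..t0}. \<forall>x. \<forall>y\<in>RN N. u (t, x, y) = u (t, x, mat_vec N A y))"

definition wave_solution :: "real \<Rightarrow> real \<Rightarrow> nat \<Rightarrow> (real^'n \<Rightarrow> real) \<Rightarrow> ('n pt \<Rightarrow> real) \<Rightarrow> bool" where
  "wave_solution T t0 N h u \<longleftrightarrow>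
     smooth_on_dom (dirs N) (dom T t0 N) u \<and>
     (\<forall>p\<in>dom T t0 N.
        - (2 * fst p / real N) * pdiff (dom T t0 N) Dt (pdiff (dom T t0 N) Dt u) p
        - (\<Sum>i\<in>UNIV. pdiff (dom T t0 N) (Dx i) (pdiff (dom T t0 N) (Dx i) u) p)
        - (\<Sum>j<N. pdiff (dom T t0 N) (Dy j) (pdiff (dom T t0 N) (Dy j) u) p) = 0) \<and>
     (\<forall>x. \<forall>y\<in>RN N. u (T, x, y) = h x)"

definition heat_solution :: "real \<Rightarrow> real \<Rightarrow> (real^'n \<Rightarrow> real) \<Rightarrow> (real \<Rightarrow> real^'n \<Rightarrow> real) \<Rightarrow> bool" where
  "heat_solution T t0 h U \<longleftrightarrow>
     (let V = (\<lambda>(t, x, y). U t x) :: 'n pt \<Rightarrow> real in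
      smooth_on_dom (dirs 0) (dom T t0 0) V \<and>
      (\<forall>p\<in>dom T t0 0.
         pdiff (dom T t0 0) Dt V p
         - (\<Sum>i\<in>UNIV. pdiff (dom T t0 0) (Dx i) (pdiff (dom T t0 0) (Dx i) V) p) = 0) \<and>
      (\<forall>x. U T x = h x))"

text \<open>The point y = sqrt(-2Nt) e_1 of R^N, on the paraboloid t = -|y|^2/(2N).\<close>
definition yN :: "nat \<Rightarrow> real \<Rightarrow> nat \<Rightarrow> real" where
  "yN N t = (\<lambda>j. if j = 0 then sqrt (- 2 * real N * t) else 0)"

end

theory Submission
  imports
    "HOL-Probability.Probability"
    "HOL-Complex_Analysis.Complex_Analysis"
    "HOL-Real_Asymp.Real_Asymp"
    Defs
begin

text \<open>
  Put $s=-t$, $S=-T$, $\rho = |y|^2/(2N)$ and let $J = {}_0F_1(;N/2;\cdot)$. A mode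
  $e^{i\xi\cdot x}\,e(s)\,J(\zeta\rho)$ solves the wave equation iff $s e'' = w^2 e$ with
  $w^2 = \zeta - N|\xi|^2/2$. The static mode $w=0$, damped by $e^{-|\xi|^2 S}$, tends to
  $e^{-|\xi|^2(S-s)}$ on $\rho = s$, which is the heat flow, but it violates the initial condition.
  The initial condition is restored by averaging modes over circles $\zeta = b - Ce^{i\theta}$ with
  $b=0$ (which creates $h$) and $b = N|\xi|^2/2$ (which cancels the static mode): at $s=S$, where
  $e$ is normalised to $1$, the mean value property of $J$ makes the circles invisible.
  For $s<S$ the exponent $w$ can be chosen on almost every point of the circle with real part tending to infinity
  as soon as $\sqrt N \ll C \ll N$, and the solution $e$ selected by a radiation condition at the other
  end of the time interval is $O(e^{-2\,\mathrm{Re}\,w(\sqrt S-\sqrt s)})$. So the averaged modes disappear in the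
  limit. Superposing over $\xi$ with the Fourier transform of $h$ gives the theorem.
\<close>

section \<open>The time-dependent factor of a mode\<close>

text \<open>Why circles rather than single modes: the direct repair of the datum would add the mode
  zeta = 0 with the amplitude of h and subtract the static mode zeta = N|xi|^2/2. The first has w^2
  = -N|xi|^2/2, so it oscillates in time without decay; the second has w = 0 and would cancel the
  heat flow at all times. Only J depends on zeta at s = S, and J is entire; for s < S the factor e
  involves the branch of w with Re w >= 0, so it is not holomorphic inside the circle and averaging
  changes it. Both constraints on C come from estimates: Re w is at least of order C /
  sqrt(N|xi|^2/2 + C), which needs C beyond sqrt N, whereas on rho = s the factor J is at most
  exp(2|zeta|s/N), where the radius contributes a bounded amount only if C <= N. For fixed N there
  is a further obstacle: y is unbounded, and a bound exp(|xi|^2 rho) would beat the damping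
  exp(-|xi|^2 S) once rho > S. The finer growth exp(2 sqrt|zeta rho|) is only exponential in |xi|
  and is absorbed.\<close>

fun ode_coeff :: "complex \<Rightarrow> complex \<Rightarrow> complex \<Rightarrow> nat \<Rightarrow> complex" where
  "ode_coeff q a b 0 = a"
| "ode_coeff q a b (Suc 0) = b"
| "ode_coeff q a b (Suc (Suc j)) =
     - (of_nat j / of_nat (j + 2)) * ode_coeff q a b (Suc j)
     + q / (of_nat (j + 1) * of_nat (j + 2)) * ode_coeff q a b j"

text \<open>The recurrence enlarges the maximum of two consecutive coefficients by a factor of at
  most 1 + |q|/((j+1)(j+2)), and the sum of 1/((j+1)(j+2)) telescopes to 1 - 1/(j+1). Two neighbours
  are carried along because the recurrence has order two.\<close>

lemma ode_coeff_bound_step: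
  "norm (ode_coeff q a b j) \<le> (norm a + norm b) * exp (norm q * (1 - 1 / real (j + 1))) \<and>
    norm (ode_coeff q a b (Suc j)) \<le> (norm a + norm b) * exp (norm q * (1 - 1 / real (j + 1)))"
proof (induction j)
  case 0
  then show ?case by simp
next
  case (Suc j)
  let ?M = "norm a + norm b" and ?K = "norm q"
  let ?e = "exp (?K * (1 - 1 / real (j + 1)))"
  let ?t = "?K / (real (j + 1) * real (j + 2))"
  have exps: "?e * exp ?t = exp (?K * (1 - 1 / real (Suc j + 1)))"
  proof -
    have "1 - 1 / real (j + 1) + 1 / (real (j + 1) * real (j + 2)) = 1 - 1 / real (Suc j + 1)"
      by (simp add: divide_simps) (simp add: algebra_simps)
    hence "?K * (1 - 1 / real (j + 1)) + ?t = ?K * (1 - 1 / real (Suc j + 1))"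
      by (metis (no_types, lifting) distrib_left mult.right_neutral times_divide_eq_right)
    thus ?thesis unfolding exp_add[symmetric] by simp
  qed
  have "norm (ode_coeff q a b (Suc (Suc j)))
      \<le> norm (- (of_nat j / of_nat (j + 2)) * ode_coeff q a b (Suc j))
        + norm (q / (of_nat (j + 1) * of_nat (j + 2)) * ode_coeff q a b j)"
    unfolding ode_coeff.simps by (rule norm_triangle_ineq)
  also have "\<dots> = real j / real (j + 2) * norm (ode_coeff q a b (Suc j)) + ?t * norm (ode_coeff q a b j)"
    by (simp only: norm_mult norm_divide norm_minus_cancel norm_of_nat)
  also have "\<dots> \<le> 1 * (?M * ?e) + ?t * (?M * ?e)"
    using Suc.IH by (intro add_mono mult_mono) auto
  also have "\<dots> = (?M * ?e) * (1 + ?t)" by (simp add: algebra_simps)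
  also have "\<dots> \<le> (?M * ?e) * exp ?t"
    by (intro mult_left_mono exp_ge_add_one_self) auto
  finally have 1: "norm (ode_coeff q a b (Suc (Suc j))) \<le> ?M * exp (?K * (1 - 1 / real (Suc j + 1)))"
    using exps by (simp add: mult.assoc)
  have "?M * ?e \<le> ?M * (?e * exp ?t)"
    by (intro mult_left_mono) auto
  hence 2: "norm (ode_coeff q a b (Suc j)) \<le> ?M * exp (?K * (1 - 1 / real (Suc j + 1)))"
    using Suc.IH exps by simp
  show ?case using 1 2 by blast
qed

lemma ode_coeff_bounded: "norm (ode_coeff q a b j) \<le> (norm a + norm b) * exp (norm q)"
proof -
  have "exp (norm q * (1 - 1 / real (j + 1))) \<le> exp (norm q)"
    by (simp add: mult_left_le)
  thus ?thesis
    using ode_coeff_bound_step[of q a b j] mult_left_mono[of _ _ "norm a + norm b"]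
    by (smt (verit) norm_ge_zero)
qed

lemma ode_coeff_summable:
  assumes "norm z < 1"
  shows "summable (\<lambda>j. ode_coeff q a b j * z ^ j)"
proof (rule summable_comparison_test'[where g="\<lambda>j. ((norm a + norm b) * exp (norm q)) * norm z ^ j" and N=0])
  show "summable (\<lambda>j. ((norm a + norm b) * exp (norm q)) * norm z ^ j)"
    using assms by (intro summable_mult summable_geometric) auto
  show "norm (ode_coeff q a b j * z ^ j) \<le> ((norm a + norm b) * exp (norm q)) * norm z ^ j" for j
    unfolding norm_mult norm_power by (intro mult_right_mono ode_coeff_bounded) auto
qed

lemma diffs_summable_unit:
  fixes c :: "nat \<Rightarrow> complex"
  assumes "\<And>z. norm z < 1 \<Longrightarrow> summable (\<lambda>j. c j * z ^ j)" and "norm z < 1"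
  shows "summable (\<lambda>j. diffs c j * z ^ j)"
    and "((\<lambda>z. \<Sum>j. c j * z ^ j) has_field_derivative (\<Sum>j. diffs c j * z ^ j)) (at z)"
proof -
  show "summable (\<lambda>j. diffs c j * z ^ j)"
    by (rule termdiff_converges[where K=1]) (use assms in auto)
  \<comment> \<open>\<open>termdiffs_strong\<close> asks for convergence at a point of larger
    modulus; the midpoint between |z| and 1 provides it.\<close>
  define r :: complex where "r = of_real ((1 + norm z) / 2)"
  have "norm r = (1 + norm z) / 2"
    unfolding r_def norm_of_real by (simp add: add_nonneg_nonneg)
  hence r: "norm r < 1" "norm z < norm r" using assms(2) by auto
  show "((\<lambda>z. \<Sum>j. c j * z ^ j) has_field_derivative (\<Sum>j. diffs c j * z ^ j)) (at z)"
    by (rule termdiffs_strong[OF assms(1)[OF r(1)] r(2)])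
qed

text \<open>With z = (s - S)/S the equation s e'' = w^2 e becomes (1 + z) f'' = q f for q = S w^2,
  which is the recurrence of \<open>ode_coeff\<close>. The singular point s = 0 is z = -1, so the
  unit disc covers 0 < s <= S. The explicit series also makes the solution measurable in w, which an
  abstract existence theorem would not show.\<close>

definition ode_series :: "complex \<Rightarrow> complex \<Rightarrow> complex \<Rightarrow> complex \<Rightarrow> complex" where
  "ode_series q a b z = (\<Sum>j. ode_coeff q a b j * z ^ j)"

definition ode_series' :: "complex \<Rightarrow> complex \<Rightarrow> complex \<Rightarrow> complex \<Rightarrow> complex" where
  "ode_series' q a b z = (\<Sum>j. diffs (ode_coeff q a b) j * z ^ j)"

lemma ode_series_derivs:
  assumes "norm z < 1"
  shows "(ode_series q a b has_field_derivative ode_series' q a b z) (at z)"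
    and "(ode_series' q a b has_field_derivative q * ode_series q a b z / (1 + z)) (at z)"
proof -
  let ?c = "ode_coeff q a b"
  have s1: "norm z < 1 \<Longrightarrow> summable (\<lambda>j. diffs ?c j * z ^ j)" for z
    using diffs_summable_unit(1)[OF ode_coeff_summable] by blast
  have s2: "norm z < 1 \<Longrightarrow> summable (\<lambda>j. diffs (diffs ?c) j * z ^ j)" for z
    using diffs_summable_unit(1)[OF s1] by blast
  show "(ode_series q a b has_field_derivative ode_series' q a b z) (at z)"
    using diffs_summable_unit(2)[OF ode_coeff_summable assms]
    unfolding ode_series_def[abs_def] ode_series'_def .
  have d2: "(ode_series' q a b has_field_derivative (\<Sum>j. diffs (diffs ?c) j * z ^ j)) (at z)"
    using diffs_summable_unit(2)[OF s1 assms]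
    unfolding ode_series'_def[abs_def] .
  let ?f = "\<lambda>j. diffs (diffs ?c) j * z ^ j"
  have sf: "?f sums (\<Sum>j. ?f j)" using s2[OF assms] by (rule summable_sums)
  have "(\<lambda>j. z * ?f j) sums (z * (\<Sum>j. ?f j))" by (rule sums_mult[OF sf])
  moreover have "(\<lambda>j. z * ?f j) = (\<lambda>j. of_nat (Suc j) * of_nat (Suc (Suc j)) * ?c (Suc (Suc j)) * z ^ Suc j)"
    by (simp add: diffs_def fun_eq_iff mult_ac del: ode_coeff.simps of_nat_Suc)
  \<comment> \<open>Shifting the index costs nothing: the factor \<open>of_nat j\<close> kills the
    new term at 0.\<close>
  ultimately have "(\<lambda>j. of_nat j * of_nat (Suc j) * ?c (Suc j) * z ^ j) sums (z * (\<Sum>j. ?f j))"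
    using sums_Suc[of "\<lambda>j. of_nat j * of_nat (Suc j) * ?c (Suc j) * z ^ j"] by simp
  from sums_add[OF sf this]
  have "(\<lambda>j. ?f j + of_nat j * of_nat (Suc j) * ?c (Suc j) * z ^ j) sums ((1 + z) * (\<Sum>j. ?f j))"
    by (simp add: algebra_simps)
  moreover have "?f j + of_nat j * of_nat (Suc j) * ?c (Suc j) * z ^ j = q * (?c j * z ^ j)" for j
  proof -
    have nz: "of_nat (j + 1) * of_nat (j + 2) \<noteq> (0::complex)"
      by (simp only: mult_eq_0_iff of_nat_eq_0_iff) simp
    have nz2: "(of_nat (j + 2) :: complex) \<noteq> 0" by (simp only: of_nat_eq_0_iff)
    have "of_nat (j+1) * of_nat (j + 2) * ?c (Suc (Suc j)) + of_nat j * of_nat (j+1) * ?c (Suc j) = q * ?c j"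
      unfolding ode_coeff.simps using nz nz2 by (simp add: divide_simps)
    hence "(of_nat (j+1) * of_nat (j + 2) * ?c (Suc (Suc j)) + of_nat j * of_nat (j+1) * ?c (Suc j)) * z ^ j = q * (?c j * z ^ j)"
      by simp
    thus ?thesis by (simp add: diffs_def algebra_simps del: ode_coeff.simps(3))
  qed
  ultimately have "(\<lambda>j. q * (?c j * z ^ j)) sums ((1 + z) * (\<Sum>j. ?f j))" by simp
  hence "(1 + z) * (\<Sum>j. ?f j) = q * ode_series q a b z"
    using sums_mult[OF summable_sums[OF ode_coeff_summable[OF assms]], of q q a b]
    unfolding ode_series_def by (rule sums_unique2)
  moreover have "1 + z \<noteq> 0"
    using assms by (metis add_eq_0_iff less_irrefl norm_minus_cancel norm_one)
  ultimately have "(\<Sum>j. ?f j) = q * ode_series q a b z / (1 + z)"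
    by (simp add: field_simps)
  with d2 show "(ode_series' q a b has_field_derivative q * ode_series q a b z / (1 + z)) (at z)"
    by simp
qed

definition ode_sol :: "real \<Rightarrow> complex \<Rightarrow> complex \<Rightarrow> complex \<Rightarrow> real \<Rightarrow> complex" where
  "ode_sol S w a b s = ode_series (of_real S * w\<^sup>2) a b (of_real ((s - S) / S))"

definition ode_sol' :: "real \<Rightarrow> complex \<Rightarrow> complex \<Rightarrow> complex \<Rightarrow> real \<Rightarrow> complex" where
  "ode_sol' S w a b s = ode_series' (of_real S * w\<^sup>2) a b (of_real ((s - S) / S)) / of_real S"

lemma ode_sol_derivs:
  assumes "0 < s" "s \<le> S"
  shows "(ode_sol S w a b has_vector_derivative ode_sol' S w a b s) (at s within X)"
    and "(ode_sol' S w a b has_vector_derivative w\<^sup>2 / of_real s * ode_sol S w a b s) (at s within X)"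
proof -
  let ?g = "\<lambda>s. complex_of_real ((s - S) / S)"
  have S: "S > 0" using assms by simp
  have n: "norm (?g s) < 1"
    unfolding norm_of_real using assms by (auto simp: abs_if field_simps)
  have g: "(?g has_vector_derivative of_real (1 / S)) (at s within X)"
    by (rule has_vector_derivative_of_real)
       (use S in \<open>auto intro!: derivative_eq_intros simp: has_real_derivative_iff_has_vector_derivative[symmetric]\<close>)
  have "(ode_series (of_real S * w\<^sup>2) a b \<circ> ?g has_vector_derivative
      of_real (1 / S) * ode_series' (of_real S * w\<^sup>2) a b (?g s)) (at s within X)"
    by (rule field_vector_diff_chain_within[OF g])
       (rule has_field_derivative_at_within[OF ode_series_derivs(1)[OF n]])
  thus "(ode_sol S w a b has_vector_derivative ode_sol' S w a b s) (at s within X)"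
    unfolding ode_sol_def[abs_def] ode_sol'_def o_def by simp
  have 2: "(ode_series' (of_real S * w\<^sup>2) a b \<circ> ?g has_vector_derivative
      of_real (1 / S) * (of_real S * w\<^sup>2 * ode_series (of_real S * w\<^sup>2) a b (?g s) / (1 + ?g s))) (at s within X)"
    by (rule field_vector_diff_chain_within[OF g])
       (rule has_field_derivative_at_within[OF ode_series_derivs(2)[OF n]])
  have eq: "1 + ?g s = of_real (s / S)" using S by (simp add: field_simps)
  have "of_real (1 / S) * (of_real S * w\<^sup>2 * ode_sol S w a b s / (1 + ?g s)) / of_real S
     = w\<^sup>2 / of_real s * ode_sol S w a b s"
    unfolding eq using S assms by (simp add: field_simps)
  with has_vector_derivative_divide[OF 2, of "of_real S"]
  show "(ode_sol' S w a b has_vector_derivative w\<^sup>2 / of_real s * ode_sol S w a b s) (at s within X)"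
    unfolding ode_sol'_def[abs_def] ode_sol_def o_def by simp
qed

lemma ode_sol_at_S: "S > 0 \<Longrightarrow> ode_sol S w a b S = a" "S > 0 \<Longrightarrow> ode_sol' S w a b S = b / of_real S"
proof -
  show "S > 0 \<Longrightarrow> ode_sol S w a b S = a"
    unfolding ode_sol_def ode_series_def using powser_zero[of "ode_coeff (of_real S * w\<^sup>2) a b"] by simp
  show "S > 0 \<Longrightarrow> ode_sol' S w a b S = b / of_real S"
    unfolding ode_sol'_def ode_series'_def using powser_zero[of "diffs (ode_coeff (of_real S * w\<^sup>2) a b)"]
    by (simp add: diffs_def)
qed

lemma ode_coeff_measurable [measurable]: "(\<lambda>q. ode_coeff q a b j) \<in> borel_measurable borel"
  by (induction j rule: less_induct) (rename_tac j, case_tac "(undefined, a, b, j)" rule: ode_coeff.cases, auto)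

lemma ode_sol_measurable [measurable]:
  "(\<lambda>w. ode_sol S w a b s) \<in> borel_measurable borel"
  "(\<lambda>w. ode_sol' S w a b s) \<in> borel_measurable borel"
proof -
  have [measurable]: "(\<lambda>w::complex. ode_coeff (of_real S * w\<^sup>2) a b j) \<in> borel_measurable borel" for j
    by (rule measurable_compose[OF _ ode_coeff_measurable]) simp
  show "(\<lambda>w. ode_sol S w a b s) \<in> borel_measurable borel"
    unfolding ode_sol_def ode_series_def by measurable
  show "(\<lambda>w. ode_sol' S w a b s) \<in> borel_measurable borel"
    unfolding ode_sol'_def ode_series'_def diffs_def by measurable
qed

section \<open>Energy estimate for modes with Re w >= 0\<close>

lemma norm_sq_has_real_derivative:
  fixes f :: "real \<Rightarrow> complex"
  assumes "(f has_vector_derivative f') (at s within X)"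
  shows "((\<lambda>s. (norm (f s))\<^sup>2) has_real_derivative 2 * Re (f' * cnj (f s))) (at s within X)"
proof -
  have "((\<lambda>s. f s * cnj (f s)) has_vector_derivative (f s * cnj f' + f' * cnj (f s))) (at s within X)"
    by (rule has_vector_derivative_mult[OF assms has_vector_derivative_cnj[OF assms]])
  from bounded_linear.has_vector_derivative[OF bounded_linear_Re this]
  have "((\<lambda>s. Re (f s * cnj (f s))) has_vector_derivative (2 * Re (f' * cnj (f s)))) (at s within X)"
    by (simp add: algebra_simps)
  thus ?thesis
    unfolding has_real_derivative_iff_has_vector_derivative
    unfolding cmod_power2 by (simp add: power2_eq_square)
qed

text \<open>
  In the travelling-wave variables $D = \sqrt{s}\,e' + we$ and $F = \sqrt{s}\,e' - we$ the equation
  $se'' = w^2 e$ only couples through lower order terms. Since $F$ vanishes at $s_0$, the quantity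
  $|D|^2 - |F|^2$ keeps $F$ strictly below $D$ uniformly in $w$, so $e$ cannot vanish and
  is comparable to $D/w$.
\<close>

lemma wave_mode_estimate:
  fixes e0 e1 :: "real \<Rightarrow> complex"
  assumes s0: "0 < s0" "s0 \<le> S" and w: "w \<noteq> 0" "0 \<le> Re w"
    and d0: "\<And>s. s \<in> {s0..S} \<Longrightarrow> (e0 has_vector_derivative e1 s) (at s)"
    and d1: "\<And>s. s \<in> {s0..S} \<Longrightarrow> (e1 has_vector_derivative w\<^sup>2 / of_real s * e0 s) (at s)"
    and init: "of_real (sqrt s0) * e1 s0 = w * e0 s0" and s: "s \<in> {s0..S}"
  shows "norm (e0 s) \<le> 4 * (S / s0) * exp (- 2 * Re w * (sqrt S - sqrt s)) * norm (e0 S)"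
    and "norm (of_real (sqrt s) * e1 s) \<le> 4 * (S / s0) * norm w * norm (e0 S)"
proof -
  define D where "D s = of_real (sqrt s) * e1 s + w * e0 s" for s
  define F where "F s = of_real (sqrt s) * e1 s - w * e0 s" for s
  define k where "k = Re w"
  have k: "0 \<le> k" using w by (simp add: k_def)
  have S: "0 < S" using s0 by simp
  have X: "of_real (sqrt s) * e1 s = (D s + F s) / 2" for s
    by (simp add: D_def F_def)
  have sq: "of_real (sqrt s) * of_real (sqrt s) = complex_of_real s" if "s > 0" for s
    using that by (metis of_real_mult real_sqrt_mult_self abs_of_pos)
  have dX: "((\<lambda>s. of_real (sqrt s) * e1 s) has_vector_derivative
      (w\<^sup>2 * e0 s / of_real (sqrt s) + (D s + F s) / (4 * of_real s))) (at s)" if "s \<in> {s0..S}" for s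
  proof -
    have sp: "s > 0" using that s0 by auto
    have a: "((\<lambda>s. complex_of_real (sqrt s)) has_vector_derivative of_real (inverse (sqrt s) / 2)) (at s)"
      by (rule has_vector_derivative_of_real)
         (use DERIV_real_sqrt[OF sp] in \<open>simp add: has_real_derivative_iff_has_vector_derivative\<close>)
    have b: "of_real (sqrt s) * (w\<^sup>2 / of_real s * e0 s) = w\<^sup>2 * e0 s / of_real (sqrt s)"
      using sp sq[OF sp, symmetric] by (simp add: field_simps)
    have c: "of_real (inverse (sqrt s) / 2) * e1 s = (D s + F s) / (4 * of_real s)"
      unfolding sq[OF sp, symmetric] using sp X[of s] by (simp add: field_simps)
    show ?thesis
      using has_vector_derivative_mult[OF a d1[OF that]] unfolding b c .
  qed
  have wF: "w * e0 s = (D s - F s) / 2" for s by (simp add: D_def F_def)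
  have dW: "((\<lambda>s. w * e0 s) has_vector_derivative w * ((D s + F s) / 2) / of_real (sqrt s)) (at s)"
    if "s \<in> {s0..S}" for s
    using has_vector_derivative_mult_right[OF d0[OF that], of w] that s0
    unfolding X[symmetric] by simp
  have w2: "w\<^sup>2 * e0 s = w * ((D s - F s) / 2)" for s
    unfolding wF[symmetric] by (simp add: power2_eq_square)
  have dD: "(D has_vector_derivative
      (of_real (1 / sqrt s) * (w * D s) + of_real (1 / (4 * s)) * (D s + F s))) (at s)" if "s \<in> {s0..S}" for s
    using has_vector_derivative_add[OF dX[OF that] dW[OF that]]
    unfolding D_def[symmetric] w2 
    by (rule back_subst[where P="\<lambda>y. (_ has_vector_derivative y) (at s)"]) (simp add: divide_simps, simp add: algebra_simps)
  have dF: "(F has_vector_derivative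
      (- of_real (1 / sqrt s) * (w * F s) + of_real (1 / (4 * s)) * (D s + F s))) (at s)" if "s \<in> {s0..S}" for s
    using has_vector_derivative_diff[OF dX[OF that] dW[OF that]]
    unfolding F_def[symmetric] w2 
    by (rule back_subst[where P="\<lambda>y. (_ has_vector_derivative y) (at s)"]) (simp add: divide_simps, simp add: algebra_simps)
  define r where "r s = Re (F s * cnj (D s))" for s
  have ReD: "Re ((of_real (1 / sqrt s) * (w * D s) + of_real (1 / (4 * s)) * (D s + F s)) * cnj (D s))
      = k / sqrt s * (norm (D s))\<^sup>2 + ((norm (D s))\<^sup>2 + r s) / (4 * s)" for s
    unfolding distrib_right mult.assoc plus_complex.sel Re_complex_of_real
    unfolding cmod_power2 r_def k_def by (simp add: power2_eq_square algebra_simps add_divide_distrib)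
  have ReF: "Re ((- of_real (1 / sqrt s) * (w * F s) + of_real (1 / (4 * s)) * (D s + F s)) * cnj (F s))
      = - k / sqrt s * (norm (F s))\<^sup>2 + ((norm (F s))\<^sup>2 + r s) / (4 * s)" for s
    unfolding distrib_right mult.assoc plus_complex.sel Re_complex_of_real
    unfolding cmod_power2 r_def k_def by (simp add: power2_eq_square algebra_simps add_divide_distrib)
  have nD: "((\<lambda>s. (norm (D s))\<^sup>2) has_real_derivative
     2 * (k / sqrt s * (norm (D s))\<^sup>2 + ((norm (D s))\<^sup>2 + r s) / (4 * s))) (at s)" if "s \<in> {s0..S}" for s
    using norm_sq_has_real_derivative[OF dD[OF that]] unfolding ReD .
  have nF: "((\<lambda>s. (norm (F s))\<^sup>2) has_real_derivative
     2 * (- k / sqrt s * (norm (F s))\<^sup>2 + ((norm (F s))\<^sup>2 + r s) / (4 * s))) (at s)" if "s \<in> {s0..S}" for s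
    using norm_sq_has_real_derivative[OF dF[OF that]] unfolding ReF .
  define Del where "Del s = (norm (D s))\<^sup>2 - (norm (F s))\<^sup>2" for s
  \<comment> \<open>\<open>E\<close> removes the growth rate 2k/sqrt s of |D|^2, whose
    antiderivative is 4k sqrt s.\<close>
  define E where "E s = exp (- 4 * k * sqrt s)" for s
  have E: "E s > 0" for s by (simp add: E_def)
  have dE: "(E has_real_derivative - 2 * k / sqrt s * E s) (at s)" if "s > 0" for s
    unfolding E_def using that by (auto intro!: derivative_eq_intros simp: field_simps)
  have dDel: "(Del has_real_derivative
      2 * k / sqrt s * ((norm (D s))\<^sup>2 + (norm (F s))\<^sup>2) + Del s / (2 * s)) (at s)" if "s \<in> {s0..S}" for s
    using DERIV_diff[OF nD[OF that] nF[OF that]]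
    unfolding Del_def by (rule back_subst[where P="\<lambda>y. (_ has_real_derivative y) (at s)"]) (use that s0 in \<open>simp add: field_simps\<close>)
  have F0: "F s0 = 0" using init by (simp add: F_def)
  \<comment> \<open>The factor 1/sqrt s compensates the term Del/(2s) of the derivative; what
    remains is a nonnegative multiple of |F|^2.\<close>
  have Delmono: "Del a * E a / sqrt a \<le> Del b * E b / sqrt b" if ab: "s0 \<le> a" "a \<le> b" "b \<le> S" for a b
  proof (rule DERIV_nonneg_imp_nondecreasing[OF ab(2)])
    fix s assume "a \<le> s" "s \<le> b"
    hence ss: "s \<in> {s0..S}" and sp: "s > 0" using ab s0 by auto
    have root: "sqrt s * sqrt s = s" using sp by simp
    have "((\<lambda>s. Del s * E s / sqrt s) has_real_derivative
       (4 * k / sqrt s * (norm (F s))\<^sup>2 * E s / sqrt s)) (at s)"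
    proof -
      have "((\<lambda>s. (Del s * E s) * inverse (sqrt s)) has_real_derivative
        ((2 * k / sqrt s * ((norm (D s))\<^sup>2 + (norm (F s))\<^sup>2) + Del s / (2 * s)) * E s
          + (- 2 * k / sqrt s * E s) * Del s) * inverse (sqrt s)
        + (- (inverse (sqrt s) * (inverse (sqrt s) / 2) * inverse (sqrt s))) * (Del s * E s)) (at s)"
        using sp by (intro DERIV_mult dDel[OF ss] dE[OF sp] DERIV_inverse' DERIV_real_sqrt) auto
      moreover have "((2 * k / sqrt s * (a + b) + (a - b) / (2 * s)) * E s + (- 2 * k / sqrt s * E s) * (a - b)) * inverse (sqrt s)
        + (- (inverse (sqrt s) * (inverse (sqrt s) / 2) * inverse (sqrt s))) * ((a - b) * E s)
         = 4 * k / sqrt s * b * E s / sqrt s" for a b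
      proof -
        define i where "i = inverse (sqrt s)"
        have ii: "inverse s = i * i"
          unfolding i_def using root by (metis inverse_mult_distrib)
        show ?thesis
          unfolding divide_inverse inverse_mult_distrib i_def[symmetric] ii by (simp add: algebra_simps)
      qed
      ultimately show ?thesis unfolding Del_def divide_inverse by metis
    qed
    moreover have "4 * k / sqrt s * (norm (F s))\<^sup>2 * E s / sqrt s \<ge> 0"
      using k sp E[of s] by simp
    ultimately show "\<exists>y. ((\<lambda>s. Del s * E s / sqrt s) has_real_derivative y) (at s) \<and> 0 \<le> y" by blast
  qed
  have Del0: "Del s \<ge> 0" if "s \<in> {s0..S}" for s
  proof -
    have "0 \<le> Del s0 * E s0 / sqrt s0" using E[of s0] s0 by (simp add: Del_def F0)
    also have "\<dots> \<le> Del s * E s / sqrt s" using that by (intro Delmono) auto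
    finally show ?thesis using E[of s] that s0 by (simp add: zero_le_divide_iff zero_le_mult_iff)
  qed
  have rle: "r s \<le> (norm (D s))\<^sup>2" if "s \<in> {s0..S}" for s
  proof -
    have "r s \<le> norm (F s) * norm (D s)"
        unfolding r_def using complex_Re_le_cmod[of "F s * cnj (D s)"] by (simp add: norm_mult)
    moreover have "norm (F s) \<le> norm (D s)" 
    by (rule power2_le_imp_le) (use Del0[OF that] in \<open>auto simp: Del_def\<close>)
    hence "norm (F s) * norm (D s) \<le> norm (D s) * norm (D s)" by (rule mult_right_mono) simp
    ultimately show ?thesis unfolding power2_eq_square by linarith
  qed
  \<comment> \<open>The opposite direction: after division by s the derivative is a multiple of r -
    |D|^2, which is nonpositive because |F| <= |D|. Now Del from below and |D|^2 from above are both
    compared with the value at s0.\<close>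
  have Dmono: "(norm (D b))\<^sup>2 * E b / b \<le> (norm (D a))\<^sup>2 * E a / a" if ab: "s0 \<le> a" "a \<le> b" "b \<le> S" for a b
  proof (rule DERIV_nonpos_imp_nonincreasing[OF ab(2)])
    fix s assume "a \<le> s" "s \<le> b"
    hence ss: "s \<in> {s0..S}" and sp: "s > 0" using ab s0 by auto
    have "((\<lambda>s. (norm (D s))\<^sup>2 * E s / s) has_real_derivative
       ((r s - (norm (D s))\<^sup>2) / (2 * s) * E s / s)) (at s)"
    proof -
      have "((\<lambda>s. ((norm (D s))\<^sup>2 * E s) * inverse s) has_real_derivative
        ((2 * (k / sqrt s * (norm (D s))\<^sup>2 + ((norm (D s))\<^sup>2 + r s) / (4 * s))) * E s
          + (- 2 * k / sqrt s * E s) * (norm (D s))\<^sup>2) * inverse s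
        + (- (inverse s * 1 * inverse s)) * ((norm (D s))\<^sup>2 * E s)) (at s)"
        using sp by (intro DERIV_mult nD[OF ss] dE[OF sp] DERIV_inverse' DERIV_ident) auto
      moreover have "((2 * (k / sqrt s * a + (a + r s) / (4 * s))) * E s + (- 2 * k / sqrt s * E s) * a) * inverse s
        + (- (inverse s * 1 * inverse s)) * (a * E s)
         = (r s - a) / (2 * s) * E s / s" for a
        unfolding divide_inverse inverse_mult_distrib by (simp add: algebra_simps)
      ultimately show ?thesis unfolding divide_inverse by metis
    qed
    moreover have "(r s - (norm (D s))\<^sup>2) / (2 * s) * E s / s \<le> 0"
      using rle[OF ss] sp E[of s] by (simp add: divide_le_0_iff mult_le_0_iff)
    ultimately show "\<exists>y. ((\<lambda>s. (norm (D s))\<^sup>2 * E s / s) has_real_derivative y) (at s) \<and> y \<le> 0" by blast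
  qed
  define d where "d = (norm (D s0))\<^sup>2 * E s0"
  have d: "0 \<le> d" using E[of s0] by (simp add: d_def)
  have up: "(norm (D s))\<^sup>2 * E s \<le> d * (s / s0)" if "s \<in> {s0..S}" for s
    using Dmono[of s0 s] that s0 by (simp add: d_def field_simps)
  have lo: "d * sqrt (S / s0) \<le> Del S * E S"
    using Delmono[of s0 S] s0 by (simp add: d_def Del_def F0 real_sqrt_divide field_simps)
  have loD: "d \<le> (norm (D S))\<^sup>2 * E S"
  proof -
    have "d * 1 \<le> d * sqrt (S / s0)" using d s0 by (intro mult_left_mono) auto
    also have "\<dots> \<le> (norm (D S))\<^sup>2 * E S"
    proof -
      have "Del S * E S \<le> (norm (D S))\<^sup>2 * E S"
        using E[of S] by (intro mult_right_mono) (auto simp: Del_def)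
      thus ?thesis using lo by linarith
    qed
    finally show ?thesis by simp
  qed
  \<comment> \<open>\<open>q\<close> is the quotient of the lower bound d sqrt(S/s0) for Del S * E S
    and the upper bound d S/s0 for |D S|^2 * E S. It yields |F S|^2 <= (1 - q) |D S|^2, a gap
    independent of w.\<close>
  define q where "q = sqrt (s0 / S)"
  have q: "0 < q" "q \<le> 1" "q * sqrt (S / s0) = 1" "q * q = s0 / S"
    using s0 by (auto simp: q_def real_sqrt_mult[symmetric])
  have "(norm (D S))\<^sup>2 * q * E S \<le> Del S * E S"
  proof -
    have "(norm (D S))\<^sup>2 * E S * q \<le> d * (S / s0) * q"
      using up[of S] s0 q by (intro mult_right_mono) auto
    moreover have "(S / s0) * q = sqrt (S / s0)"
    proof -
      have "(S / s0) * q = sqrt (S / s0) * (q * sqrt (S / s0))"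
        using s0 by (simp add: mult_ac real_sqrt_mult_self)
      thus ?thesis using q(3) by simp
    qed
    hence "d * (S / s0) * q = d * sqrt (S / s0)" by (metis mult.assoc)
    ultimately have "(norm (D S))\<^sup>2 * E S * q \<le> Del S * E S" using lo by linarith
    thus ?thesis by (metis mult.assoc mult.commute)
  qed
  hence "(norm (D S))\<^sup>2 * q \<le> (norm (D S))\<^sup>2 - (norm (F S))\<^sup>2"
    using E[of S] by (simp add: Del_def)
  hence "(norm (F S))\<^sup>2 \<le> (norm (D S))\<^sup>2 * (1 - q)" unfolding right_diff_distrib by linarith
  also have "\<dots> \<le> (norm (D S))\<^sup>2 * (1 - q / 2)\<^sup>2"
  proof (rule mult_left_mono)
    have "(1 - q / 2)\<^sup>2 = 1 - q + (q / 2)\<^sup>2" by (simp add: power2_eq_square algebra_simps)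
    thus "1 - q \<le> (1 - q / 2)\<^sup>2" using zero_le_power2[of "q / 2"] by linarith
  qed simp
  finally have "norm (F S) \<le> norm (D S) * (1 - q / 2)"
    by (rule power2_le_imp_le[OF ord_le_eq_trans]) (use q in \<open>auto simp: power_mult_distrib\<close>)
  \<comment> \<open>Since 2 w e0 = D - F, the gap between |D S| and |F S| lets e0(S) control
    D(S).\<close>
  moreover have "norm (D S) - norm (F S) \<le> 2 * (norm w * norm (e0 S))"
  proof -
    have "norm w * norm (e0 S) = norm (D S - F S) / 2"
      unfolding norm_mult[symmetric] wF by (simp add: norm_divide)
    thus ?thesis using norm_triangle_ineq2[of "D S" "F S"] by linarith
  qed
  ultimately have "norm (D S) * (q / 2) \<le> 2 * (norm w * norm (e0 S))"
    unfolding right_diff_distrib by linarith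
  hence DS: "norm (D S) \<le> 4 / q * (norm w * norm (e0 S))"
    using q by (simp add: field_simps)
  \<comment> \<open>The bound travels from S to s by way of s0, with \<open>loD\<close> and then
    \<open>up\<close>; the quotient E S / E s is the decay.\<close>
  have Ds: "norm (D s) \<le> norm (D S) * (1 / q * exp (- 2 * k * (sqrt S - sqrt s)))"
  proof (rule power2_le_imp_le)
    have "(norm (D s))\<^sup>2 * E s \<le> d * (s / s0)" using up[OF s] .
    also have "\<dots> \<le> d * (S / s0)" using s s0 d by (intro mult_left_mono divide_right_mono) auto
    also have "\<dots> \<le> (norm (D S))\<^sup>2 * E S * (S / s0)"
      using loD s0 by (intro mult_right_mono) auto
    finally have "(norm (D s))\<^sup>2 \<le> ((norm (D S))\<^sup>2 * E S * (S / s0)) / E s"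
      using E[of s] by (simp only: pos_le_divide_eq)
    also have "\<dots> = (norm (D S))\<^sup>2 * (S / s0) * (E S / E s)" by simp
    also have "E S / E s = (exp (- 2 * k * (sqrt S - sqrt s)))\<^sup>2"
      unfolding E_def exp_diff[symmetric] exp_double[symmetric] by (simp add: algebra_simps)
    also have "S / s0 = (1 / q)\<^sup>2" using q(1,4) s0 by (simp add: power2_eq_square field_simps)
    finally show "(norm (D s))\<^sup>2 \<le> (norm (D S) * (1 / q * exp (- 2 * k * (sqrt S - sqrt s))))\<^sup>2"
      unfolding power_mult_distrib by (simp only: mult.assoc)
    show "0 \<le> norm (D S) * (1 / q * exp (- 2 * k * (sqrt S - sqrt s)))" using q by simp
  qed
  also have "\<dots> \<le> (4 / q * (norm w * norm (e0 S))) * (1 / q * exp (- 2 * k * (sqrt S - sqrt s)))"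
    using q by (intro mult_right_mono DS) auto
  also have "\<dots> = (4 / (q * q)) * exp (- 2 * k * (sqrt S - sqrt s)) * (norm w * norm (e0 S))"
    by (simp add: field_simps)
  also have "4 / (q * q) = 4 * (S / s0)" using q(4) by simp
  finally have Ds: "norm (D s) \<le> 4 * (S / s0) * exp (- 2 * k * (sqrt S - sqrt s)) * (norm w * norm (e0 S))" .
  have FD: "norm (F s) \<le> norm (D s)" 
    by (rule power2_le_imp_le) (use Del0[OF s] in \<open>auto simp: Del_def\<close>)
  have "norm w * norm (e0 s) \<le> norm (D s)"
    using norm_triangle_ineq4[of "D s" "F s"] FD
    unfolding norm_mult[symmetric] wF by (simp add: norm_divide)
  with Ds have "norm w * norm (e0 s) \<le> norm w * (4 * (S / s0) * exp (- 2 * k * (sqrt S - sqrt s)) * norm (e0 S))"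
    by (simp add: mult_ac)
  hence "norm (e0 s) \<le> 4 * (S / s0) * exp (- 2 * k * (sqrt S - sqrt s)) * norm (e0 S)"
    by (rule mult_left_le_imp_le) (use w in simp)
  thus "norm (e0 s) \<le> 4 * (S / s0) * exp (- 2 * Re w * (sqrt S - sqrt s)) * norm (e0 S)"
    unfolding k_def .
  have "norm (of_real (sqrt s) * e1 s) \<le> norm (D s)"
    using norm_triangle_ineq[of "D s" "F s"] FD
    unfolding X by (simp add: norm_divide)
  also note Ds
  also have "4 * (S / s0) * exp (- 2 * k * (sqrt S - sqrt s)) * (norm w * norm (e0 S))
      \<le> 4 * (S / s0) * 1 * (norm w * norm (e0 S))"
    using k s s0 by (intro mult_right_mono mult_left_mono) auto
  finally show "norm (of_real (sqrt s) * e1 s) \<le> 4 * (S / s0) * norm w * norm (e0 S)"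
    by (simp add: mult_ac)
qed

text \<open>The normalised solution of $se'' = w^2e$, $e(S)=1$, $\sqrt{s_0}\,e'(s_0) = w\,e(s_0)$.\<close>

definition mode_slope :: "real \<Rightarrow> real \<Rightarrow> complex \<Rightarrow> complex" where
  "mode_slope s0 S w = - (of_real (sqrt s0) * ode_sol' S w 1 0 s0 - w * ode_sol S w 1 0 s0)
     / (of_real (sqrt s0) * ode_sol' S w 0 1 s0 - w * ode_sol S w 0 1 s0)"

definition mode :: "real \<Rightarrow> real \<Rightarrow> complex \<Rightarrow> real \<Rightarrow> complex" where
  "mode s0 S w s = ode_sol S w 1 0 s + mode_slope s0 S w * ode_sol S w 0 1 s"

definition mode' :: "real \<Rightarrow> real \<Rightarrow> complex \<Rightarrow> real \<Rightarrow> complex" where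
  "mode' s0 S w s = ode_sol' S w 1 0 s + mode_slope s0 S w * ode_sol' S w 0 1 s"

lemma mode_measurable [measurable]:
  "(\<lambda>w. mode s0 S w s) \<in> borel_measurable borel" "(\<lambda>w. mode' s0 S w s) \<in> borel_measurable borel"
  unfolding mode_def mode'_def mode_slope_def by measurable

lemma mode_derivs:
  assumes "0 < s" "s \<le> S"
  shows "(mode s0 S w has_vector_derivative mode' s0 S w s) (at s within X)"
    and "(mode' s0 S w has_vector_derivative w\<^sup>2 / of_real s * mode s0 S w s) (at s within X)"
proof -
  show "(mode s0 S w has_vector_derivative mode' s0 S w s) (at s within X)"
    unfolding mode_def[abs_def] mode'_def
    by (intro has_vector_derivative_add has_vector_derivative_mult_right ode_sol_derivs assms)
  have "((\<lambda>s. ode_sol' S w 1 0 s + mode_slope s0 S w * ode_sol' S w 0 1 s) has_vector_derivative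
     (w\<^sup>2 / of_real s * ode_sol S w 1 0 s + mode_slope s0 S w * (w\<^sup>2 / of_real s * ode_sol S w 0 1 s))) (at s within X)"
    by (intro has_vector_derivative_add has_vector_derivative_mult_right ode_sol_derivs assms)
  thus "(mode' s0 S w has_vector_derivative w\<^sup>2 / of_real s * mode s0 S w s) (at s within X)"
    unfolding mode_def mode'_def[abs_def] by (simp add: algebra_simps)
qed

lemma mode_at_S: "S > 0 \<Longrightarrow> mode s0 S w S = 1"
  by (simp add: mode_def ode_sol_at_S)

text \<open>The denominator of \<open>mode_slope\<close> cannot vanish: otherwise the solution with
  e(S) = 0 and e'(S) = 1/S would satisfy the condition at s0, and the estimate would bound its slope
  at S by a multiple of e(S) = 0.\<close>

lemma mode_init:
  assumes "0 < s0" "s0 \<le> S" "w \<noteq> 0" "0 \<le> Re w"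
  shows "of_real (sqrt s0) * mode' s0 S w s0 = w * mode s0 S w s0"
proof -
  have nz: "of_real (sqrt s0) * ode_sol' S w 0 1 s0 - w * ode_sol S w 0 1 s0 \<noteq> 0"
  proof
    assume "of_real (sqrt s0) * ode_sol' S w 0 1 s0 - w * ode_sol S w 0 1 s0 = 0"
    hence "norm (of_real (sqrt S) * ode_sol' S w 0 1 S) \<le> 4 * (S / s0) * norm w * norm (ode_sol S w 0 1 S)"
      using assms by (intro wave_mode_estimate(2)[OF assms(1-4)] ode_sol_derivs) auto
    thus False using assms by (simp add: ode_sol_at_S)
  qed
  have "mode_slope s0 S w * (of_real (sqrt s0) * ode_sol' S w 0 1 s0 - w * ode_sol S w 0 1 s0)
     = - (of_real (sqrt s0) * ode_sol' S w 1 0 s0 - w * ode_sol S w 1 0 s0)"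
    using nz by (simp add: mode_slope_def)
  thus ?thesis by (simp add: mode_def mode'_def algebra_simps)
qed

lemma ode_coeff_0: "ode_coeff 0 a b (Suc (Suc j)) = 0"
  by (induction j) auto

text \<open>The estimate, which divides by w, says nothing at w = 0. There the series with data 1, 0
  is constant, the numerator of \<open>mode_slope\<close> is 0, and so is the quotient, whatever the
  denominator.\<close>

lemma mode_zero: "S > 0 \<Longrightarrow> mode s0 S 0 s = 1" "S > 0 \<Longrightarrow> mode' s0 S 0 s = 0"
proof -
  have c: "ode_coeff 0 1 0 j = (if j = 0 then 1 else 0)" for j
    by (cases "(0::complex, 1::complex, 0::complex, j)" rule: ode_coeff.cases) (auto simp: ode_coeff_0 simp del: ode_coeff.simps(3))
  have "ode_sol S 0 1 0 s = 1"
    unfolding ode_sol_def ode_series_def using powser_zero[of "\<lambda>j. if j = 0 then 1 else (0::complex)"]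
    by (simp add: c if_distrib[of "\<lambda>x. x * _"] cong: if_cong)
  moreover have d: "diffs (ode_coeff 0 1 0) = (\<lambda>j. 0)"
    by (simp add: diffs_def c fun_eq_iff)
  have ode_sol': "ode_sol' S 0 1 0 s = 0" for s
    unfolding ode_sol'_def ode_series'_def by (simp add: d)
  ultimately show "S > 0 \<Longrightarrow> mode s0 S 0 s = 1" "S > 0 \<Longrightarrow> mode' s0 S 0 s = 0"
    by (simp_all add: mode_def mode'_def mode_slope_def ode_sol')
qed

lemma mode_bounds:
  assumes "0 < s0" "s0 \<le> S" "0 \<le> Re w" "s \<in> {s0..S}"
  shows "norm (mode s0 S w s) \<le> 4 * (S / s0) * exp (- 2 * Re w * (sqrt S - sqrt s))"
    and "norm (mode' s0 S w s) \<le> 4 * (S / s0) / sqrt s0 * norm w"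
proof -
  have S: "S > 0" using assms by simp
  have *: "norm (mode s0 S w s) \<le> 4 * (S / s0) * exp (- 2 * Re w * (sqrt S - sqrt s)) \<and>
     norm (mode' s0 S w s) \<le> 4 * (S / s0) / sqrt s0 * norm w"
  proof (cases "w = 0")
    case True
    thus ?thesis using assms S by (simp add: mode_zero divide_simps)
  next
    case False
    note est = wave_mode_estimate[OF assms(1,2) False assms(3), of "mode s0 S w" "mode' s0 S w",
        OF mode_derivs(1) mode_derivs(2) mode_init[OF assms(1,2) False assms(3)] assms(4)]
    have 1: "norm (mode s0 S w s) \<le> 4 * (S / s0) * exp (- 2 * Re w * (sqrt S - sqrt s))"
      using est(1) assms by (simp add: mode_at_S[OF S])
    have "norm (of_real (sqrt s) * mode' s0 S w s) \<le> 4 * (S / s0) * norm w"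
      using est(2) assms by (simp add: mode_at_S[OF S])
    hence "sqrt s * norm (mode' s0 S w s) \<le> 4 * (S / s0) * norm w"
      using assms by (simp add: norm_mult)
    moreover have "sqrt s0 * norm (mode' s0 S w s) \<le> sqrt s * norm (mode' s0 S w s)"
      using assms by (intro mult_right_mono) auto
    ultimately have "sqrt s0 * norm (mode' s0 S w s) \<le> 4 * (S / s0) * norm w" by linarith
    hence "norm (mode' s0 S w s) \<le> 4 * (S / s0) / sqrt s0 * norm w"
      using assms(1) by (simp add: pos_le_divide_eq mult.commute)
    thus ?thesis using 1 by blast
  qed
  show "norm (mode s0 S w s) \<le> 4 * (S / s0) * exp (- 2 * Re w * (sqrt S - sqrt s))"
    and "norm (mode' s0 S w s) \<le> 4 * (S / s0) / sqrt s0 * norm w"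
    using * by auto
qed

section \<open>The radial factor of a mode\<close>

text \<open>The hypergeometric function ${}_0F_1(;\nu;z)$.\<close>

definition J01 :: "real \<Rightarrow> complex \<Rightarrow> complex" where
  "J01 \<nu> z = (\<Sum>j. z ^ j / of_real (fact j * pochhammer \<nu> j))"

lemma pochhammer_lower:
  fixes \<nu> :: real
  assumes "\<nu> > 0"
  shows "\<nu> ^ j \<le> pochhammer \<nu> j"
proof (induction j)
  case (Suc j)
  have "\<nu> ^ j * \<nu> \<le> pochhammer \<nu> j * (\<nu> + real j)"
    using assms by (intro mult_mono Suc.IH pochhammer_nonneg) auto
  thus ?case by (simp add: pochhammer_Suc mult.commute)
qed simp

text \<open>At nu = 1/2 this is the equality (2j)! = 4^j j! (1/2)_j, which expresses 0F1(;1/2;z) =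
  cosh(2 sqrt z); a larger nu only increases the Pochhammer symbol.\<close>

lemma pochhammer_lower_half:
  fixes \<nu> :: real
  assumes "\<nu> \<ge> 1 / 2"
  shows "fact (2 * j) \<le> 4 ^ j * fact j * pochhammer \<nu> j"
proof (induction j)
  case (Suc j)
  have "fact (2 * Suc j) = (real (2 * j + 2) * real (2 * j + 1)) * fact (2 * j)"
    by (simp add: algebra_simps)
  also have "\<dots> \<le> (real (2 * j + 2) * real (2 * j + 1)) * (4 ^ j * fact j * pochhammer \<nu> j)"
    by (intro mult_left_mono Suc.IH) auto
  also have "\<dots> \<le> (real (2 * j + 2) * (2 * (\<nu> + real j))) * (4 ^ j * fact j * pochhammer \<nu> j)"
    using assms by (intro mult_right_mono mult_left_mono mult_nonneg_nonneg pochhammer_nonneg) auto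
  also have "\<dots> = 4 ^ Suc j * fact (Suc j) * pochhammer \<nu> (Suc j)"
    by (simp add: pochhammer_Suc algebra_simps)
  finally show ?case .
qed simp

lemma J01_norm_term:
  fixes z :: complex
  assumes "\<nu> > 0"
  shows "norm (z ^ j / of_real (fact j * pochhammer \<nu> j)) \<le> (norm z / \<nu>) ^ j / fact j"
proof -
  have p: "\<nu> ^ j > 0" "\<nu> ^ j \<le> pochhammer \<nu> j" using assms pochhammer_lower by auto
  have "norm (z ^ j / of_real (fact j * pochhammer \<nu> j)) = norm z ^ j / (fact j * pochhammer \<nu> j)"
    using p by (simp add: norm_divide norm_power norm_mult del: of_real_mult)
  also have "\<dots> \<le> norm z ^ j / (fact j * \<nu> ^ j)"
    using p by (intro divide_left_mono mult_left_mono mult_pos_pos) auto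
  finally show ?thesis by (simp add: power_divide mult.commute)
qed

lemma J01_summable_norm:
  fixes z :: complex
  assumes "\<nu> > 0"
  shows "summable (\<lambda>j. norm (z ^ j / of_real (fact j * pochhammer \<nu> j)))"
  by (rule summable_comparison_test'[OF summable_exp_generic[of "norm z / \<nu>"], where N=0])
     (use J01_norm_term[OF assms] in \<open>simp add: divide_inverse_commute\<close>)

lemma J01_summable: "\<nu> > 0 \<Longrightarrow> summable (\<lambda>j. z ^ j / complex_of_real (fact j * pochhammer \<nu> j))"
  using J01_summable_norm by (rule summable_norm_cancel)

text \<open>The bound for N to infinity: at nu = N/2 and z = (N/2) x it does not depend on
  N.\<close>

lemma J01_norm_le_exp:
  assumes "\<nu> > 0"
  shows "norm (J01 \<nu> z) \<le> exp (norm z / \<nu>)"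
proof -
  have "norm (J01 \<nu> z) \<le> (\<Sum>j. norm (z ^ j / of_real (fact j * pochhammer \<nu> j)))"
    unfolding J01_def by (rule summable_norm[OF J01_summable_norm[OF assms]])
  also have "\<dots> \<le> (\<Sum>j. (norm z / \<nu>) ^ j / fact j)"
    using summable_exp_generic[of "norm z / \<nu>"]
    by (intro suminf_le J01_norm_term J01_summable_norm assms) (simp add: divide_inverse_commute)
  also have "\<dots> = exp (norm z / \<nu>)"
    unfolding exp_def by (simp add: divide_inverse_commute)
  finally show ?thesis .
qed

text \<open>The bound for fixed N: if |z| grows like |xi|^2, the value grows only exponentially in
  |xi|. The series is dominated by the even terms of the exponential series of 2 sqrt|z|.\<close>

lemma J01_norm_le_exp_sqrt:
  assumes "\<nu> \<ge> 1 / 2"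
  shows "norm (J01 \<nu> z) \<le> exp (2 * sqrt (norm z))"
proof -
  have \<nu>: "\<nu> > 0" using assms by simp
  let ?a = "\<lambda>j. (2 * sqrt (norm z)) ^ j / fact j"
  have sa: "summable ?a" using summable_exp_generic[of "2 * sqrt (norm z)"] by (simp add: divide_inverse_commute)
  have t: "norm (z ^ j / of_real (fact j * pochhammer \<nu> j)) \<le> ?a (2 * j)" for j
  proof -
    have p: "pochhammer \<nu> j > 0" using \<nu> by (rule pochhammer_pos)
    have "norm (z ^ j / of_real (fact j * pochhammer \<nu> j)) = norm z ^ j / (fact j * pochhammer \<nu> j)"
      using p by (simp add: norm_divide norm_power norm_mult del: of_real_mult)
    also have "\<dots> = 4 ^ j * norm z ^ j / (4 ^ j * fact j * pochhammer \<nu> j)" by simp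
    also have "\<dots> \<le> 4 ^ j * norm z ^ j / fact (2 * j)"
      using p by (intro divide_left_mono pochhammer_lower_half assms mult_pos_pos) auto
    also have "4 ^ j * norm z ^ j = (2 * sqrt (norm z)) ^ (2 * j)"
      by (simp add: power_mult power_mult_distrib)
    finally show ?thesis .
  qed
  have sa2: "summable (\<lambda>j. ?a (2 * j))" and le: "(\<Sum>j. ?a (2 * j)) \<le> (\<Sum>j. ?a j)"
  proof -
    have nn: "?a j \<ge> 0" for j by simp
    have part: "(\<Sum>j<n. ?a (2 * j)) \<le> (\<Sum>j. ?a j)" for n
    proof -
      have "(\<Sum>j<n. ?a (2 * j)) = sum ?a ((\<lambda>j. 2 * j) ` {..<n})"
        by (subst sum.reindex) (auto simp: inj_on_def)
      also have "\<dots> \<le> (\<Sum>j. ?a j)" by (rule sum_le_suminf[OF sa]) auto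
      finally show ?thesis .
    qed
    show s2: "summable (\<lambda>j. ?a (2 * j))"
      by (rule summableI_nonneg_bounded[OF _ part]) simp
    show "(\<Sum>j. ?a (2 * j)) \<le> (\<Sum>j. ?a j)"
      by (rule suminf_le_const[OF s2 part])
  qed
  have "norm (J01 \<nu> z) \<le> (\<Sum>j. norm (z ^ j / of_real (fact j * pochhammer \<nu> j)))"
    unfolding J01_def by (rule summable_norm[OF J01_summable_norm[OF \<nu>]])
  also have "\<dots> \<le> (\<Sum>j. ?a (2 * j))"
    by (intro suminf_le t J01_summable_norm \<nu> sa2)
  also note le
  also have "(\<Sum>j. ?a j) = exp (2 * sqrt (norm z))"
    unfolding exp_def by (simp add: divide_inverse_commute)
  finally show ?thesis .
qed

lemma J01_has_field_derivative:
  assumes "\<nu> > 0"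
  shows "(J01 \<nu> has_field_derivative J01 (\<nu> + 1) z / of_real \<nu>) (at z)"
proof -
  define c where "c j = inverse (complex_of_real (fact j * pochhammer \<nu> j))" for j
  have s: "summable (\<lambda>j. c j * z ^ j)" for z
    using J01_summable[OF assms, of z] by (simp add: c_def divide_inverse mult.commute)
  have "((\<lambda>z. \<Sum>j. c j * z ^ j) has_field_derivative (\<Sum>j. diffs c j * z ^ j)) (at z)"
    by (rule termdiffs_strong_converges_everywhere[OF s])
  moreover have "(\<lambda>z. \<Sum>j. c j * z ^ j) = J01 \<nu>"
    unfolding J01_def by (simp add: c_def divide_inverse mult.commute fun_eq_iff)
  moreover have "diffs c j * z ^ j = (z ^ j / of_real (fact j * pochhammer (\<nu> + 1) j)) / of_real \<nu>" for j
  proof -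
    have "pochhammer \<nu> (Suc j) = \<nu> * pochhammer (\<nu> + 1) j" by (rule pochhammer_rec)
    thus ?thesis using assms
      by (simp add: diffs_def c_def divide_inverse del: of_nat_Suc)
  qed
  hence "(\<Sum>j. diffs c j * z ^ j) = J01 (\<nu> + 1) z / of_real \<nu>"
    unfolding J01_def using suminf_divide[OF J01_summable, of "\<nu> + 1" z "of_real \<nu>"] assms by simp
  ultimately show ?thesis by simp
qed

text \<open>Bessel's equation $zJ'' + \nu J' = J$ as a contiguity relation.\<close>

lemma J01_contiguous:
  assumes "\<nu> > 0"
  shows "z * J01 (\<nu> + 2) z / (of_real \<nu> * of_real (\<nu> + 1)) + J01 (\<nu> + 1) z = J01 \<nu> z"
proof -
  let ?t = "\<lambda>\<nu> j. z ^ j / complex_of_real (fact j * pochhammer \<nu> j)"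
  have s: "(\<lambda>j. ?t (\<nu> + i) j) sums J01 (\<nu> + i) z" if "i \<ge> 0" for i
    unfolding J01_def by (rule summable_sums[OF J01_summable]) (use assms that in simp)
  have eq: "z * ?t (\<nu> + 2) j / (of_real \<nu> * of_real (\<nu> + 1)) = ?t \<nu> (Suc j) - ?t (\<nu> + 1) (Suc j)" for j
  proof -
    have p: "pochhammer (\<nu> + 2) j > 0" using assms by (intro pochhammer_pos) simp
    have p0: "pochhammer \<nu> (Suc (Suc j)) = \<nu> * ((\<nu> + 1) * pochhammer (\<nu> + 2) j)"
      by (simp add: pochhammer_rec[of _ "Suc j"] pochhammer_rec[of _ j] add.assoc)
    have pa: "pochhammer \<nu> (Suc j) = \<nu> * ((\<nu> + 1) * pochhammer (\<nu> + 2) j) / (\<nu> + real j + 1)"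
      using p0 assms unfolding pochhammer_Suc[of _ "Suc j"] by (simp add: field_simps)
    have pb: "pochhammer (\<nu> + 1) (Suc j) = (\<nu> + 1) * pochhammer (\<nu> + 2) j"
      by (simp add: pochhammer_rec[of _ j] add.assoc)
    have "1 / (fact j * pochhammer (\<nu> + 2) j) / (\<nu> * (\<nu> + 1))
        = 1 / (fact (Suc j) * pochhammer \<nu> (Suc j)) - 1 / (fact (Suc j) * pochhammer (\<nu> + 1) (Suc j))"
    proof -
      have "1 / (f * p) / (\<nu> * (\<nu> + 1)) = 1 / ((i * f) * (\<nu> * ((\<nu> + 1) * p) / (\<nu> + i))) - 1 / ((i * f) * ((\<nu> + 1) * p))"
        if "f > 0" "p > 0" "i > 0" for f p i :: real
        using assms that by (simp add: divide_simps add_eq_0_iff)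
      from this[of "fact j" "pochhammer (\<nu> + 2) j" "real j + 1"] p
      show ?thesis unfolding pa pb by (simp add: add_ac)
    qed
    hence "z ^ Suc j * complex_of_real (1 / (fact j * pochhammer (\<nu> + 2) j) / (\<nu> * (\<nu> + 1)))
       = z ^ Suc j * complex_of_real (1 / (fact (Suc j) * pochhammer \<nu> (Suc j)) - 1 / (fact (Suc j) * pochhammer (\<nu> + 1) (Suc j)))"
      by simp
    thus ?thesis unfolding of_real_diff of_real_divide right_diff_distrib by simp
  qed
  have "(\<lambda>j. ?t \<nu> (Suc j) - ?t (\<nu> + 1) (Suc j)) sums (z * J01 (\<nu> + 2) z / (of_real \<nu> * of_real (\<nu> + 1)))"
    unfolding eq[symmetric] using sums_divide[OF sums_mult[OF s[of 2], of z]] by simp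
  \<comment> \<open>The two series agree in their term j = 0, so the shifted difference may start at
    0.\<close>
  hence "(\<lambda>j. ?t \<nu> j - ?t (\<nu> + 1) j) sums (z * J01 (\<nu> + 2) z / (of_real \<nu> * of_real (\<nu> + 1)) + 0)"
    using sums_Suc[of "\<lambda>j. ?t \<nu> j - ?t (\<nu> + 1) j"] by simp
  moreover have "(\<lambda>j. ?t \<nu> j - ?t (\<nu> + 1) j) sums (J01 \<nu> z - J01 (\<nu> + 1) z)"
    using sums_diff[OF s[of 0] s[of 1]] by simp
  ultimately show ?thesis using sums_unique2 by fastforce
qed

lemma J01_measurable [measurable]: "J01 \<nu> \<in> borel_measurable borel"
  unfolding J01_def[abs_def] by measurable

text \<open>Cauchy's integral formula at the centre of the circle |c| = C, applied to the entire
  function that maps c to \<open>J01 \<nu> ((b - c) * r)\<close>.\<close>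

lemma J01_mean_value:
  assumes pos: "\<nu> > 0"
    and True: "C > 0"
  shows "((\<lambda>\<theta>. J01 \<nu> ((b - of_real C * cis (2 * pi * \<theta>)) * r)) has_integral J01 \<nu> (b * r)) {0..1}"
proof -
  define f where "f c = J01 \<nu> ((b - c) * r)" for c
  have d: "(f has_field_derivative - r * (J01 (\<nu> + 1) ((b - c) * r) / of_real \<nu>)) (at c)" for c
  proof -
    have "((\<lambda>c. (b - c) * r) has_field_derivative - r) (at c)"
      by (rule derivative_eq_intros refl | simp)+
    from DERIV_chain2[OF J01_has_field_derivative[OF pos] this]
    show ?thesis unfolding f_def by (simp add: mult.commute)
  qed
  have hol: "f holomorphic_on UNIV"
    by (intro holomorphic_onI) (use d field_differentiable_def field_differentiable_at_within in blast)
  have "((\<lambda>u. f u / (u - 0)) has_contour_integral (2 * of_real pi * \<i> * f 0)) (circlepath 0 C)"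
    by (rule Cauchy_integral_circlepath_simple) (use True in \<open>auto intro: holomorphic_on_subset[OF hol]\<close>)
  hence "((\<lambda>x. f (circlepath 0 C x) / circlepath 0 C x * vector_derivative (circlepath 0 C) (at x within {0..1}))
      has_integral 2 * of_real pi * \<i> * f 0) {0..1}"
    unfolding has_contour_integral_def by simp
  moreover have "f (circlepath 0 C x) / circlepath 0 C x * vector_derivative (circlepath 0 C) (at x within {0..1})
     = (2 * of_real pi * \<i>) * f (of_real C * cis (2 * pi * x))" if "x \<in> {0..1}" for x
  proof -
    have vd: "vector_derivative (circlepath 0 C) (at x within {0..1}) = 2 * pi * \<i> * C * exp (2 * of_real pi * \<i> * x)"
      using that by (intro vector_derivative_circlepath01) auto
    have cp: "circlepath 0 C x = of_real C * cis (2 * pi * x)"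
      by (simp add: circlepath_def part_circlepath_def linepath_def cis_conv_exp mult_ac)
    have ce: "exp (2 * of_real pi * \<i> * x) = cis (2 * pi * x)"
      by (simp add: cis_conv_exp mult_ac)
    show ?thesis unfolding vd cp ce using True by (simp add: field_simps)
  qed
  ultimately have "((\<lambda>x. (2 * of_real pi * \<i>) * f (of_real C * cis (2 * pi * x))) has_integral 2 * of_real pi * \<i> * f 0) {0..1}"
    by (rule has_integral_eq[rotated])
  from has_integral_mult_right[OF this, of "inverse (2 * of_real pi * \<i>)"]
  show ?thesis unfolding mult.assoc[symmetric] by (simp add: f_def field_simps)
qed

lemma pochhammer_ratio_tendsto:
  "(\<lambda>N. (real N / 2) ^ j / pochhammer (real N / 2) j) \<longlonglongrightarrow> 1"
proof (induction j)
  case (Suc j)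
  have "(\<lambda>N. (real N / 2) / (real N / 2 + real j)) \<longlonglongrightarrow> 1"
    by real_asymp
  from tendsto_mult[OF Suc.IH this] show ?case
    unfolding pochhammer_Suc power_Suc2 times_divide_times_eq by simp
qed simp

text \<open>Tannery's theorem: each ratio (N/2)^j / (N/2)_j tends to 1, and
  \<open>J01_norm_term\<close> gives the majorant |z|^j / j!. This is where the exponential of the
  heat flow originates.\<close>

lemma J01_tendsto_exp:
  "(\<lambda>N. J01 (real N / 2) (of_real (real N / 2) * z)) \<longlonglongrightarrow> exp z"
proof -
  define a where "a j N = (of_real (real N / 2) * z) ^ j / complex_of_real (fact j * pochhammer (real N / 2) j)" for j N
  have aeq: "a j N = z ^ j / fact j * of_real ((real N / 2) ^ j / pochhammer (real N / 2) j)" for j N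
    unfolding a_def power_mult_distrib by simp
  have lim: "(\<lambda>N. a j N) \<longlonglongrightarrow> z ^ j / fact j" for j
    unfolding aeq
    using tendsto_mult[OF tendsto_const[of "z ^ j / fact j"] tendsto_of_real[OF pochhammer_ratio_tendsto[of j]]] by simp
  have bound: "norm (a j N) \<le> norm z ^ j / fact j" if "N \<ge> 1" for j N
    using J01_norm_term[of "real N / 2" "of_real (real N / 2) * z" j] that unfolding a_def norm_mult by simp
  have "eventually (\<lambda>(j, N). norm (a j N) \<le> norm z ^ j / fact j) (at_top \<times>\<^sub>F sequentially)"
    unfolding eventually_prod_filter
    using bound eventually_ge_at_top[of "1::nat"] by (intro exI[of _ "\<lambda>_. True"] exI[of _ "\<lambda>N. N \<ge> 1"]) auto
  moreover have "summable (\<lambda>j. norm z ^ j / fact j)"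
    using summable_exp_generic[of "norm z"] by (simp add: divide_inverse_commute)
  ultimately have "(\<lambda>N. suminf (\<lambda>j. a j N)) \<longlonglongrightarrow> (\<Sum>j. z ^ j / fact j)"
    using tannerys_theorem[of a "\<lambda>j. z ^ j / fact j" sequentially "\<lambda>j. norm z ^ j / fact j"] lim by simp
  moreover have "(\<Sum>j. z ^ j / fact j) = exp z"
    unfolding exp_def by (simp add: scaleR_conv_of_real divide_inverse mult.commute)
  ultimately show ?thesis unfolding a_def J01_def by simp
qed

section \<open>Smoothness of integrals with parameters\<close>

lemma shift_coord [simp]: "shift d p (coord d p) = p"
  by (cases p; cases d) (auto simp: vec_eq_iff)

lemma coord_shift [simp]: "coord d (shift d p s) = s"
  by (cases p; cases d) auto

lemma shift_shift [simp]: "shift d (shift d p s) r = shift d p r"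
  by (cases p; cases d) (auto simp: vec_eq_iff)

lemma slice_dom:
  assumes "p \<in> dom T t0 N" "d \<in> dirs N"
  shows "{s. shift d p s \<in> dom T t0 N} = (if d = Dt then {T..t0} else UNIV)"
  using assms by (cases p; cases d) (auto simp: dom_def dirs_def RN_def)

lemma coord_in_slice: "p \<in> \<Omega> \<Longrightarrow> coord d p \<in> {s. shift d p s \<in> \<Omega>}"
  by simp

text \<open>T < t0 makes the time slice a nondegenerate interval, so one-sided derivatives at its
  ends are unique; in every other direction the slice is the whole line.\<close>

lemma pdiff_eqI:
  assumes "T < t0" "p \<in> dom T t0 N" "d \<in> dirs N"
    and "((\<lambda>s. f (shift d p s)) has_vector_derivative f') (at (coord d p) within {s. shift d p s \<in> dom T t0 N})"
  shows "pdiff (dom T t0 N) d f p = f'" "has_pdiff (dom T t0 N) d f p"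
proof -
  show "has_pdiff (dom T t0 N) d f p"
    unfolding has_pdiff_def using assms(4) by (rule differentiableI_vector)
  show "pdiff (dom T t0 N) d f p = f'"
  proof (cases "d = Dt")
    case True
    have "coord d p \<in> {T..t0}"
      using coord_in_slice[OF assms(2), of d] unfolding slice_dom[OF assms(2,3)] using True by simp
    thus ?thesis
      using assms(1,4) True unfolding pdiff_def slice_dom[OF assms(2,3)]
      by (auto intro!: vector_derivative_within_closed_interval)
  next
    case False
    thus ?thesis
      using assms(4) unfolding pdiff_def slice_dom[OF assms(2,3)]
      by (simp add: vector_derivative_at)
  qed
qed

text \<open>A relation with a named candidate for the derivative. In contrast to
  \<open>pdiff\<close> it needs no uniqueness of limits and admits complex values, so sums, products
  and integrals are treated term by term.\<close>

definition pderiv_on :: "('n::finite) pt set \<Rightarrow> 'n dir \<Rightarrow> ('n pt \<Rightarrow> 'b::real_normed_vector) \<Rightarrow> ('n pt \<Rightarrow> 'b) \<Rightarrow> bool" where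
  "pderiv_on \<Omega> d f g \<longleftrightarrow> (\<forall>p\<in>\<Omega>. ((\<lambda>s. f (shift d p s)) has_vector_derivative g p)
      (at (coord d p) within {s. shift d p s \<in> \<Omega>}))"

lemma pderiv_on_cong:
  assumes "pderiv_on \<Omega> d f g" "\<And>p. p \<in> \<Omega> \<Longrightarrow> f p = f2 p"
  shows "pderiv_on \<Omega> d f2 g"
  unfolding pderiv_on_def
proof
  fix p assume p: "p \<in> \<Omega>"
  show "((\<lambda>s. f2 (shift d p s)) has_vector_derivative g p) (at (coord d p) within {s. shift d p s \<in> \<Omega>})"
  proof (rule has_vector_derivative_transform[OF coord_in_slice[OF p]])
    show "((\<lambda>s. f (shift d p s)) has_vector_derivative g p) (at (coord d p) within {s. shift d p s \<in> \<Omega>})"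
      using assms(1) p unfolding pderiv_on_def by blast
    show "f2 (shift d p s) = f (shift d p s)" if "s \<in> {s. shift d p s \<in> \<Omega>}" for s
      using assms(2)[of "shift d p s"] that by simp
  qed
qed

lemma pderiv_on_mult:
  fixes f k :: "('n::finite) pt \<Rightarrow> complex"
  assumes "pderiv_on \<Omega> d f f'" "pderiv_on \<Omega> d k k'"
  shows "pderiv_on \<Omega> d (\<lambda>p. k p * f p) (\<lambda>p. k p * f' p + k' p * f p)"
  unfolding pderiv_on_def
proof
  fix p assume p: "p \<in> \<Omega>"
  note D = assms[unfolded pderiv_on_def, rule_format, OF p]
  show "((\<lambda>s. k (shift d p s) * f (shift d p s)) has_vector_derivative k p * f' p + k' p * f p)
      (at (coord d p) within {s. shift d p s \<in> \<Omega>})"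
    using has_vector_derivative_mult[OF D(2) D(1)] by simp
qed

lemma pderiv_on_pdiff:
  assumes "T < t0" "d \<in> dirs N" "pderiv_on (dom T t0 N) d f g" "p \<in> dom T t0 N"
  shows "pdiff (dom T t0 N) d f p = g p" "has_pdiff (dom T t0 N) d f p"
  using pdiff_eqI[OF assms(1,4,2)] assms(3,4) by (auto simp: pderiv_on_def)

lemma pderiv_on_pdiff2:
  assumes "T < t0" "d \<in> dirs N" "pderiv_on (dom T t0 N) d f g" "pderiv_on (dom T t0 N) d g k" "p \<in> dom T t0 N"
  shows "pdiff (dom T t0 N) d (pdiff (dom T t0 N) d f) p = k p"
  by (rule pderiv_on_pdiff(1)[OF assms(1,2) pderiv_on_cong[OF assms(4)] assms(5)])
     (simp add: pderiv_on_pdiff[OF assms(1,2,3)])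

text \<open>A coinductive form of smoothness: continuous functions that form a family stable under
  all allowed partial derivatives are smooth, and no formula for iterated derivatives is
  required.\<close>

definition deriv_closed :: "real \<Rightarrow> real \<Rightarrow> nat \<Rightarrow> (('n::finite) pt \<Rightarrow> real) set \<Rightarrow> bool" where
  "deriv_closed T t0 N \<F> \<longleftrightarrow> (\<forall>f\<in>\<F>. continuous_on (dom T t0 N) f \<and>
      (\<forall>d\<in>dirs N. \<exists>g\<in>\<F>. pderiv_on (dom T t0 N) d f g))"

lemma deriv_closed_smooth:
  fixes f :: "('n::finite) pt \<Rightarrow> real"
  assumes T: "T < t0" and cl: "deriv_closed T t0 N \<F>" and f: "f \<in> \<F>"
  shows "smooth_on_dom (dirs N) (dom T t0 N) f"
proof -
  \<comment> \<open>An iterated \<open>pdiff\<close> agrees with a member of the family only on the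
    domain, hence the use of \<open>pderiv_on_cong\<close> in each step.\<close>
  have *: "\<exists>g\<in>\<F>. \<forall>p\<in>dom T t0 N. g p = iter_pdiff (dom T t0 N) ds f p" if "set ds \<subseteq> dirs N" for ds
    using that
  proof (induction ds)
    case Nil
    thus ?case using f by (auto simp: iter_pdiff_def)
  next
    case (Cons d ds)
    then obtain g where g: "g \<in> \<F>" "\<And>p. p \<in> dom T t0 N \<Longrightarrow> g p = iter_pdiff (dom T t0 N) ds f p" by auto
    obtain k where k: "k \<in> \<F>" "pderiv_on (dom T t0 N) d g k"
      using cl g(1) Cons.prems unfolding deriv_closed_def by (auto dest!: bspec)
    have "pderiv_on (dom T t0 N) d (iter_pdiff (dom T t0 N) ds f) k"
      by (rule pderiv_on_cong[OF k(2) g(2)])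
    from pderiv_on_pdiff(1)[OF T _ this] Cons.prems k(1) show ?case
      by (auto simp: iter_pdiff_def intro!: bexI[of _ k])
  qed
  show ?thesis
    unfolding smooth_on_dom_def
  proof (intro allI impI conjI ballI)
    fix ds :: "'n dir list" assume ds: "set ds \<subseteq> dirs N"
    from *[OF ds] obtain g where g: "g \<in> \<F>" "\<And>p. p \<in> dom T t0 N \<Longrightarrow> g p = iter_pdiff (dom T t0 N) ds f p" by blast
    show "continuous_on (dom T t0 N) (iter_pdiff (dom T t0 N) ds f)"
      using cl g continuous_on_cong[of "dom T t0 N" _ g "iter_pdiff (dom T t0 N) ds f"]
      unfolding deriv_closed_def by blast
    fix d :: "'n dir" and p :: "'n pt" assume d: "d \<in> dirs N" and p: "p \<in> dom T t0 N"
    obtain k where k: "pderiv_on (dom T t0 N) d g k"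
      using cl g(1) d unfolding deriv_closed_def by blast
    show "has_pdiff (dom T t0 N) d (iter_pdiff (dom T t0 N) ds f) p"
      by (rule pderiv_on_pdiff(2)[OF T d pderiv_on_cong[OF k g(2)] p])
  qed
qed

lemma deriv_closed_add:
  fixes \<F> \<G> :: "(('n::finite) pt \<Rightarrow> real) set"
  assumes "deriv_closed T t0 N \<F>" "deriv_closed T t0 N \<G>"
  shows "deriv_closed T t0 N {\<lambda>p. f p + g p | f g. f \<in> \<F> \<and> g \<in> \<G>}"
  unfolding deriv_closed_def
proof (intro ballI conjI)
  fix k assume "k \<in> {\<lambda>p. f p + g p | f g. f \<in> \<F> \<and> g \<in> \<G>}"
  then obtain f g where k: "k = (\<lambda>p. f p + g p)" and fg: "f \<in> \<F>" "g \<in> \<G>" by blast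
  show "continuous_on (dom T t0 N) k"
    using assms fg unfolding k deriv_closed_def by (intro continuous_on_add) auto
  fix d :: "'n dir" assume d: "d \<in> dirs N"
  obtain f' g' where fg': "f' \<in> \<F>" "g' \<in> \<G>" "pderiv_on (dom T t0 N) d f f'" "pderiv_on (dom T t0 N) d g g'"
    using assms fg d unfolding deriv_closed_def by meson
  have "pderiv_on (dom T t0 N) d k (\<lambda>p. f' p + g' p)"
    using fg'(3,4) unfolding pderiv_on_def k by (auto intro: has_vector_derivative_add)
  thus "\<exists>k'\<in>{\<lambda>p. f p + g p | f g. f \<in> \<F> \<and> g \<in> \<G>}. pderiv_on (dom T t0 N) d k k'"
    using fg'(1,2) by blast
qed

section \<open>Differentiation under the integral sign\<close>

text \<open>Dominated convergence for the remainders of the difference quotients, which the mean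
  value inequality on \<open>I\<close> intersected with a unit ball bounds by 2 D. The convex set
  \<open>I\<close> is arbitrary so that the end points of the time interval are included.\<close>

lemma has_vector_derivative_integral:
  fixes G G' :: "real \<Rightarrow> 'w \<Rightarrow> 'b::{banach, second_countable_topology}"
  assumes I: "convex I" "a \<in> I"
    and der: "\<And>v s. s \<in> I \<Longrightarrow> ((\<lambda>s. G s v) has_vector_derivative G' s v) (at s within I)"
    and int: "\<And>s. s \<in> I \<Longrightarrow> integrable \<mu> (G s)" and int': "integrable \<mu> (G' a)"
    and bound: "\<And>v s. s \<in> I \<Longrightarrow> \<bar>s - a\<bar> \<le> 1 \<Longrightarrow> norm (G' s v) \<le> D v"
    and D: "integrable \<mu> D"
  shows "((\<lambda>s. \<integral>v. G s v \<partial>\<mu>) has_vector_derivative (\<integral>v. G' a v \<partial>\<mu>)) (at a within I)"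
proof -
  let ?q = "\<lambda>s v. (1 / \<bar>s - a\<bar>) *\<^sub>R (G s v - (G a v + (s - a) *\<^sub>R G' a v))"
  have pt: "((\<lambda>s. ?q s v) \<longlongrightarrow> 0) (at a within I)" for v
    using der[OF I(2), of v] unfolding has_vector_derivative_def has_derivative_within by simp
  have mv: "norm (G s v - G a v) \<le> D v * \<bar>s - a\<bar>" if "s \<in> I" "\<bar>s - a\<bar> \<le> 1" for s v
  proof -
    have cv: "convex (I \<inter> cball a 1)" using I by (intro convex_Int convex_cball)
    have "norm (G s v - G a v) \<le> D v * norm (s - a)"
    proof (rule differentiable_bound[OF cv, where f' = "\<lambda>s h. h *\<^sub>R G' s v"])
      fix x assume x: "x \<in> I \<inter> cball a 1"
      show "((\<lambda>s. G s v) has_derivative (\<lambda>h. h *\<^sub>R G' x v)) (at x within I \<inter> cball a 1)"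
        using der[of x v] x unfolding has_vector_derivative_def
        by (auto intro: has_derivative_subset)
      have "norm (G' x v) \<le> D v" using x by (intro bound) (auto simp: dist_real_def)
      thus "onorm (\<lambda>h. h *\<^sub>R G' x v) \<le> D v"
        by (intro onorm_le) (simp add: mult.commute[of "D v"] mult_left_mono)
    qed (use that I in \<open>auto simp: dist_real_def\<close>)
    thus ?thesis by simp
  qed
  have qb: "norm (?q s v) \<le> 2 * D v" if "s \<in> I - {a}" "\<bar>s - a\<bar> \<le> 1" for s v
  proof -
    have pos: "\<bar>s - a\<bar> > 0" using that by auto
    have "norm (G s v - (G a v + (s - a) *\<^sub>R G' a v)) \<le> norm (G s v - G a v) + norm ((s - a) *\<^sub>R G' a v)"
      using norm_triangle_ineq4[of "G s v - G a v" "(s - a) *\<^sub>R G' a v"] by (simp add: algebra_simps)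
    also have "\<dots> \<le> D v * \<bar>s - a\<bar> + \<bar>s - a\<bar> * D v"
    proof (rule add_mono)
      show "norm (G s v - G a v) \<le> D v * \<bar>s - a\<bar>" using mv[of s v] that by auto
      show "norm ((s - a) *\<^sub>R G' a v) \<le> \<bar>s - a\<bar> * D v"
        using bound[OF I(2), of v] by (simp add: mult_left_mono)
    qed
    finally have "norm (G s v - (G a v + (s - a) *\<^sub>R G' a v)) \<le> (2 * D v) * \<bar>s - a\<bar>"
      by (simp add: mult_ac)
    thus ?thesis using pos unfolding norm_scaleR by (simp add: pos_divide_le_eq)
  qed
  have "((\<lambda>s. \<integral>v. ?q s v \<partial>\<mu>) \<longlongrightarrow> 0) (at a within I)"
    unfolding tendsto_at_iff_sequentially o_def
  proof (intro allI impI)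
    fix X :: "nat \<Rightarrow> real" assume X: "\<forall>i. X i \<in> I - {a}" "X \<longlonglongrightarrow> a"
    have "eventually (\<lambda>i. \<bar>X i - a\<bar> < 1) sequentially"
      using X(2) by (auto simp: tendsto_iff dist_real_def)
    then obtain n0 where n0: "\<And>i. i \<ge> n0 \<Longrightarrow> \<bar>X i - a\<bar> \<le> 1"
      by (auto simp: eventually_sequentially intro: less_imp_le)
    have "(\<lambda>i. \<integral>v. ?q (X (i + n0)) v \<partial>\<mu>) \<longlonglongrightarrow> (\<integral>v. 0 \<partial>\<mu>)"
    proof (rule integral_dominated_convergence[where w = "\<lambda>v. 2 * D v"])
      show "(\<lambda>v. ?q (X (i + n0)) v) \<in> borel_measurable \<mu>" for i
        using X int[of "X (i + n0)"] int[OF I(2)] int' by (intro borel_measurable_integrable) auto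
      show "AE v in \<mu>. (\<lambda>i. ?q (X (i + n0)) v) \<longlonglongrightarrow> 0"
      proof (rule AE_I2)
        fix v
        have "(\<lambda>i. ?q (X i) v) \<longlonglongrightarrow> 0"
          using pt[of v] X unfolding tendsto_at_iff_sequentially o_def by blast
        thus "(\<lambda>i. ?q (X (i + n0)) v) \<longlonglongrightarrow> 0" by (rule LIMSEQ_ignore_initial_segment)
      qed
      show "AE v in \<mu>. norm (?q (X (i + n0)) v) \<le> 2 * D v" for i
        using qb[of "X (i + n0)"] X n0[of "i + n0"] by auto
    qed (use D in auto)
    thus "(\<lambda>i. \<integral>v. ?q (X i) v \<partial>\<mu>) \<longlonglongrightarrow> 0"
      by (simp add: LIMSEQ_offset)
  qed
  moreover have "eventually (\<lambda>s. (\<integral>v. ?q s v \<partial>\<mu>) =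
     (1 / norm (s - a)) *\<^sub>R ((\<integral>v. G s v \<partial>\<mu>) - ((\<integral>v. G a v \<partial>\<mu>) + (s - a) *\<^sub>R (\<integral>v. G' a v \<partial>\<mu>)))) (at a within I)"
    unfolding eventually_at_filter
    by (rule always_eventually) (use int int' I in auto)
  ultimately show ?thesis
    unfolding has_vector_derivative_def has_derivative_within
    by (intro conjI bounded_linear_scaleR_left) (rule Lim_transform_eventually)
qed

text \<open>Serves to express bounds that are locally uniform in p. Time is left out because it
  ranges over a bounded interval; the squares of the y-coordinates directly control rho.\<close>

definition psize :: "nat \<Rightarrow> ('n::finite) pt \<Rightarrow> real" where
  "psize N p = norm (fst (snd p)) + (\<Sum>j<N. (snd (snd p) j)\<^sup>2)"

lemma continuous_on_y_coord: "continuous_on X (\<lambda>p::('n::finite) pt. snd (snd p) j)"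
  by (rule continuous_on_compose2[OF continuous_on_product_coordinates[of j]]) (auto intro!: continuous_on_snd continuous_on_id simp del: continuous_on_product_coordinates)

lemma continuous_on_psize: "continuous_on X (psize N)"
  unfolding psize_def by (intro continuous_intros continuous_on_y_coord)

lemma continuous_on_psize_shift: "continuous_on X (\<lambda>s. psize N (shift d p s))"
proof (cases p; cases d)
  fix t x y i assume [simp]: "p = (t, x, y)" "d = Dx i"
  have "continuous_on X (\<lambda>s. \<chi> k. if k = i then s else x $ k)"
    by (rule continuous_on_vec_lambda, rename_tac k, case_tac "k = i") (simp_all add: continuous_on_id)
  thus ?thesis by (auto simp: psize_def intro!: continuous_intros)
next
  fix t x y j assume [simp]: "p = (t, x, y)" "d = Dy j"
  have "continuous_on X (\<lambda>s. (y(j := s)) i)" for i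
    by (cases "i = j") (auto simp: continuous_on_id)
  thus ?thesis by (auto simp: psize_def intro!: continuous_intros)
qed (auto simp: psize_def)

section \<open>Algebras of kernels and their integrals\<close>

text \<open>Growth in the parameter is measured by powers of a single weight \<open>W\<close>, with
  constants uniform on bounded regions only. Working with powers keeps the condition stable under
  products.\<close>

definition kernel_ok :: "'w measure \<Rightarrow> ('w \<Rightarrow> real) \<Rightarrow> ('n::finite) pt set \<Rightarrow> nat \<Rightarrow> ('w \<Rightarrow> 'n pt \<Rightarrow> complex) \<Rightarrow> bool" where
  "kernel_ok \<mu> W \<Omega> N K \<longleftrightarrow>
     (\<forall>p\<in>\<Omega>. (\<lambda>v. K v p) \<in> borel_measurable \<mu>) \<and>
     (\<forall>v. continuous_on \<Omega> (K v)) \<and>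
     (\<forall>R. \<exists>A\<ge>0. \<exists>m. \<forall>v. \<forall>p\<in>\<Omega>. psize N p \<le> R \<longrightarrow> norm (K v p) \<le> A * W v ^ m)"

text \<open>If the derivatives of the generators lie in the generated algebra, the Leibniz rule
  makes the whole algebra stable under differentiation, so only generators have to be
  checked.\<close>

inductive_set kalg :: "('w \<Rightarrow> ('n::finite) pt \<Rightarrow> complex) set \<Rightarrow> ('w \<Rightarrow> 'n pt \<Rightarrow> complex) set"
  for G where
  gen: "K \<in> G \<Longrightarrow> K \<in> kalg G"
| add: "K \<in> kalg G \<Longrightarrow> L \<in> kalg G \<Longrightarrow> (\<lambda>v p. K v p + L v p) \<in> kalg G"
| mult: "K \<in> kalg G \<Longrightarrow> L \<in> kalg G \<Longrightarrow> (\<lambda>v p. K v p * L v p) \<in> kalg G"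

lemma kernel_ok_add:
  assumes W: "\<And>v. W v \<ge> 1" and "kernel_ok \<mu> W \<Omega> N K" "kernel_ok \<mu> W \<Omega> N L"
  shows "kernel_ok \<mu> W \<Omega> N (\<lambda>v p. K v p + L v p)"
proof -
  have "\<exists>A\<ge>0. \<exists>m. \<forall>v. \<forall>p\<in>\<Omega>. psize N p \<le> R \<longrightarrow> norm (K v p + L v p) \<le> A * W v ^ m" for R
  proof -
    obtain A m where A: "A \<ge> 0" "\<And>v p. p \<in> \<Omega> \<Longrightarrow> psize N p \<le> R \<Longrightarrow> norm (K v p) \<le> A * W v ^ m"
      using assms(2) unfolding kernel_ok_def by meson
    obtain B n where B: "B \<ge> 0" "\<And>v p. p \<in> \<Omega> \<Longrightarrow> psize N p \<le> R \<Longrightarrow> norm (L v p) \<le> B * W v ^ n"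
      using assms(3) unfolding kernel_ok_def by meson
    have "norm (K v p + L v p) \<le> (A + B) * W v ^ (m + n)" if "p \<in> \<Omega>" "psize N p \<le> R" for v p
    proof -
      have "norm (K v p + L v p) \<le> A * W v ^ m + B * W v ^ n"
        using A(2)[OF that] B(2)[OF that] by (meson add_mono norm_triangle_le)
      also have "\<dots> \<le> A * W v ^ (m + n) + B * W v ^ (m + n)"
        using A(1) B(1) W by (intro add_mono mult_left_mono power_increasing) auto
      finally show ?thesis by (simp add: algebra_simps)
    qed
    thus ?thesis using A(1) B(1) by (intro exI[of _ "A + B"] conjI exI[of _ "m + n"]) auto
  qed
  thus ?thesis using assms unfolding kernel_ok_def
    by (intro conjI ballI allI continuous_intros borel_measurable_add borel_measurable_times) blast+
qed

lemma kernel_ok_mult: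
  assumes W: "\<And>v. W v \<ge> 1" and "kernel_ok \<mu> W \<Omega> N K" "kernel_ok \<mu> W \<Omega> N L"
  shows "kernel_ok \<mu> W \<Omega> N (\<lambda>v p. K v p * L v p)"
proof -
  have "\<exists>A\<ge>0. \<exists>m. \<forall>v. \<forall>p\<in>\<Omega>. psize N p \<le> R \<longrightarrow> norm (K v p * L v p) \<le> A * W v ^ m" for R
  proof -
    obtain A m where A: "A \<ge> 0" "\<And>v p. p \<in> \<Omega> \<Longrightarrow> psize N p \<le> R \<Longrightarrow> norm (K v p) \<le> A * W v ^ m"
      using assms(2) unfolding kernel_ok_def by meson
    obtain B n where B: "B \<ge> 0" "\<And>v p. p \<in> \<Omega> \<Longrightarrow> psize N p \<le> R \<Longrightarrow> norm (L v p) \<le> B * W v ^ n"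
      using assms(3) unfolding kernel_ok_def by meson
    have "norm (K v p * L v p) \<le> (A * B) * W v ^ (m + n)" if "p \<in> \<Omega>" "psize N p \<le> R" for v p
    proof -
      have "norm (K v p * L v p) \<le> (A * W v ^ m) * (B * W v ^ n)"
        unfolding norm_mult using A(1) W[of v] by (intro mult_mono A(2) B(2) that mult_nonneg_nonneg) auto
      thus ?thesis by (simp add: power_add mult_ac)
    qed
    thus ?thesis using A(1) B(1) by (intro exI[of _ "A * B"] conjI exI[of _ "m + n"]) auto
  qed
  thus ?thesis using assms unfolding kernel_ok_def
    by (intro conjI ballI allI continuous_intros borel_measurable_add borel_measurable_times) blast+
qed

definition kgen :: "'w measure \<Rightarrow> ('w \<Rightarrow> real) \<Rightarrow> real \<Rightarrow> real \<Rightarrow> nat \<Rightarrow> ('w \<Rightarrow> ('n::finite) pt \<Rightarrow> complex) set \<Rightarrow> bool" where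
  "kgen \<mu> W T t0 N G \<longleftrightarrow> (\<forall>v. W v \<ge> 1) \<and> (\<forall>K\<in>G. kernel_ok \<mu> W (dom T t0 N) N K \<and>
     (\<forall>d\<in>dirs N. \<exists>K'\<in>kalg G. \<forall>v. pderiv_on (dom T t0 N) d (K v) (K' v)))"

lemma kalg_kernel:
  fixes K :: "'w \<Rightarrow> ('n::finite) pt \<Rightarrow> complex"
  assumes "kgen \<mu> W T t0 N G" "K \<in> kalg G"
  shows "kernel_ok \<mu> W (dom T t0 N) N K \<and>
     (\<forall>d\<in>dirs N. \<exists>K'\<in>kalg G. \<forall>v. pderiv_on (dom T t0 N) d (K v) (K' v))"
  using assms(2)
proof induction
  case (gen K)
  thus ?case using assms(1) unfolding kgen_def by blast
next
  case (add K L)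
  have W: "W v \<ge> 1" for v using assms(1) by (simp add: kgen_def)
  have "\<exists>M\<in>kalg G. \<forall>v. pderiv_on (dom T t0 N) d (\<lambda>p. K v p + L v p) (M v)" if d: "d \<in> dirs N" for d :: "'n dir"
  proof -
    obtain K' L' where "K' \<in> kalg G" "L' \<in> kalg G"
      and 1: "\<And>v. pderiv_on (dom T t0 N) d (K v) (K' v)" and 2: "\<And>v. pderiv_on (dom T t0 N) d (L v) (L' v)"
      using add.IH d by metis
    moreover have "pderiv_on (dom T t0 N) d (\<lambda>p. K v p + L v p) (\<lambda>p. K' v p + L' v p)" for v
      using 1[of v] 2[of v] unfolding pderiv_on_def by (auto intro: has_vector_derivative_add)
    ultimately show ?thesis by (intro bexI[OF _ kalg.add[of K' G L']]) auto
  qed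
  thus ?case using add.IH kernel_ok_add[of W, OF W] by blast
next
  case (mult K L)
  have W: "W v \<ge> 1" for v using assms(1) by (simp add: kgen_def)
  have "\<exists>M\<in>kalg G. \<forall>v. pderiv_on (dom T t0 N) d (\<lambda>p. K v p * L v p) (M v)" if d: "d \<in> dirs N" for d :: "'n dir"
  proof -
    obtain K' L' where K'L': "K' \<in> kalg G" "L' \<in> kalg G"
      and 1: "\<And>v. pderiv_on (dom T t0 N) d (K v) (K' v)" and 2: "\<And>v. pderiv_on (dom T t0 N) d (L v) (L' v)"
      using mult.IH d by metis
    have "pderiv_on (dom T t0 N) d (\<lambda>p. K v p * L v p) (\<lambda>p. K v p * L' v p + K' v p * L v p)" for v
      by (rule pderiv_on_mult[OF 2 1])
    thus ?thesis using mult.hyps K'L'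
      by (intro bexI[OF _ kalg.add[OF kalg.mult[of K G L'] kalg.mult[of K' G L]]]) auto
  qed
  thus ?case using mult.IH kernel_ok_mult[of W, OF W] by blast
qed

definition kint :: "'w measure \<Rightarrow> ('w \<Rightarrow> complex) \<Rightarrow> ('w \<Rightarrow> ('n::finite) pt \<Rightarrow> complex) \<Rightarrow> 'n pt \<Rightarrow> real" where
  "kint \<mu> g K p = Re (\<integral>v. g v * K v p \<partial>\<mu>)"

text \<open>Each differentiation may raise the power of \<open>W\<close>, hence integrability
  against all powers at once.\<close>

definition weight_ok :: "'w measure \<Rightarrow> ('w \<Rightarrow> real) \<Rightarrow> ('w \<Rightarrow> complex) \<Rightarrow> bool" where
  "weight_ok \<mu> W g \<longleftrightarrow> g \<in> borel_measurable \<mu> \<and> (\<forall>m. integrable \<mu> (\<lambda>v. norm (g v) * W v ^ m))"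

lemma kernel_integrable:
  assumes "kernel_ok \<mu> W \<Omega> N K" "weight_ok \<mu> W g" "p \<in> \<Omega>"
  shows "integrable \<mu> (\<lambda>v. g v * K v p)"
proof -
  obtain A m where A: "A \<ge> 0" "\<And>v. norm (K v p) \<le> A * W v ^ m"
    using assms(1,3) unfolding kernel_ok_def by (metis order_refl)
  show ?thesis
  proof (rule Bochner_Integration.integrable_bound)
    show "integrable \<mu> (\<lambda>v. A * (norm (g v) * W v ^ m))"
      using assms(2) unfolding weight_ok_def by auto
    show "(\<lambda>v. g v * K v p) \<in> borel_measurable \<mu>"
      using assms unfolding weight_ok_def kernel_ok_def by auto
    show "AE v in \<mu>. norm (g v * K v p) \<le> norm (A * (norm (g v) * W v ^ m))"
    proof (rule AE_I2)
      fix v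
      have "norm (g v * K v p) \<le> norm (g v) * (A * W v ^ m)"
        unfolding norm_mult by (intro mult_left_mono A(2)) auto
      also have "\<dots> \<le> norm (A * (norm (g v) * W v ^ m))"
        using abs_ge_self[of "A * (norm (g v) * W v ^ m)"] by (simp add: mult_ac)
      finally show "norm (g v * K v p) \<le> norm (A * (norm (g v) * W v ^ m))" .
    qed
  qed
qed

lemma kint_continuous:
  fixes K :: "'w \<Rightarrow> ('n::finite) pt \<Rightarrow> complex"
  assumes "kernel_ok \<mu> W \<Omega> N K" "weight_ok \<mu> W g"
  shows "continuous_on \<Omega> (kint \<mu> g K)"
  unfolding kint_def continuous_on_sequentially o_def
proof (intro allI ballI impI, elim conjE)
  fix X and p :: "'n pt" assume p: "p \<in> \<Omega>" and X: "\<forall>n. X n \<in> \<Omega>" "X \<longlonglongrightarrow> p"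
  have lim: "(\<lambda>n. psize N (X n)) \<longlonglongrightarrow> psize N p"
    using continuous_on_tendsto_compose[OF continuous_on_psize[of UNIV N] X(2)] by simp
  \<comment> \<open>A convergent sequence stays in a bounded region, so one majorant serves all its
    terms.\<close>
  obtain R where R: "\<And>n. psize N (X n) \<le> R"
  proof -
    from convergent_imp_Bseq[OF convergentI[OF lim]] obtain B where "\<And>n. norm (psize N (X n)) \<le> B"
      unfolding Bseq_def by blast
    thus thesis using that[of B] abs_le_D1 by force
  qed
  obtain A m where A: "A \<ge> 0" "\<And>v p. p \<in> \<Omega> \<Longrightarrow> psize N p \<le> R \<Longrightarrow> norm (K v p) \<le> A * W v ^ m"
    using assms(1) unfolding kernel_ok_def by meson
  have "(\<lambda>n. \<integral>v. g v * K v (X n) \<partial>\<mu>) \<longlonglongrightarrow> (\<integral>v. g v * K v p \<partial>\<mu>)"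
  proof (rule integral_dominated_convergence[where w = "\<lambda>v. A * (norm (g v) * W v ^ m)"])
    show "(\<lambda>v. g v * K v p) \<in> borel_measurable \<mu>"
      using kernel_integrable[OF assms p] by simp
    show "(\<lambda>v. g v * K v (X i)) \<in> borel_measurable \<mu>" for i
      using kernel_integrable[OF assms X(1)[rule_format, of i]] by simp
    show "integrable \<mu> (\<lambda>v. A * (norm (g v) * W v ^ m))"
      using assms(2) unfolding weight_ok_def by auto
    show "AE v in \<mu>. (\<lambda>i. g v * K v (X i)) \<longlonglongrightarrow> g v * K v p"
    proof (intro AE_I2 tendsto_mult_left)
      fix v
      have "continuous_on \<Omega> (K v)" using assms(1) unfolding kernel_ok_def by blast
      thus "(\<lambda>i. K v (X i)) \<longlonglongrightarrow> K v p"
        by (rule continuous_on_tendsto_compose[OF _ X(2) p]) (use X(1) in simp)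
    qed
    show "AE v in \<mu>. norm (g v * K v (X i)) \<le> A * (norm (g v) * W v ^ m)" for i
    proof (rule AE_I2)
      fix v
      have "norm (g v * K v (X i)) \<le> norm (g v) * (A * W v ^ m)"
        unfolding norm_mult using X R by (intro mult_left_mono A(2)) auto
      thus "norm (g v * K v (X i)) \<le> A * (norm (g v) * W v ^ m)" by (simp add: mult_ac)
    qed
  qed
  thus "(\<lambda>n. Re (\<integral>v. g v * K v (X n) \<partial>\<mu>)) \<longlonglongrightarrow> Re (\<integral>v. g v * K v p \<partial>\<mu>)"
    by (rule tendsto_Re)
qed

lemma kint_pderiv:
  fixes K :: "'w \<Rightarrow> ('n::finite) pt \<Rightarrow> complex"
  assumes K: "kernel_ok \<mu> W (dom T t0 N) N K" and K': "kernel_ok \<mu> W (dom T t0 N) N K'"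
    and g: "weight_ok \<mu> W g" and d: "d \<in> dirs N"
    and der: "\<And>v. pderiv_on (dom T t0 N) d (K v) (K' v)"
  shows "pderiv_on (dom T t0 N) d (kint \<mu> g K) (kint \<mu> g K')"
  unfolding pderiv_on_def
proof
  let ?\<Omega> = "dom T t0 N :: 'n pt set"
  fix p assume p: "p \<in> ?\<Omega>"
  define I where "I = {s. shift d p s \<in> ?\<Omega>}"
  define a where "a = coord d p"
  have aI: "a \<in> I" using p by (simp add: I_def a_def)
  have cI: "convex I" unfolding I_def slice_dom[OF p d] by simp
  have "bounded ((\<lambda>s. psize N (shift d p s)) ` cball a 1)"
    by (intro compact_imp_bounded compact_continuous_image continuous_on_psize_shift compact_cball)
  then obtain R where R: "\<And>s. \<bar>s - a\<bar> \<le> 1 \<Longrightarrow> psize N (shift d p s) \<le> R"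
    unfolding bounded_iff
  proof (elim exE)
    fix B assume B: "\<forall>x\<in>(\<lambda>s. psize N (shift d p s)) ` cball a 1. norm x \<le> B"
    show thesis
    proof (rule that)
      fix s :: real assume "\<bar>s - a\<bar> \<le> 1"
      hence "psize N (shift d p s) \<in> (\<lambda>s. psize N (shift d p s)) ` cball a 1"
        by (intro imageI) (simp add: dist_real_def abs_minus_commute)
      hence "norm (psize N (shift d p s)) \<le> B" using B by blast
      thus "psize N (shift d p s) \<le> B" by simp
    qed
  qed
  obtain A m where A: "A \<ge> 0" "\<And>v p. p \<in> ?\<Omega> \<Longrightarrow> psize N p \<le> R \<Longrightarrow> norm (K' v p) \<le> A * W v ^ m"
    using K' unfolding kernel_ok_def by meson
  have "((\<lambda>s. \<integral>v. g v * K v (shift d p s) \<partial>\<mu>) has_vector_derivative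
      (\<integral>v. g v * K' v (shift d p a) \<partial>\<mu>)) (at a within I)"
  proof (rule has_vector_derivative_integral[OF cI aI, where D = "\<lambda>v. A * (norm (g v) * W v ^ m)"])
    fix s v assume s: "s \<in> I"
    have sp: "shift d p s \<in> ?\<Omega>" using s by (simp add: I_def)
    have "((\<lambda>r. K v (shift d p r)) has_vector_derivative K' v (shift d p s)) (at s within I)"
      using der[of v] sp unfolding pderiv_on_def I_def by (auto dest!: bspec[of _ _ "shift d p s"])
    thus "((\<lambda>s. g v * K v (shift d p s)) has_vector_derivative g v * K' v (shift d p s)) (at s within I)"
      by (rule has_vector_derivative_mult_right)
    assume "\<bar>s - a\<bar> \<le> 1"
    hence "norm (g v * K' v (shift d p s)) \<le> norm (g v) * (A * W v ^ m)"
      unfolding norm_mult using R sp by (intro mult_left_mono A(2)) auto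
    thus "norm (g v * K' v (shift d p s)) \<le> A * (norm (g v) * W v ^ m)" by (simp add: mult_ac)
  next
    show "integrable \<mu> (\<lambda>v. g v * K v (shift d p s))" if "s \<in> I" for s
      using that by (intro kernel_integrable[OF K g]) (simp add: I_def)
    show "integrable \<mu> (\<lambda>v. g v * K' v (shift d p a))"
      using aI by (intro kernel_integrable[OF K' g]) (simp add: I_def)
    show "integrable \<mu> (\<lambda>v. A * (norm (g v) * W v ^ m))"
      using g unfolding weight_ok_def by auto
  qed
  from bounded_linear.has_vector_derivative[OF bounded_linear_Re this]
  show "((\<lambda>s. kint \<mu> g K (shift d p s)) has_vector_derivative kint \<mu> g K' p)
      (at (coord d p) within {s. shift d p s \<in> ?\<Omega>})"
    unfolding kint_def I_def a_def by simp
qed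

lemma kint_deriv_closed:
  fixes G :: "('w \<Rightarrow> ('n::finite) pt \<Rightarrow> complex) set"
  assumes G: "kgen \<mu> W T t0 N G" and g: "weight_ok \<mu> W g"
  shows "deriv_closed T t0 N (kint \<mu> g ` kalg G)"
  unfolding deriv_closed_def
proof (intro ballI conjI)
  fix f assume "f \<in> kint \<mu> g ` kalg G"
  then obtain K where f: "f = kint \<mu> g K" and K: "K \<in> kalg G" by blast
  show "continuous_on (dom T t0 N) f"
    unfolding f using kalg_kernel[OF G K] by (intro kint_continuous[OF _ g]) auto
  fix d :: "'n dir" assume d: "d \<in> dirs N"
  obtain K' where K': "K' \<in> kalg G" "\<And>v. pderiv_on (dom T t0 N) d (K v) (K' v)"
    using kalg_kernel[OF G K] d by blast
  show "\<exists>h\<in>kint \<mu> g ` kalg G. pderiv_on (dom T t0 N) d f h"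
    unfolding f using kalg_kernel[OF G K] kalg_kernel[OF G K'(1)] K'
    by (intro bexI[of _ "kint \<mu> g K'"] kint_pderiv[OF _ _ g d]) auto
qed

section \<open>Fourier representation of test functions\<close>

text \<open>Lebesgue measure is the image of the product measure over \<open>Basis\<close>, which
  reduces separable integrals to dimension one.\<close>

lemma lborel_prod_basis:
  fixes f :: "'a::euclidean_space \<Rightarrow> real \<Rightarrow> complex"
  assumes f: "\<And>b. b \<in> Basis \<Longrightarrow> integrable lborel (f b)"
  shows "integrable lborel (\<lambda>x::'a. \<Prod>b\<in>Basis. f b (x \<bullet> b))"
    and "(\<integral>x. (\<Prod>b\<in>Basis. f b (x \<bullet> b)) \<partial>(lborel :: 'a measure)) = (\<Prod>b\<in>Basis. \<integral>x. f b x \<partial>lborel)"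
proof -
  interpret product_sigma_finite "\<lambda>_::'a. lborel :: real measure" ..
  have [measurable]: "f b \<in> borel_measurable borel" if "b \<in> Basis" for b
    using borel_measurable_integrable[OF f[OF that]] by simp
  have eq: "(\<Prod>b\<in>Basis. f b ((\<Sum>c\<in>Basis. y c *\<^sub>R c) \<bullet> b)) = (\<Prod>b\<in>Basis. f b (y b))" for y
    by (intro prod.cong refl) (simp add: inner_sum_left inner_Basis if_distrib cong: if_cong)
  have m: "(\<lambda>x::'a. \<Prod>b\<in>Basis. f b (x \<bullet> b)) \<in> borel_measurable borel"
  proof (rule borel_measurable_prod)
    fix b :: 'a assume b: "b \<in> Basis"
    have "(\<lambda>x::'a. x \<bullet> b) \<in> borel_measurable borel" by simp
    from measurable_compose[OF this] show "(\<lambda>x. f b (x \<bullet> b)) \<in> borel_measurable borel"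
      using borel_measurable_integrable[OF f[OF b]] by simp
  qed
  show "integrable lborel (\<lambda>x::'a. \<Prod>b\<in>Basis. f b (x \<bullet> b))"
    by (subst lborel_eq, subst integrable_distr_eq[OF _ m])
       (simp_all add: eq product_integrable_prod[OF finite_Basis f])
  show "(\<integral>x. (\<Prod>b\<in>Basis. f b (x \<bullet> b)) \<partial>(lborel :: 'a measure)) = (\<Prod>b\<in>Basis. \<integral>x. f b x \<partial>lborel)"
    by (subst lborel_eq, subst integral_distr[OF _ m])
       (simp_all add: eq product_integral_prod[OF finite_Basis f])
qed

lemma integrable_pair_mult:
  fixes f :: "'a::euclidean_space \<Rightarrow> 'c::{real_normed_field, banach, second_countable_topology}"
    and g :: "'b::euclidean_space \<Rightarrow> 'c"
  assumes f: "integrable lborel f" and g: "integrable lborel g"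
  shows "integrable (lborel \<Otimes>\<^sub>M lborel) (\<lambda>(x, y). f x * g y)"
proof (rule lborel_pair.Fubini_integrable)
  have [measurable]: "f \<in> borel_measurable borel" "g \<in> borel_measurable borel"
    using f g by (auto dest: borel_measurable_integrable)
  show "(\<lambda>(x, y). f x * g y) \<in> borel_measurable (lborel \<Otimes>\<^sub>M lborel)" by measurable
  show "integrable lborel (\<lambda>x. \<integral>y. norm (case (x, y) of (x, y) \<Rightarrow> f x * g y) \<partial>lborel)"
    using f g by (simp add: norm_mult)
  show "AE x in lborel. integrable lborel (\<lambda>y. case (x, y) of (x, y) \<Rightarrow> f x * g y)"
    using g by simp
qed

definition gauss :: "'a::euclidean_space \<Rightarrow> real" where
  "gauss z = (\<Prod>b\<in>Basis. std_normal_density (z \<bullet> b))"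

lemma gauss_measurable [measurable]: "gauss \<in> borel_measurable borel"
  unfolding gauss_def[abs_def] by measurable

lemma gauss_nonneg: "gauss z \<ge> 0"
  unfolding gauss_def by (intro prod_nonneg) simp

lemma cis_sum: "finite A \<Longrightarrow> cis (\<Sum>b\<in>A. f b) = (\<Prod>b\<in>A. cis (f b))"
  by (induction A rule: finite_induct) (auto simp: cis_mult[symmetric])

lemma gauss_eq: "gauss (z::'a::euclidean_space) = exp (- (norm z)\<^sup>2 / 2) / sqrt (2 * pi) ^ DIM('a)"
proof -
  have "gauss z = (\<Prod>b\<in>Basis. exp (- (z \<bullet> b)\<^sup>2 / 2) / sqrt (2 * pi))"
    by (simp add: gauss_def std_normal_density_def)
  also have "\<dots> = exp (\<Sum>b\<in>Basis. - (z \<bullet> b)\<^sup>2 / 2) / sqrt (2 * pi) ^ DIM('a)"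
    by (simp add: prod_dividef exp_sum)
  also have "(\<Sum>b\<in>Basis. - (z \<bullet> b)\<^sup>2 / 2) = - (norm z)\<^sup>2 / 2"
    unfolding power2_norm_eq_inner euclidean_inner[of z z]
    by (simp add: sum_negf sum_divide_distrib power2_eq_square)
  finally show ?thesis .
qed

lemma cis_measurable [measurable]: "cis \<in> borel_measurable borel"
  by (intro borel_measurable_continuous_onI continuous_on_cis continuous_on_id)

text \<open>In dimension one this is the characteristic function of the standard normal law; the
  rest is the product structure.\<close>

lemma gauss_char:
  fixes \<xi> :: "'a::euclidean_space"
  shows "integrable lborel (\<lambda>z::'a. of_real (gauss z) * cis (\<xi> \<bullet> z))"
    and "(\<integral>z. of_real (gauss z) * cis (\<xi> \<bullet> z) \<partial>lborel) = of_real (exp (- (norm \<xi>)\<^sup>2 / 2))"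
proof -
  define f where "f b x = of_real (std_normal_density x) * cis ((\<xi> \<bullet> b) * x)" for b x
  have eq: "of_real (gauss z) * cis (\<xi> \<bullet> z) = (\<Prod>b\<in>Basis. f b (z \<bullet> b))" for z
    unfolding gauss_def euclidean_inner[of \<xi> z] f_def by (simp add: cis_sum prod.distrib)
  have int: "integrable lborel (f b)" for b
    unfolding f_def[abs_def]
    by (rule Bochner_Integration.integrable_bound[OF integrable_normal_density[of 1 0]])
       (auto simp: norm_mult)
  have val: "(\<integral>x. f b x \<partial>lborel) = of_real (exp (- (\<xi> \<bullet> b)\<^sup>2 / 2))" for b
  proof -
    have "char std_normal_distribution (\<xi> \<bullet> b) = (\<integral>x. f b x \<partial>lborel)"
      unfolding char_def f_def
      by (subst integral_density) (auto simp: scaleR_conv_of_real cis_conv_exp)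
    thus ?thesis by (simp add: char_std_normal_distribution)
  qed
  show "integrable lborel (\<lambda>z::'a. of_real (gauss z) * cis (\<xi> \<bullet> z))"
    unfolding eq by (rule lborel_prod_basis(1)[OF int])
  have "(\<integral>z. of_real (gauss z) * cis (\<xi> \<bullet> z) \<partial>lborel) = (\<Prod>b\<in>Basis. of_real (exp (- (\<xi> \<bullet> b)\<^sup>2 / 2)))"
    unfolding eq lborel_prod_basis(2)[OF int] val ..
  also have "\<dots> = of_real (exp (\<Sum>b\<in>Basis. - (\<xi> \<bullet> b)\<^sup>2 / 2))"
    by (simp add: exp_sum)
  also have "(\<Sum>b\<in>Basis. - (\<xi> \<bullet> b)\<^sup>2 / 2) = - (norm \<xi>)\<^sup>2 / 2"
    unfolding power2_norm_eq_inner euclidean_inner[of \<xi> \<xi>]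
    by (simp add: sum_negf sum_divide_distrib power2_eq_square)
  finally show "(\<integral>z. of_real (gauss z) * cis (\<xi> \<bullet> z) \<partial>lborel) = of_real (exp (- (norm \<xi>)\<^sup>2 / 2))" .
qed

lemma gauss_integral:
  "integrable lborel (\<lambda>z::'a::euclidean_space. complex_of_real (gauss z))"
  "(\<integral>z. complex_of_real (gauss z) \<partial>(lborel :: 'a measure)) = 1"
  using gauss_char[of "0::'a"] by simp_all

lemma lborel_integral_affine:
  fixes f :: "'a::euclidean_space \<Rightarrow> complex"
  assumes "c > 0" and [measurable]: "f \<in> borel_measurable borel"
  shows "(\<integral>x. f x \<partial>lborel) = of_real (c ^ DIM('a)) * (\<integral>x. f (t + c *\<^sub>R x) \<partial>lborel)"
proof -
  have "(\<integral>x. f x \<partial>lborel) = (\<integral>x. f x \<partial>density (distr lborel borel (\<lambda>x. t + c *\<^sub>R x)) (\<lambda>_. \<bar>c\<bar>^DIM('a)))"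
    using lborel_affine[of c t] assms(1) by simp
  also have "\<dots> = (\<integral>x. c ^ DIM('a) *\<^sub>R f (t + c *\<^sub>R x) \<partial>lborel)"
    using assms(1) by (subst integral_density) (auto simp: integral_distr)
  finally show ?thesis by (simp add: scaleR_conv_of_real)
qed

text \<open>The whole constant (2 pi)^(-n) sits in the forward transform, so h is recovered as a
  plain superposition of plane waves.\<close>

definition fourier :: "('a::euclidean_space \<Rightarrow> real) \<Rightarrow> 'a \<Rightarrow> complex" where
  "fourier h \<xi> = (\<integral>z. of_real (h z) * cis (- (\<xi> \<bullet> z)) \<partial>lborel) / of_real (2 * pi) ^ DIM('a)"

lemma fourier_measurable [measurable]:
  fixes h :: "'a::euclidean_space \<Rightarrow> real"
  assumes [measurable]: "h \<in> borel_measurable borel"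
  shows "fourier h \<in> borel_measurable borel"
proof -
  have "(\<lambda>\<xi>. \<integral>z. of_real (h z) * cis (- (\<xi> \<bullet> z)) \<partial>lborel) \<in> borel_measurable (borel :: 'a measure)"
    by (rule lborel.borel_measurable_lebesgue_integral) measurable
  thus ?thesis unfolding fourier_def[abs_def] by measurable
qed

text \<open>Inserting a Gaussian of width $1/\varepsilon$ into the inversion integral turns it into an average of
  $h$ over a Gaussian of width $\varepsilon$.\<close>

lemma fourier_gauss_regularised:
  fixes h :: "'a::euclidean_space \<Rightarrow> real"
  assumes int: "integrable lborel h" and e: "e > 0"
  shows "(\<integral>\<xi>. fourier h \<xi> * cis (\<xi> \<bullet> x) * of_real (exp (- (norm (e *\<^sub>R \<xi>))\<^sup>2 / 2)) \<partial>lborel)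
     = (\<integral>u. of_real (h (x + e *\<^sub>R u)) * of_real (gauss u) \<partial>lborel)"
proof -
  have [measurable]: "h \<in> borel_measurable borel" using int by auto
  let ?n = "DIM('a)" and ?c = "complex_of_real (sqrt (2 * pi) ^ DIM('a))"
  have c0: "?c \<noteq> 0" by simp
  have cc: "of_real (2 * pi) ^ DIM('a) = ?c * ?c"
  proof -
    have "(2 * pi) ^ DIM('a) = sqrt (2 * pi) ^ DIM('a) * sqrt (2 * pi) ^ DIM('a)"
      unfolding power_mult_distrib[symmetric] by simp
    thus ?thesis unfolding of_real_mult[symmetric] of_real_power[symmetric] by simp
  qed
  define A where "A \<eta> = (\<integral>u. of_real (h (x + e *\<^sub>R u)) * cis (- (\<eta> \<bullet> u)) \<partial>lborel)" for \<eta>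
  have [measurable]: "A \<in> borel_measurable borel"
    unfolding A_def[abs_def] by (rule lborel.borel_measurable_lebesgue_integral) measurable
  have inner: "(\<integral>z. of_real (h z) * cis (- (\<xi> \<bullet> z)) \<partial>lborel) * cis (\<xi> \<bullet> x)
     = of_real (e ^ ?n) * A (e *\<^sub>R \<xi>)" for \<xi>
  proof -
    have "(\<integral>z. of_real (h z) * cis (- (\<xi> \<bullet> z)) \<partial>lborel)
      = of_real (e ^ ?n) * (\<integral>u. of_real (h (x + e *\<^sub>R u)) * cis (- (\<xi> \<bullet> (x + e *\<^sub>R u))) \<partial>lborel)"
      by (rule lborel_integral_affine[OF e]) measurable
    also have "(\<lambda>u. of_real (h (x + e *\<^sub>R u)) * cis (- (\<xi> \<bullet> (x + e *\<^sub>R u))))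
       = (\<lambda>u. (of_real (h (x + e *\<^sub>R u)) * cis (- ((e *\<^sub>R \<xi>) \<bullet> u))) * cis (- (\<xi> \<bullet> x)))"
      by (simp add: fun_eq_iff cis_mult inner_add_right add_ac)
    finally have "(\<integral>z. of_real (h z) * cis (- (\<xi> \<bullet> z)) \<partial>lborel) = of_real (e ^ ?n) * (A (e *\<^sub>R \<xi>) * cis (- (\<xi> \<bullet> x)))"
      unfolding A_def integral_mult_left_zero .
    moreover have "cis (- (\<xi> \<bullet> x)) * cis (\<xi> \<bullet> x) = 1" by (simp add: cis_mult)
    ultimately show ?thesis by (simp add: mult.assoc)
  qed
  have inth: "integrable lborel (\<lambda>u. complex_of_real (h (x + e *\<^sub>R u)))"
  proof -
    have "integrable (density (distr lborel borel (\<lambda>u. x + e *\<^sub>R u)) (\<lambda>_. \<bar>e\<bar> ^ ?n)) (\<lambda>z. complex_of_real (h z))"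
      using int lborel_affine[of e x] e by simp
    hence "integrable lborel (\<lambda>u. e ^ ?n *\<^sub>R complex_of_real (h (x + e *\<^sub>R u)))" using e
      by (subst (asm) integrable_density) (auto simp: integrable_distr_eq)
    from integrable_scaleR_right[OF this, of "inverse (e ^ ?n)"] show ?thesis using e by simp
  qed
  have "(\<integral>\<xi>. fourier h \<xi> * cis (\<xi> \<bullet> x) * of_real (exp (- (norm (e *\<^sub>R \<xi>))\<^sup>2 / 2)) \<partial>lborel)
     = (\<integral>\<xi>. of_real (e ^ ?n) * (A (e *\<^sub>R \<xi>) * of_real (gauss (e *\<^sub>R \<xi>)) / ?c) \<partial>lborel)"
  proof (rule Bochner_Integration.integral_cong[OF refl])
    fix \<xi>
    have "fourier h \<xi> * cis (\<xi> \<bullet> x) = of_real (e ^ ?n) * A (e *\<^sub>R \<xi>) / (?c * ?c)"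
      unfolding fourier_def cc times_divide_eq_left inner ..
    thus "fourier h \<xi> * cis (\<xi> \<bullet> x) * of_real (exp (- (norm (e *\<^sub>R \<xi>))\<^sup>2 / 2))
       = of_real (e ^ ?n) * (A (e *\<^sub>R \<xi>) * of_real (gauss (e *\<^sub>R \<xi>)) / ?c)"
      unfolding gauss_eq using c0 by (simp add: field_simps)
  qed
  also have "\<dots> = (\<integral>\<eta>. A \<eta> * of_real (gauss \<eta>) / ?c \<partial>lborel)"
    using lborel_integral_affine[OF e, of "\<lambda>\<eta>. A \<eta> * of_real (gauss \<eta>) / ?c" 0] by simp
  also have "\<dots> = (\<integral>\<eta>. A \<eta> * of_real (gauss \<eta>) \<partial>lborel) / ?c" by simp
  also have "(\<integral>\<eta>. A \<eta> * of_real (gauss \<eta>) \<partial>lborel)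
     = (\<integral>\<eta>. (\<integral>u. of_real (h (x + e *\<^sub>R u)) * cis (- (\<eta> \<bullet> u)) * of_real (gauss \<eta>) \<partial>lborel) \<partial>lborel)"
    unfolding A_def by simp
  \<comment> \<open>The Gaussian in eta and the integrable h in u make the double integral
    absolutely convergent.\<close>
  also have "\<dots> = (\<integral>u. (\<integral>\<eta>. of_real (h (x + e *\<^sub>R u)) * cis (- (\<eta> \<bullet> u)) * of_real (gauss \<eta>) \<partial>lborel) \<partial>lborel)"
  proof (rule lborel_pair.Fubini_integral, rule Bochner_Integration.integrable_bound[OF integrable_pair_mult[OF inth gauss_integral(1)]])
    show "(\<lambda>(u, \<eta>). of_real (h (x + e *\<^sub>R u)) * cis (- (\<eta> \<bullet> u)) * of_real (gauss \<eta>))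
        \<in> borel_measurable (lborel \<Otimes>\<^sub>M lborel :: ('a \<times> 'a) measure)" by measurable
  qed (auto simp: norm_mult)
  also have "(\<lambda>u. \<integral>\<eta>. of_real (h (x + e *\<^sub>R u)) * cis (- (\<eta> \<bullet> u)) * of_real (gauss \<eta>) \<partial>lborel)
     = (\<lambda>u. of_real (h (x + e *\<^sub>R u)) * of_real (gauss u) * ?c)"
  proof
    fix u :: 'a
    have "(\<integral>\<eta>. of_real (h (x + e *\<^sub>R u)) * cis (- (\<eta> \<bullet> u)) * of_real (gauss \<eta>) \<partial>lborel)
      = (\<integral>\<eta>. of_real (h (x + e *\<^sub>R u)) * (of_real (gauss \<eta>) * cis ((- u) \<bullet> \<eta>)) \<partial>lborel)"
      by (simp add: mult_ac inner_commute)
    also have "\<dots> = of_real (h (x + e *\<^sub>R u)) * of_real (exp (- (norm u)\<^sup>2 / 2))"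
      using gauss_char[of "- u"] by simp
    finally show "(\<integral>\<eta>. of_real (h (x + e *\<^sub>R u)) * cis (- (\<eta> \<bullet> u)) * of_real (gauss \<eta>) \<partial>lborel)
      = of_real (h (x + e *\<^sub>R u)) * of_real (gauss u) * ?c"
      using c0 by (simp add: gauss_eq)
  qed
  finally show ?thesis using c0 by simp
qed

text \<open>The regularised identity passes to the limit on both sides: \<open>fourier h\<close>
  dominates the left one, \<open>B\<close> times the Gaussian the right one.\<close>

lemma fourier_inversion:
  fixes h :: "'a::euclidean_space \<Rightarrow> real"
  assumes int: "integrable lborel h" and cont: "continuous_on UNIV h" and bdd: "\<And>z. \<bar>h z\<bar> \<le> B"
    and intF: "integrable lborel (fourier h)"
  shows "(\<integral>\<xi>. fourier h \<xi> * cis (\<xi> \<bullet> x) \<partial>lborel) = of_real (h x)"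
proof -
  have [measurable]: "h \<in> borel_measurable borel" using int by auto
  define e where "e k = 1 / real (Suc k)" for k
  have e: "e k > 0" for k by (simp add: e_def)
  have e0: "e \<longlonglongrightarrow> 0" unfolding e_def by real_asymp
  have 1: "(\<lambda>k. \<integral>\<xi>. fourier h \<xi> * cis (\<xi> \<bullet> x) * of_real (exp (- (norm (e k *\<^sub>R \<xi>))\<^sup>2 / 2)) \<partial>lborel)
     \<longlonglongrightarrow> (\<integral>\<xi>. fourier h \<xi> * cis (\<xi> \<bullet> x) \<partial>lborel)"
  proof (rule integral_dominated_convergence[where w = "\<lambda>\<xi>. norm (fourier h \<xi>)"])
    show "AE \<xi> in lborel. (\<lambda>k. fourier h \<xi> * cis (\<xi> \<bullet> x) * of_real (exp (- (norm (e k *\<^sub>R \<xi>))\<^sup>2 / 2)))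
       \<longlonglongrightarrow> fourier h \<xi> * cis (\<xi> \<bullet> x)"
    proof (rule AE_I2)
      fix \<xi>
      have "(\<lambda>k. fourier h \<xi> * cis (\<xi> \<bullet> x) * of_real (exp (- (norm (e k *\<^sub>R \<xi>))\<^sup>2 / 2)))
         \<longlonglongrightarrow> fourier h \<xi> * cis (\<xi> \<bullet> x) * of_real (exp (- (norm (0 *\<^sub>R \<xi>))\<^sup>2 / 2))"
        by (intro tendsto_intros e0) auto
      thus "(\<lambda>k. fourier h \<xi> * cis (\<xi> \<bullet> x) * of_real (exp (- (norm (e k *\<^sub>R \<xi>))\<^sup>2 / 2)))
         \<longlonglongrightarrow> fourier h \<xi> * cis (\<xi> \<bullet> x)" by simp
    qed
  qed (use intF in \<open>auto simp: norm_mult mult_left_le\<close>)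
  have 2: "(\<lambda>k. \<integral>u. of_real (h (x + e k *\<^sub>R u)) * of_real (gauss u) \<partial>lborel)
     \<longlonglongrightarrow> (\<integral>u. complex_of_real (h x) * of_real (gauss u) \<partial>(lborel :: 'a measure))"
  proof (rule integral_dominated_convergence[where w = "\<lambda>u::'a. B * gauss u"])
    show "integrable lborel (\<lambda>u::'a. B * gauss u)"
      using integrable_Re[OF gauss_integral(1)[where 'a='a]] by simp
    show "AE u in lborel. (\<lambda>k. complex_of_real (h (x + e k *\<^sub>R u)) * of_real (gauss u)) \<longlonglongrightarrow> of_real (h x) * of_real (gauss u)"
    proof (rule AE_I2)
      fix u :: 'a
      have "(\<lambda>k. x + e k *\<^sub>R u) \<longlonglongrightarrow> x + 0 *\<^sub>R u" by (intro tendsto_intros e0)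
      hence "(\<lambda>k. h (x + e k *\<^sub>R u)) \<longlonglongrightarrow> h x"
        using continuous_on_tendsto_compose[OF cont] by fastforce
      thus "(\<lambda>k. complex_of_real (h (x + e k *\<^sub>R u)) * of_real (gauss u)) \<longlonglongrightarrow> of_real (h x) * of_real (gauss u)"
        by (intro tendsto_intros)
    qed
    show "AE u in lborel. norm (complex_of_real (h (x + e k *\<^sub>R u)) * of_real (gauss u)) \<le> B * gauss u" for k
      by (intro AE_I2) (simp add: norm_mult abs_of_nonneg[OF gauss_nonneg] mult_right_mono[OF bdd gauss_nonneg])
  qed auto
  have "(\<integral>u. complex_of_real (h x) * of_real (gauss u) \<partial>(lborel::'a measure)) = of_real (h x)"
    using gauss_integral[where 'a='a] by simp
  with LIMSEQ_unique[OF 1[unfolded fourier_gauss_regularised[OF int e]] 2] show ?thesis by simp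
qed

lemma integrable_compact_support:
  fixes f :: "'a::euclidean_space \<Rightarrow> 'b::{banach, second_countable_topology}"
  assumes "continuous_on UNIV f" "compact C" "\<And>x. x \<notin> C \<Longrightarrow> f x = 0"
  shows "integrable lborel f"
proof -
  have "integrable lborel (\<lambda>x. indicator C x *\<^sub>R f x)"
    by (rule borel_integrable_compact[OF assms(2) continuous_on_subset[OF assms(1)]]) simp
  also have "(\<lambda>x. indicator C x *\<^sub>R f x) = f"
    using assms(3) by (auto simp: fun_eq_iff indicator_def)
  finally show ?thesis .
qed

lemma bounded_compact_support:
  fixes f :: "'a::euclidean_space \<Rightarrow> 'b::real_normed_vector"
  assumes "continuous_on UNIV f" "compact C" "\<And>x. x \<notin> C \<Longrightarrow> f x = 0"
  obtains B where "B \<ge> 0" "\<And>x. norm (f x) \<le> B"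
proof -
  have "bounded (f ` C)"
    by (intro compact_imp_bounded compact_continuous_image continuous_on_subset[OF assms(1)] assms(2)) auto
  then obtain B where B: "B > 0" "\<And>x. x \<in> C \<Longrightarrow> norm (f x) \<le> B"
    unfolding bounded_pos by blast
  show thesis
    by (rule that[of B]) (use B assms(3) in \<open>force+\<close>)
qed

lemma has_vector_derivative_translate:
  fixes g :: "real \<Rightarrow> 'b::real_normed_vector"
  assumes "(g has_vector_derivative g') (at (c + a))"
  shows "((\<lambda>s. g (c + s)) has_vector_derivative g') (at a)"
proof -
  have "((\<lambda>s. c + s) has_vector_derivative 1) (at a)"
    unfolding has_real_derivative_iff_has_vector_derivative[symmetric] by (auto intro!: derivative_eq_intros)
  from vector_diff_chain_at[OF this assms] show ?thesis by (simp add: o_def)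
qed

text \<open>Translation invariance makes $\int F(x+sa)\,dx$ constant in $s$; differentiate at $s=0$.\<close>

lemma integral_directional_derivative:
  fixes F F' :: "'a::euclidean_space \<Rightarrow> complex"
  assumes F: "continuous_on UNIV F" "\<And>x. norm x > R \<Longrightarrow> F x = 0"
    and F': "continuous_on UNIV F'" "\<And>x. norm x > R \<Longrightarrow> F' x = 0"
    and der: "\<And>x. ((\<lambda>s. F (x + s *\<^sub>R a)) has_vector_derivative F' x) (at 0)"
  shows "(\<integral>x. F' x \<partial>lborel) = 0"
proof -
  have cF: "compact (cball (0::'a) R)" by simp
  have intF: "integrable lborel F" by (rule integrable_compact_support[OF F(1) cF]) (use F(2) in auto)
  have intF': "integrable lborel F'" by (rule integrable_compact_support[OF F'(1) cF]) (use F'(2) in auto)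
  have [measurable]: "F \<in> borel_measurable borel" "F' \<in> borel_measurable borel"
    using intF intF' by auto
  obtain B where B: "B \<ge> 0" "\<And>x. norm (F' x) \<le> B"
    using bounded_compact_support[OF F'(1) cF] F'(2) by auto
  have const: "(\<integral>x. F (x + s *\<^sub>R a) \<partial>lborel) = (\<integral>x. F x \<partial>lborel)" for s
    using integral_distr[of "(+) (s *\<^sub>R a)" lborel borel F] by (simp add: lborel_distr_plus add.commute)
  have tr: "integrable lborel (\<lambda>x. H (x + s *\<^sub>R a))" if "integrable lborel H" for H :: "'a \<Rightarrow> complex" and s
  proof -
    have "integrable (distr lborel borel ((+) (s *\<^sub>R a))) H" using that by (simp add: lborel_distr_plus)
    thus ?thesis by (subst (asm) integrable_distr_eq) (use that in \<open>auto simp: add.commute\<close>)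
  qed
  let ?D = "\<lambda>x. B * indicator (cball (0::'a) (R + norm a)) x :: real"
  have "((\<lambda>s. \<integral>x. F (x + s *\<^sub>R a) \<partial>lborel) has_vector_derivative (\<integral>x. F' (x + 0 *\<^sub>R a) \<partial>lborel)) (at 0 within UNIV)"
  proof (rule has_vector_derivative_integral[where D = ?D])
    fix x and s :: real
    \<comment> \<open>The hypothesis gives the derivative along the line only at parameter 0; moving
      the base point transfers it to s.\<close>
    have "((\<lambda>r. F ((x + s *\<^sub>R a) + (- s + r) *\<^sub>R a)) has_vector_derivative F' (x + s *\<^sub>R a)) (at s)"
      by (rule has_vector_derivative_translate) (simp add: der)
    thus "((\<lambda>s. F (x + s *\<^sub>R a)) has_vector_derivative F' (x + s *\<^sub>R a)) (at s within UNIV)"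
      by (simp add: algebra_simps)
    assume s: "\<bar>s - 0\<bar> \<le> 1"
    show "norm (F' (x + s *\<^sub>R a)) \<le> ?D x"
    proof (cases "norm x \<le> R + norm a")
      case True
      thus ?thesis using B by simp
    next
      case False
      have "norm x \<le> norm (x + s *\<^sub>R a) + norm (s *\<^sub>R a)"
        using norm_triangle_ineq4[of "x + s *\<^sub>R a" "s *\<^sub>R a"] by simp
      also have "norm (s *\<^sub>R a) \<le> norm a" using s by (simp add: mult_left_le_one_le)
      finally have "norm (x + s *\<^sub>R a) > R" using False by linarith
      thus ?thesis using F'(2) B by simp
    qed
  next
    show "integrable lborel ?D"
      using lmeasurable_cball[of "0::'a" "R + norm a"]
      by (auto simp: fmeasurable_def emeasure_bounded_finite)
  qed (use tr intF intF' in auto)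
  hence "((\<lambda>s::real. \<integral>x. F x \<partial>lborel) has_vector_derivative (\<integral>x. F' x \<partial>lborel)) (at 0)"
    unfolding const by simp
  thus ?thesis
    using vector_derivative_unique_at has_vector_derivative_const by blast
qed

section \<open>Decay of the Fourier transform\<close>

text \<open>Integration by parts: the product of f with the exponential has compact support, so the
  integral of its i-th derivative vanishes.\<close>

lemma fourier_partial:
  fixes f f' :: "real^'n \<Rightarrow> real"
  assumes f: "continuous_on UNIV f" "\<And>x. norm x > R \<Longrightarrow> f x = 0"
    and f': "continuous_on UNIV f'" "\<And>x. norm x > R \<Longrightarrow> f' x = 0"
    and der: "\<And>x. ((\<lambda>s. f (\<chi> k. if k = i then s else x $ k)) has_vector_derivative f' x) (at (x $ i))"
  shows "fourier f' \<xi> = \<i> * of_real (\<xi> $ i) * fourier f \<xi>"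
proof -
  let ?F = "\<lambda>x. of_real (f x) * cis (- (\<xi> \<bullet> x))"
  let ?F' = "\<lambda>x. of_real (f' x) * cis (- (\<xi> \<bullet> x)) - \<i> * of_real (\<xi> $ i) * (of_real (f x) * cis (- (\<xi> \<bullet> x)))"
  have cis_cont: "continuous_on UNIV (\<lambda>x. cis (- (\<xi> \<bullet> x)))"
    by (intro continuous_intros)
  have "(\<integral>x. ?F' x \<partial>lborel) = 0"
  proof (rule integral_directional_derivative[where F = ?F and R = R and a = "axis i 1"])
    fix x :: "real^'n"
    have line: "x + s *\<^sub>R axis i 1 = (\<chi> k. if k = i then x $ i + s else x $ k)" for s
      by (simp add: vec_eq_iff axis_def)
    have "((\<lambda>s. f (\<chi> k. if k = i then x $ i + s else x $ k)) has_vector_derivative f' x) (at 0)"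
      by (rule has_vector_derivative_translate[where g = "\<lambda>s. f (\<chi> k. if k = i then s else x $ k)"]) (simp add: der)
    hence 1: "((\<lambda>s. complex_of_real (f (x + s *\<^sub>R axis i 1))) has_vector_derivative of_real (f' x)) (at 0)"
      unfolding line by (intro has_vector_derivative_of_real) (simp add: has_real_derivative_iff_has_vector_derivative)
    have ip: "\<xi> \<bullet> (x + s *\<^sub>R axis i 1) = \<xi> \<bullet> x + s * \<xi> $ i" for s
      by (simp add: inner_add_right inner_axis)
    have 2: "((\<lambda>s. cis (- (\<xi> \<bullet> (x + s *\<^sub>R axis i 1)))) has_vector_derivative - \<i> * of_real (\<xi> $ i) * cis (- (\<xi> \<bullet> x))) (at 0)"
    proof -
      have "((\<lambda>z. exp (\<i> * (- of_real (\<xi> \<bullet> x) - z * of_real (\<xi> $ i)))) has_field_derivative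
         exp (\<i> * (- of_real (\<xi> \<bullet> x) - of_real 0 * of_real (\<xi> $ i))) * (\<i> * (- of_real (\<xi> $ i)))) (at (of_real 0))"
        by (auto intro!: derivative_eq_intros)
      from has_vector_derivative_real_field[OF this]
      show ?thesis unfolding ip by (simp add: cis_conv_exp mult_ac)
    qed
    show "((\<lambda>s. ?F (x + s *\<^sub>R axis i 1)) has_vector_derivative ?F' x) (at 0)"
      using has_vector_derivative_mult[OF 1 2] by (simp add: algebra_simps)
  qed (use f f' in \<open>auto intro!: continuous_intros\<close>)
  moreover have "integrable lborel (\<lambda>x. of_real (f x) * cis (- (\<xi> \<bullet> x)))"
    using f by (intro integrable_compact_support[where C = "cball 0 R"] continuous_intros) auto
  moreover have "integrable lborel (\<lambda>x. of_real (f' x) * cis (- (\<xi> \<bullet> x)))"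
    using f' by (intro integrable_compact_support[where C = "cball 0 R"] continuous_intros) auto
  ultimately have "(\<integral>x. of_real (f' x) * cis (- (\<xi> \<bullet> x)) \<partial>lborel)
     = \<i> * of_real (\<xi> $ i) * (\<integral>x. of_real (f x) * cis (- (\<xi> \<bullet> x)) \<partial>lborel)"
    by simp
  thus ?thesis unfolding fourier_def by simp
qed

lemma fourier_bounded:
  fixes f :: "'a::euclidean_space \<Rightarrow> real"
  shows "norm (fourier f \<xi>) \<le> (\<integral>x. \<bar>f x\<bar> \<partial>lborel) / (2 * pi) ^ DIM('a)"
proof -
  have "norm (\<integral>z. of_real (f z) * cis (- (\<xi> \<bullet> z)) \<partial>lborel) \<le> (\<integral>z. norm (of_real (f z) * cis (- (\<xi> \<bullet> z))) \<partial>lborel)"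
    by (rule integral_norm_bound)
  thus ?thesis unfolding fourier_def
    by (simp add: norm_divide norm_power norm_mult divide_right_mono)
qed

text \<open>Pure derivatives in one coordinate suffice, since bounds involving |xi_i|^m for all i
  control |xi|^m.\<close>

definition rderiv :: "(real^'n \<Rightarrow> real) \<Rightarrow> 'n \<Rightarrow> nat \<Rightarrow> real^'n \<Rightarrow> real" where
  "rderiv h i m x = iter_pdiff ({0} \<times> UNIV \<times> {\<lambda>_. 0}) (replicate m (Dx i)) (\<lambda>(t, x, y). h x) (0, x, \<lambda>_. 0)"

lemma rderiv_facts:
  fixes h :: "real^'n \<Rightarrow> real"
  assumes "smooth_Rn h"
  shows "rderiv h i 0 = h" "continuous_on UNIV (rderiv h i m)"
    "((\<lambda>s. rderiv h i m (\<chi> k. if k = i then s else x $ k)) has_vector_derivative rderiv h i (Suc m) x) (at (x $ i))"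
proof -
  let ?\<Omega> = "{0::real} \<times> (UNIV :: (real^'n) set) \<times> {\<lambda>_::nat. 0::real}"
  let ?f = "iter_pdiff ?\<Omega> (replicate m (Dx i)) (\<lambda>(t, x, y). h x)"
  have sm: "continuous_on ?\<Omega> ?f" "\<And>p. p \<in> ?\<Omega> \<Longrightarrow> has_pdiff ?\<Omega> (Dx i) ?f p"
  proof -
    have "set (replicate m (Dx i)) \<subseteq> range Dx" by (auto simp: set_replicate_conv_if)
    from assms[unfolded smooth_Rn_def smooth_on_dom_def, rule_format, OF this]
    show "continuous_on ?\<Omega> ?f" "\<And>p. p \<in> ?\<Omega> \<Longrightarrow> has_pdiff ?\<Omega> (Dx i) ?f p" by blast+
  qed
  show "rderiv h i 0 = h" by (simp add: rderiv_def iter_pdiff_def fun_eq_iff)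
  show "continuous_on UNIV (rderiv h i m)"
    unfolding rderiv_def[abs_def]
    by (rule continuous_on_compose2[OF sm(1)]) (auto intro!: continuous_intros)
  have slice: "{s. shift (Dx i) (0, x, \<lambda>_. 0) s \<in> ?\<Omega>} = UNIV" by simp
  have "(\<lambda>s. ?f (shift (Dx i) (0, x, \<lambda>_. 0) s)) differentiable (at (x $ i))"
    using sm(2)[of "(0, x, \<lambda>_. 0)"] unfolding has_pdiff_def slice by simp
  hence "((\<lambda>s. ?f (shift (Dx i) (0, x, \<lambda>_. 0) s)) has_vector_derivative
      vector_derivative (\<lambda>s. ?f (shift (Dx i) (0, x, \<lambda>_. 0) s)) (at (x $ i))) (at (x $ i))"
    by (simp only: vector_derivative_works)
  moreover have "rderiv h i (Suc m) x = vector_derivative (\<lambda>s. ?f (shift (Dx i) (0, x, \<lambda>_. 0) s)) (at (x $ i))"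
    unfolding rderiv_def by (simp add: iter_pdiff_def pdiff_def)
  ultimately show "((\<lambda>s. rderiv h i m (\<chi> k. if k = i then s else x $ k)) has_vector_derivative rderiv h i (Suc m) x) (at (x $ i))"
    unfolding rderiv_def by simp
qed

text \<open>Norm larger than R is an open condition, so the previous derivative vanishes on the
  coordinate line near x as well.\<close>

lemma rderiv_support:
  fixes h :: "real^'n \<Rightarrow> real"
  assumes sm: "smooth_Rn h" and h: "\<And>x. norm x > R \<Longrightarrow> h x = 0"
  shows "norm x > R \<Longrightarrow> rderiv h i m x = 0"
proof (induction m arbitrary: x)
  case 0
  thus ?case using h by (simp add: rderiv_facts(1)[OF sm])
next
  case (Suc m)
  have cont: "continuous_on UNIV (\<lambda>s. norm (\<chi> k. if k = i then s else x $ k))"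
    by (intro continuous_on_norm continuous_on_vec_lambda, rename_tac k, case_tac "k = i") (simp_all add: continuous_on_id)
  have "open ((\<lambda>s. norm (\<chi> k. if k = i then s else x $ k)) -` {R<..})"
    by (rule open_vimage[OF open_greaterThan cont])
  moreover have "(\<chi> k. if k = i then x $ i else x $ k) = x" by (simp add: vec_eq_iff)
  hence "x $ i \<in> (\<lambda>s. norm (\<chi> k. if k = i then s else x $ k)) -` {R<..}" using Suc.prems by simp
  moreover have "rderiv h i m (\<chi> k. if k = i then s else x $ k) = 0"
    if "s \<in> (\<lambda>s. norm (\<chi> k. if k = i then s else x $ k)) -` {R<..}" for s
    using that by (intro Suc.IH) simp
  ultimately have "((\<lambda>s. 0::real) has_vector_derivative rderiv h i (Suc m) x) (at (x $ i))"
    by (rule has_vector_derivative_transform_within_open[OF rderiv_facts(3)[OF sm]])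
  thus ?case using vector_derivative_unique_at has_vector_derivative_const by blast
qed

lemma fourier_decay:
  fixes h :: "real^'n \<Rightarrow> real"
  assumes sm: "smooth_Rn h" and h: "\<And>x. norm x > R \<Longrightarrow> h x = 0"
  obtains C where "C \<ge> 0" "\<And>\<xi>. norm (fourier h \<xi>) * (1 + norm \<xi>) ^ m \<le> C"
proof -
  have pow: "norm (fourier (rderiv h i m) \<xi>) = \<bar>\<xi> $ i\<bar> ^ m * norm (fourier h \<xi>)" for i m \<xi>
  proof (induction m)
    case (Suc m)
    have "fourier (rderiv h i (Suc m)) \<xi> = \<i> * of_real (\<xi> $ i) * fourier (rderiv h i m) \<xi>"
      by (rule fourier_partial[where R = R]) (use rderiv_facts[OF sm] rderiv_support[OF sm h] in auto)
    thus ?case using Suc.IH by (simp add: norm_mult)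
  qed (simp add: rderiv_facts(1)[OF sm])
  define c where "c i m = (\<integral>x. \<bar>rderiv h i m x\<bar> \<partial>lborel) / (2 * pi) ^ DIM(real^'n)" for i m
  have c: "\<bar>\<xi> $ i\<bar> ^ m * norm (fourier h \<xi>) \<le> c i m" for i m \<xi>
    using fourier_bounded[of "rderiv h i m" \<xi>] unfolding pow c_def .
  have c0: "c i m \<ge> 0" for i m unfolding c_def by (intro divide_nonneg_nonneg integral_nonneg_AE) auto
  define n where "n = real CARD('n)"
  have n: "n \<ge> 1" unfolding n_def by (simp add: Suc_leI)
  \<comment> \<open>Any index serves: \<open>c a 0\<close> only provides a bound for
    \<open>fourier h\<close> itself.\<close>
  define a :: 'n where "a = undefined"
  have bound: "norm (fourier h \<xi>) * (1 + norm \<xi>) ^ m \<le> 2 ^ m * (c a 0 + n ^ m * (\<Sum>i\<in>UNIV. c i m))" for \<xi>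
  proof -
    \<comment> \<open>The coordinate of largest modulus depends on xi; summing over all i at the end
      makes the constant independent of it.\<close>
    obtain i where i: "\<And>j. \<bar>\<xi> $ j\<bar> \<le> \<bar>\<xi> $ i\<bar>"
    proof -
      have "Max (range (\<lambda>j. \<bar>\<xi> $ j\<bar>)) \<in> range (\<lambda>j. \<bar>\<xi> $ j\<bar>)" by (intro Max_in) auto
      then obtain i where "\<bar>\<xi> $ i\<bar> = Max (range (\<lambda>j. \<bar>\<xi> $ j\<bar>))" by (metis imageE)
      thus thesis using that[of i] by simp
    qed
    have "norm \<xi> \<le> n * \<bar>\<xi> $ i\<bar>"
      using norm_le_l1_cart[of \<xi>] sum_bounded_above[of UNIV "\<lambda>j. \<bar>\<xi> $ j\<bar>" "\<bar>\<xi> $ i\<bar>"] i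
      by (simp add: n_def)
    hence pw: "norm \<xi> ^ m \<le> n ^ m * \<bar>\<xi> $ i\<bar> ^ m"
      unfolding power_mult_distrib[symmetric] by (intro power_mono) auto
    have "(1 + norm \<xi>) ^ m \<le> (2 * max 1 (norm \<xi>)) ^ m" by (intro power_mono) auto
    also have "\<dots> \<le> 2 ^ m * (1 + norm \<xi> ^ m)"
      by (simp add: power_mult_distrib max_def)
    also have "\<dots> \<le> 2 ^ m * (1 + n ^ m * \<bar>\<xi> $ i\<bar> ^ m)"
      using pw by simp
    finally have "norm (fourier h \<xi>) * (1 + norm \<xi>) ^ m \<le> norm (fourier h \<xi>) * (2 ^ m * (1 + n ^ m * \<bar>\<xi> $ i\<bar> ^ m))"
      by (rule mult_left_mono) simp
    also have "\<dots> = 2 ^ m * (\<bar>\<xi> $ a\<bar> ^ 0 * norm (fourier h \<xi>) + n ^ m * (\<bar>\<xi> $ i\<bar> ^ m * norm (fourier h \<xi>)))"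
      by (simp add: algebra_simps)
    also have "\<dots> \<le> 2 ^ m * (c a 0 + n ^ m * c i m)"
      using n by (intro mult_left_mono add_mono c) auto
    also have "c i m \<le> (\<Sum>i\<in>UNIV. c i m)"
      using c0 by (intro member_le_sum) auto
    finally show ?thesis using n by (simp add: mult_left_mono)
  qed
  show thesis
    by (rule that[OF _ bound]) (use n c0 in \<open>auto intro!: mult_nonneg_nonneg add_nonneg_nonneg sum_nonneg\<close>)
qed

text \<open>In every coordinate 1 + (xi . b)^2 <= (1 + |xi|)^2, so the product of the
  one-dimensional functions 1/(1 + x^2) is an integrable majorant; hence the exponent 2 DIM.\<close>

lemma integrable_inverse_poly:
  "integrable lborel (\<lambda>\<xi>::'a::euclidean_space. 1 / (1 + norm \<xi>) ^ (2 * DIM('a)))"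
proof -
  have 1: "integrable lborel (\<lambda>x. complex_of_real (inverse (1 + x\<^sup>2)))"
    by (rule integrable_of_real) (use integrable_inverse_1_plus_square in \<open>simp add: set_integrable_def\<close>)
  have "integrable lborel (\<lambda>\<xi>::'a. \<Prod>b\<in>Basis. complex_of_real (inverse (1 + (\<xi> \<bullet> b)\<^sup>2)))"
    using lborel_prod_basis(1)[of "\<lambda>b x. complex_of_real (inverse (1 + x\<^sup>2))"] 1 by simp
  thus ?thesis
  proof (rule Bochner_Integration.integrable_bound)
    show "AE \<xi> in (lborel :: 'a measure). norm (1 / (1 + norm \<xi>) ^ (2 * DIM('a))) \<le> norm (\<Prod>b\<in>Basis. complex_of_real (inverse (1 + (\<xi> \<bullet> b)\<^sup>2)))"
    proof (rule AE_I2)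
      fix \<xi> :: 'a
      have "1 + (\<xi> \<bullet> b)\<^sup>2 \<le> (1 + norm \<xi>)\<^sup>2" if "b \<in> Basis" for b
      proof -
        have "(\<xi> \<bullet> b)\<^sup>2 \<le> (norm \<xi>)\<^sup>2"
          using Basis_le_norm[OF that, of \<xi>] by (simp add: abs_le_square_iff[symmetric])
        thus ?thesis using norm_ge_zero[of \<xi>] unfolding power2_sum by (simp add: add_increasing2)
      qed
      hence "inverse ((1 + norm \<xi>)\<^sup>2) \<le> inverse (1 + (\<xi> \<bullet> b)\<^sup>2)" if "b \<in> Basis" for b
        using that by (intro le_imp_inverse_le) (auto simp: add_pos_nonneg)
      hence "(\<Prod>b\<in>(Basis::'a set). inverse ((1 + norm \<xi>)\<^sup>2)) \<le> (\<Prod>b\<in>Basis. inverse (1 + (\<xi> \<bullet> b)\<^sup>2))"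
        by (intro prod_mono) auto
      moreover have "norm (1 / (1 + norm \<xi>) ^ (2 * DIM('a))) = (\<Prod>b\<in>(Basis::'a set). inverse ((1 + norm \<xi>)\<^sup>2))"
        by (simp add: power_mult power_inverse divide_inverse abs_of_nonneg)
      moreover have "norm (\<Prod>b\<in>Basis. complex_of_real (inverse (1 + (\<xi> \<bullet> b)\<^sup>2))) = (\<Prod>b\<in>Basis. inverse (1 + (\<xi> \<bullet> b)\<^sup>2))"
        unfolding of_real_prod[symmetric] norm_of_real by (intro abs_of_nonneg prod_nonneg) (auto simp: add_nonneg_nonneg)
      ultimately show "norm (1 / (1 + norm \<xi>) ^ (2 * DIM('a))) \<le> norm (\<Prod>b\<in>Basis. complex_of_real (inverse (1 + (\<xi> \<bullet> b)\<^sup>2)))"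
        by simp
    qed
  qed simp
qed

text \<open>The witness is \<open>fourier h\<close>: decay of order m + 2 DIM leaves an integrable
  function after multiplication by m powers. Everything later uses only these three properties of
  \<open>H\<close>.\<close>

lemma fourier_representation:
  fixes h :: "real^'n \<Rightarrow> real"
  assumes "C0_inf h"
  obtains H :: "real^'n \<Rightarrow> complex" where "H \<in> borel_measurable borel"
    "\<And>m. integrable lborel (\<lambda>\<xi>. norm (H \<xi>) * (1 + norm \<xi>) ^ m)"
    "\<And>x. (\<integral>\<xi>. H \<xi> * cis (\<xi> \<bullet> x) \<partial>lborel) = of_real (h x)"
proof -
  have sm: "smooth_Rn h" and "compact (closure {x. h x \<noteq> 0})" using assms by (auto simp: C0_inf_def)
  then obtain R where R: "\<And>x. x \<in> closure {x. h x \<noteq> 0} \<Longrightarrow> norm x \<le> R"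
    using compact_imp_bounded bounded_iff by metis
  have h: "h x = 0" if "norm x > R" for x
    using R[of x] closure_subset[of "{x. h x \<noteq> 0}"] that by force
  have cont: "continuous_on UNIV h" using rderiv_facts(1)[OF sm] rderiv_facts(2)[OF sm, of _ 0] by metis
  have comp: "compact (cball (0::real^'n) R)" by simp
  have hC: "h x = 0" if "x \<notin> cball 0 R" for x using h that by simp
  have int: "integrable lborel h" by (rule integrable_compact_support[OF cont comp hC])
  have [measurable]: "h \<in> borel_measurable borel" using int by auto
  obtain B where B: "\<And>x. norm (h x) \<le> B" using bounded_compact_support[OF cont comp hC] by metis
  have intm: "integrable lborel (\<lambda>\<xi>. norm (fourier h \<xi>) * (1 + norm \<xi>) ^ m)" for m
  proof -
    let ?d = "2 * DIM(real^'n)"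
    obtain C where C: "C \<ge> 0" "\<And>\<xi>. norm (fourier h \<xi>) * (1 + norm \<xi>) ^ (m + ?d) \<le> C"
      using fourier_decay[OF sm h] by metis
    show ?thesis
    proof (rule Bochner_Integration.integrable_bound)
      show "integrable lborel (\<lambda>\<xi>::real^'n. C * (1 / (1 + norm \<xi>) ^ ?d))"
        by (intro integrable_mult_right integrable_inverse_poly)
      show "AE \<xi> in lborel. norm (norm (fourier h \<xi>) * (1 + norm \<xi>) ^ m) \<le> norm (C * (1 / (1 + norm \<xi>) ^ ?d))"
      proof (rule AE_I2)
        fix \<xi> :: "real^'n"
        have p: "(1 + norm \<xi>) ^ ?d > 0" by (intro zero_less_power) (simp add: add_pos_nonneg)
        have "norm (fourier h \<xi>) * (1 + norm \<xi>) ^ m * (1 + norm \<xi>) ^ ?d \<le> C"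
          using C(2)[of \<xi>] by (simp only: power_add mult.assoc)
        hence "norm (fourier h \<xi>) * (1 + norm \<xi>) ^ m \<le> C / (1 + norm \<xi>) ^ ?d"
          using p by (simp only: pos_le_divide_eq)
        thus "norm (norm (fourier h \<xi>) * (1 + norm \<xi>) ^ m) \<le> norm (C * (1 / (1 + norm \<xi>) ^ ?d))"
          using C(1) p by (simp add: abs_mult)
      qed
    qed measurable
  qed
  have "integrable lborel (fourier h)"
    using intm[of 0] by (simp add: integrable_norm_iff)
  from fourier_inversion[OF int cont B[unfolded real_norm_def] this]
  have "(\<integral>\<xi>. fourier h \<xi> * cis (\<xi> \<bullet> x) \<partial>lborel) = of_real (h x)" for x .
  thus thesis using that[of "fourier h"] intm by simp
qed

section \<open>Superpositions of modes\<close>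

definition rho :: "nat \<Rightarrow> (nat \<Rightarrow> real) \<Rightarrow> real" where
  "rho N y = (\<Sum>j<N. (y j)\<^sup>2) / (2 * real N)"

text \<open>The equation is stated for witnesses of the derivatives and without initial condition,
  which makes it additive: the parts of the solution are integrals over different measures and
  satisfy the initial condition only together.\<close>

definition wave_part :: "real \<Rightarrow> real \<Rightarrow> nat \<Rightarrow> (('n::finite) pt \<Rightarrow> real) \<Rightarrow> bool" where
  "wave_part T t0 N f \<longleftrightarrow> (\<exists>\<F>. deriv_closed T t0 N \<F> \<and> f \<in> \<F>) \<and>
     (\<exists>f1 f2. (\<forall>d\<in>dirs N. pderiv_on (dom T t0 N) d f (f1 d) \<and> pderiv_on (dom T t0 N) d (f1 d) (f2 d)) \<and>
        (\<forall>p\<in>dom T t0 N. - (2 * fst p / real N) * f2 Dt p - (\<Sum>i\<in>UNIV. f2 (Dx i) p) - (\<Sum>j<N. f2 (Dy j) p) = 0))"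

lemma dirs_simps [simp]: "Dt \<in> dirs N" "Dx i \<in> dirs N" "Dy j \<in> dirs N \<longleftrightarrow> j < N"
  by (auto simp: dirs_def)

lemma wave_part_add:
  assumes "wave_part T t0 N f" "wave_part T t0 N g"
  shows "wave_part T t0 N (\<lambda>p. f p + g p)"
proof -
  obtain \<F> f1 f2 where f: "deriv_closed T t0 N \<F>" "f \<in> \<F>"
      "\<And>d. d \<in> dirs N \<Longrightarrow> pderiv_on (dom T t0 N) d f (f1 d) \<and> pderiv_on (dom T t0 N) d (f1 d) (f2 d)"
      "\<And>p. p \<in> dom T t0 N \<Longrightarrow> - (2 * fst p / real N) * f2 Dt p - (\<Sum>i\<in>UNIV. f2 (Dx i) p) - (\<Sum>j<N. f2 (Dy j) p) = 0"
    using assms(1) unfolding wave_part_def by blast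
  obtain \<G> g1 g2 where g: "deriv_closed T t0 N \<G>" "g \<in> \<G>"
      "\<And>d. d \<in> dirs N \<Longrightarrow> pderiv_on (dom T t0 N) d g (g1 d) \<and> pderiv_on (dom T t0 N) d (g1 d) (g2 d)"
      "\<And>p. p \<in> dom T t0 N \<Longrightarrow> - (2 * fst p / real N) * g2 Dt p - (\<Sum>i\<in>UNIV. g2 (Dx i) p) - (\<Sum>j<N. g2 (Dy j) p) = 0"
    using assms(2) unfolding wave_part_def by blast
  have add: "pderiv_on \<Omega> d a a' \<Longrightarrow> pderiv_on \<Omega> d b b' \<Longrightarrow> pderiv_on \<Omega> d (\<lambda>p. a p + b p) (\<lambda>p. a' p + b' p)"
    for \<Omega> d and a a' b b' :: "'a pt \<Rightarrow> real"
    unfolding pderiv_on_def by (auto intro: has_vector_derivative_add)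
  have pde: "- (2 * fst p / real N) * (f2 Dt p + g2 Dt p) - (\<Sum>i\<in>UNIV. f2 (Dx i) p + g2 (Dx i) p)
       - (\<Sum>j<N. f2 (Dy j) p + g2 (Dy j) p) = 0" if "p \<in> dom T t0 N" for p
    using f(4)[OF that] g(4)[OF that] unfolding distrib_left sum.distrib by linarith
  have "deriv_closed T t0 N {\<lambda>p. f p + g p | f g. f \<in> \<F> \<and> g \<in> \<G>} \<and>
     (\<lambda>p. f p + g p) \<in> {\<lambda>p. f p + g p | f g. f \<in> \<F> \<and> g \<in> \<G>}"
    using deriv_closed_add[OF f(1) g(1)] f(2) g(2) by blast
  thus ?thesis unfolding wave_part_def using f(3) g(3) pde
    by (intro conjI exI[of _ "\<lambda>d p. f1 d p + g1 d p"] exI[of _ "\<lambda>d p. f2 d p + g2 d p"]) (blast intro: add)+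
qed

lemma wave_part_solution:
  assumes "T < t0" "wave_part T t0 N u" "\<And>x y. y \<in> RN N \<Longrightarrow> u (T, x, y) = h x"
  shows "wave_solution T t0 N h u"
proof -
  obtain \<F> f1 f2 where f: "deriv_closed T t0 N \<F>" "u \<in> \<F>"
      "\<And>d. d \<in> dirs N \<Longrightarrow> pderiv_on (dom T t0 N) d u (f1 d) \<and> pderiv_on (dom T t0 N) d (f1 d) (f2 d)"
      "\<And>p. p \<in> dom T t0 N \<Longrightarrow> - (2 * fst p / real N) * f2 Dt p - (\<Sum>i\<in>UNIV. f2 (Dx i) p) - (\<Sum>j<N. f2 (Dy j) p) = 0"
    using assms(2) unfolding wave_part_def by blast
  have d2: "pdiff (dom T t0 N) d (pdiff (dom T t0 N) d u) p = f2 d p" if "d \<in> dirs N" "p \<in> dom T t0 N" for d p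
    using pderiv_on_pdiff2[OF assms(1) that(1) _ _ that(2)] f(3)[OF that(1)] by blast
  show ?thesis
    unfolding wave_solution_def using deriv_closed_smooth[OF assms(1) f(1,2)] assms(3) f(4) d2 by simp
qed

lemma kconst_ok: "(\<And>v. W v \<ge> 1) \<Longrightarrow> kernel_ok \<mu> W \<Omega> N (\<lambda>v p. c)"
  unfolding kernel_ok_def
  by (intro conjI ballI allI exI[of _ "norm c"] exI[of _ 0]) auto

lemma pderiv_on_zero: "(\<And>p s. f (shift d p s) = f p) \<Longrightarrow> pderiv_on \<Omega> d f (\<lambda>p. 0)"
  unfolding pderiv_on_def by simp

lemma cis_pderiv:
  fixes \<xi> :: "real^'n"
  shows "pderiv_on \<Omega> (Dx i) (\<lambda>p. cis (\<xi> \<bullet> fst (snd p))) (\<lambda>p. \<i> * of_real (\<xi> $ i) * cis (\<xi> \<bullet> fst (snd p)))"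
  unfolding pderiv_on_def
proof
  fix p :: "'n pt"
  obtain t x y where p: "p = (t, x, y)" by (cases p)
  let ?c = "\<xi> \<bullet> x - \<xi> $ i * x $ i"
  have ip: "\<xi> \<bullet> (\<chi> k. if k = i then s else x $ k) = ?c + s * \<xi> $ i" for s
  proof -
    have "(\<chi> k. if k = i then s else x $ k) = x + (s - x $ i) *\<^sub>R axis i 1"
      by (simp add: vec_eq_iff axis_def)
    hence "\<xi> \<bullet> (\<chi> k. if k = i then s else x $ k) = \<xi> \<bullet> x + (s - x $ i) * \<xi> $ i"
      by (simp only: inner_add_right inner_scaleR_right inner_axis) simp
    thus ?thesis by (simp add: algebra_simps)
  qed
  have "((\<lambda>z. exp (\<i> * (of_real ?c + z * of_real (\<xi> $ i)))) has_field_derivative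
     exp (\<i> * (of_real ?c + of_real (x $ i) * of_real (\<xi> $ i))) * (\<i> * of_real (\<xi> $ i))) (at (of_real (x $ i)))"
    by (auto intro!: derivative_eq_intros)
  from has_vector_derivative_real_field[OF this]
  have "((\<lambda>s. cis (?c + s * \<xi> $ i)) has_vector_derivative \<i> * of_real (\<xi> $ i) * cis (?c + x $ i * \<xi> $ i))
     (at (x $ i) within {s. shift (Dx i) p s \<in> \<Omega>})"
    by (simp add: cis_conv_exp mult_ac)
  thus "((\<lambda>s. cis (\<xi> \<bullet> fst (snd (shift (Dx i) p s)))) has_vector_derivative \<i> * of_real (\<xi> $ i) * cis (\<xi> \<bullet> fst (snd p)))
     (at (coord (Dx i) p) within {s. shift (Dx i) p s \<in> \<Omega>})"
    by (simp add: p ip mult.commute)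
qed

section \<open>Families of modes\<close>

text \<open>A common frame for the static part and both circles. Bounding exp(sqrt|zeta|) instead of
  zeta is what \<open>J01_norm_le_exp_sqrt\<close> turns into powers of \<open>W\<close>.\<close>

locale wave_family =
  fixes \<mu> :: "'w measure" and W :: "'w \<Rightarrow> real" and T t0 :: real and N :: nat
    and \<xi> :: "'w \<Rightarrow> real^'n" and w \<zeta> :: "'w \<Rightarrow> complex" and A :: real and a :: nat
  assumes T: "T < t0" "t0 < 0" and N: "N \<ge> 1" and W: "\<And>v. W v \<ge> 1" and A: "A \<ge> 1"
    and meas [measurable]: "\<xi> \<in> borel_measurable \<mu>" "w \<in> borel_measurable \<mu>" "\<zeta> \<in> borel_measurable \<mu>"
    and xi_bound: "\<And>v. norm (\<xi> v) \<le> W v"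
    and w_bound: "\<And>v. (norm (w v))\<^sup>2 \<le> A * W v ^ a" and Re_w: "\<And>v. 0 \<le> Re (w v)"
    and zeta_bound: "\<And>v. exp (sqrt (norm (\<zeta> v))) \<le> A * W v ^ a"
    and dispersion: "\<And>v. (w v)\<^sup>2 = \<zeta> v - of_real (real N / 2 * (norm (\<xi> v))\<^sup>2)"
begin

abbreviation "\<Omega> \<equiv> dom T t0 N :: 'n pt set"

definition Kx :: "'w \<Rightarrow> 'n pt \<Rightarrow> complex" where "Kx v p = cis (\<xi> v \<bullet> fst (snd p))"
definition Kt :: "'w \<Rightarrow> 'n pt \<Rightarrow> complex" where "Kt v p = mode (- t0) (- T) (w v) (- fst p)"
definition Kt' :: "'w \<Rightarrow> 'n pt \<Rightarrow> complex" where "Kt' v p = mode' (- t0) (- T) (w v) (- fst p)"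
definition Kr :: "'w \<Rightarrow> 'n pt \<Rightarrow> complex" where "Kr v p = of_real (1 / fst p)"
definition Ky :: "nat \<Rightarrow> 'w \<Rightarrow> 'n pt \<Rightarrow> complex" where "Ky j v p = of_real (snd (snd p) j)"
definition KJ :: "nat \<Rightarrow> 'w \<Rightarrow> 'n pt \<Rightarrow> complex" where
  "KJ m v p = J01 (real N / 2 + real m) (\<zeta> v * of_real (rho N (snd (snd p))))"
text \<open>Differentiation dictates the list: the equation for e produces w^2 and 1/t, and a
  y-derivative of J raises the index of \<open>KJ\<close> and produces zeta and y_j. Only w^2 is
  required, never w itself.\<close>

definition gens :: "('w \<Rightarrow> 'n pt \<Rightarrow> complex) set" where
  "gens = range (\<lambda>c v p. c) \<union> range (\<lambda>i v p. of_real (\<xi> v $ i)) \<union> {\<lambda>v p. (w v)\<^sup>2, \<lambda>v p. \<zeta> v}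
     \<union> {Kx, Kt, Kt', Kr} \<union> range Ky \<union> range KJ"

lemma gens_mem:
  "(\<lambda>v p. c) \<in> kalg gens" "(\<lambda>v p. of_real (\<xi> v $ i)) \<in> kalg gens" "(\<lambda>v p. (w v)\<^sup>2) \<in> kalg gens"
  "(\<lambda>v p. \<zeta> v) \<in> kalg gens" "Kx \<in> kalg gens" "Kt \<in> kalg gens" "Kt' \<in> kalg gens" "Kr \<in> kalg gens"
  "Ky j \<in> kalg gens" "KJ m \<in> kalg gens"
  by (auto intro!: kalg.gen simp: gens_def)

lemma time_in: "p \<in> \<Omega> \<Longrightarrow> - fst p \<in> {- t0..- T}" "p \<in> \<Omega> \<Longrightarrow> fst p \<in> {T..t0}"
  by (auto simp: dom_def)

lemma Kx_pderiv: "pderiv_on \<Omega> (Dx i) (Kx v) (\<lambda>p. \<i> * of_real (\<xi> v $ i) * Kx v p)"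
  unfolding Kx_def by (rule cis_pderiv)

lemma neg_time_deriv:
  assumes "(f has_vector_derivative f') (at (- t))"
  shows "((\<lambda>s. f (- s)) has_vector_derivative - f') (at t within X)"
proof -
  have "((\<lambda>s::real. - s) has_vector_derivative - 1) (at t within X)"
    by (auto intro!: derivative_eq_intros)
  from vector_diff_chain_within[OF this has_vector_derivative_at_within[OF assms]]
  show ?thesis by (simp add: o_def)
qed

lemma Kt_pderiv: "pderiv_on \<Omega> Dt (Kt v) (\<lambda>p. - 1 * Kt' v p)"
  unfolding pderiv_on_def
proof
  fix p :: "'n pt" assume "p \<in> \<Omega>"
  hence "0 < - fst p" "- fst p \<le> - T" using time_in[of p] T by auto
  from neg_time_deriv[OF mode_derivs(1)[OF this, of "- t0" "w v" UNIV]]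
  show "((\<lambda>s. Kt v (shift Dt p s)) has_vector_derivative - 1 * Kt' v p)
     (at (coord Dt p) within {s. shift Dt p s \<in> \<Omega>})"
    by (cases p) (simp add: Kt_def Kt'_def)
qed

lemma Kt'_pderiv: "pderiv_on \<Omega> Dt (Kt' v) (\<lambda>p. (w v)\<^sup>2 * Kr v p * Kt v p)"
  unfolding pderiv_on_def
proof
  fix p :: "'n pt" assume "p \<in> \<Omega>"
  hence "0 < - fst p" "- fst p \<le> - T" using time_in[of p] T by auto
  from neg_time_deriv[OF mode_derivs(2)[OF this, of "- t0" "w v" UNIV]]
  show "((\<lambda>s. Kt' v (shift Dt p s)) has_vector_derivative (w v)\<^sup>2 * Kr v p * Kt v p)
     (at (coord Dt p) within {s. shift Dt p s \<in> \<Omega>})"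
    by (cases p) (simp add: Kt_def Kt'_def Kr_def divide_inverse)
qed

lemma Kr_pderiv: "pderiv_on \<Omega> Dt (Kr v) (\<lambda>p. - 1 * (Kr v p * Kr v p))"
  unfolding pderiv_on_def
proof
  fix p :: "'n pt" assume "p \<in> \<Omega>"
  hence nz: "fst p \<noteq> 0" using time_in[of p] T by auto
  have "((\<lambda>s. complex_of_real (1 / s)) has_vector_derivative of_real (- 1 / (fst p * fst p)))
      (at (fst p) within {s. shift Dt p s \<in> \<Omega>})"
    by (rule has_vector_derivative_of_real)
       (use nz in \<open>auto intro!: derivative_eq_intros simp: has_real_derivative_iff_has_vector_derivative[symmetric] divide_inverse\<close>)
  thus "((\<lambda>s. Kr v (shift Dt p s)) has_vector_derivative - 1 * (Kr v p * Kr v p))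
     (at (coord Dt p) within {s. shift Dt p s \<in> \<Omega>})"
    by (cases p) (simp add: Kr_def)
qed

lemma Ky_pderiv: "pderiv_on \<Omega> (Dy j) (Ky k v) (\<lambda>p. if j = k then 1 else 0)"
  unfolding pderiv_on_def
proof
  fix p :: "'n pt"
  have "((\<lambda>s. complex_of_real s) has_vector_derivative of_real 1) (at (coord (Dy j) p) within {s. shift (Dy j) p s \<in> \<Omega>})"
    by (rule has_vector_derivative_of_real) (auto intro!: derivative_eq_intros)
  thus "((\<lambda>s. Ky k v (shift (Dy j) p s)) has_vector_derivative (if j = k then 1 else 0))
     (at (coord (Dy j) p) within {s. shift (Dy j) p s \<in> \<Omega>})"
    by (cases p; cases "j = k") (simp_all add: Ky_def)
qed

text \<open>The constant combines the factor 1/nu in the derivative of \<open>J01\<close> with the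
  derivative y_j/N of rho.\<close>

lemma KJ_pderiv:
  assumes "j < N"
  shows "pderiv_on \<Omega> (Dy j) (KJ m v)
    (\<lambda>p. of_real (1 / ((real N / 2 + real m) * real N)) * (\<zeta> v * (Ky j v p * KJ (Suc m) v p)))"
  unfolding pderiv_on_def
proof
  fix p :: "'n pt"
  obtain t x y where p: "p = (t, x, y)" by (cases p)
  let ?\<nu> = "real N / 2 + real m"
  have \<nu>: "?\<nu> > 0" using N by (simp add: add_pos_nonneg)
  let ?c = "(\<Sum>k\<in>{..<N} - {j}. (y k)\<^sup>2)"
  have rho: "rho N (y(j := s)) = (s\<^sup>2 + ?c) / (2 * real N)" for s
    unfolding rho_def using assms by (subst sum.remove[of _ j]) (auto intro!: arg_cong[where f = "\<lambda>x. x / _"])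
  have "((\<lambda>z. J01 ?\<nu> (\<zeta> v * ((z\<^sup>2 + of_real ?c) / (2 * of_nat N)))) has_field_derivative
      J01 (?\<nu> + 1) (\<zeta> v * (((of_real (y j))\<^sup>2 + of_real ?c) / (2 * of_nat N))) / of_real ?\<nu> * (\<zeta> v * (of_real (y j) / of_nat N)))
      (at (of_real (y j)))"
    by (rule DERIV_chain2[OF J01_has_field_derivative[OF \<nu>]]) (use N in \<open>auto intro!: derivative_eq_intros simp: field_simps\<close>)
  from has_vector_derivative_real_field[OF this]
  have "((\<lambda>s. J01 ?\<nu> (\<zeta> v * of_real (rho N (y(j := s))))) has_vector_derivative
      J01 (?\<nu> + 1) (\<zeta> v * of_real (rho N (y(j := y j)))) / of_real ?\<nu> * (\<zeta> v * (of_real (y j) / of_nat N)))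
      (at (y j) within {s. shift (Dy j) p s \<in> \<Omega>})"
    unfolding rho by simp
  thus "((\<lambda>s. KJ m v (shift (Dy j) p s)) has_vector_derivative
      of_real (1 / (?\<nu> * real N)) * (\<zeta> v * (Ky j v p * KJ (Suc m) v p)))
     (at (coord (Dy j) p) within {s. shift (Dy j) p s \<in> \<Omega>})"
    by (simp add: KJ_def Ky_def p add_ac mult_ac)
qed

lemma pderiv_zero:
  "d \<noteq> Dt \<Longrightarrow> pderiv_on \<Omega> d (Kt v) (\<lambda>p. 0)" "d \<noteq> Dt \<Longrightarrow> pderiv_on \<Omega> d (Kt' v) (\<lambda>p. 0)"
  "d \<noteq> Dt \<Longrightarrow> pderiv_on \<Omega> d (Kr v) (\<lambda>p. 0)"
  "(\<And>i. d \<noteq> Dx i) \<Longrightarrow> pderiv_on \<Omega> d (Kx v) (\<lambda>p. 0)"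
  "(\<And>j. d \<noteq> Dy j) \<Longrightarrow> pderiv_on \<Omega> d (Ky k v) (\<lambda>p. 0)"
  "(\<And>j. d \<noteq> Dy j) \<Longrightarrow> pderiv_on \<Omega> d (KJ m v) (\<lambda>p. 0)"
  "pderiv_on \<Omega> d (\<lambda>p. c) (\<lambda>p. 0::complex)"
  by (intro pderiv_on_zero, cases d, auto simp: Kt_def Kt'_def Kr_def Kx_def Ky_def KJ_def)+

lemma rho_nonneg: "rho N y \<ge> 0"
  unfolding rho_def by (intro divide_nonneg_nonneg sum_nonneg) auto

lemma kernel_okI:
  assumes "\<And>p. p \<in> \<Omega> \<Longrightarrow> (\<lambda>v. K v p) \<in> borel_measurable \<mu>" "\<And>v. continuous_on \<Omega> (K v)"
    and "\<And>R. R \<ge> 0 \<Longrightarrow> \<exists>B\<ge>0. \<exists>m. \<forall>v. \<forall>p\<in>\<Omega>. psize N p \<le> R \<longrightarrow> norm (K v p) \<le> B * W v ^ m"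
  shows "kernel_ok \<mu> W \<Omega> N K"
  unfolding kernel_ok_def
proof (intro conjI allI ballI)
  fix R :: real
  obtain B m where B: "B \<ge> 0" "\<And>v p. p \<in> \<Omega> \<Longrightarrow> psize N p \<le> \<bar>R\<bar> \<Longrightarrow> norm (K v p) \<le> B * W v ^ m"
    using assms(3)[of "\<bar>R\<bar>"] by auto
  thus "\<exists>B\<ge>0. \<exists>m. \<forall>v. \<forall>p\<in>\<Omega>. psize N p \<le> R \<longrightarrow> norm (K v p) \<le> B * W v ^ m"
    by (intro exI[of _ B] conjI exI[of _ m] allI ballI impI) (auto intro: order_trans[OF _ abs_ge_self])
qed (use assms in auto)

lemma kernel_okI':
  assumes "\<And>p. p \<in> \<Omega> \<Longrightarrow> (\<lambda>v. K v p) \<in> borel_measurable \<mu>" "\<And>v. continuous_on \<Omega> (K v)"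
    and "B \<ge> 0" "\<And>v p. p \<in> \<Omega> \<Longrightarrow> norm (K v p) \<le> B * W v ^ m"
  shows "kernel_ok \<mu> W \<Omega> N K"
  by (rule kernel_okI[OF assms(1,2)]) (use assms(3,4) in blast)+

lemma continuous_t: "continuous_on X (f :: real \<Rightarrow> complex) \<Longrightarrow> (\<And>p. p \<in> Y \<Longrightarrow> - fst p \<in> X) \<Longrightarrow> continuous_on Y (\<lambda>p :: 'n pt. f (- fst p))"
  by (rule continuous_on_compose2[of X f]) (auto intro!: continuous_intros)

lemma gens_ok: "K \<in> gens \<Longrightarrow> kernel_ok \<mu> W \<Omega> N K"
proof -
  have s0: "0 < - t0" "- t0 \<le> - T" using T by auto
  have W0: "W v ^ m \<ge> 1" for v m using W by (simp add: one_le_power)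
  have AW: "A * W v ^ m \<ge> 0" for v m using A W0[of v m] by simp
  have xi: "kernel_ok \<mu> W \<Omega> N (\<lambda>v p. of_real (\<xi> v $ i))" for i
  proof (rule kernel_okI'[where B = 1 and m = 1])
    show "norm (complex_of_real (\<xi> v $ i)) \<le> 1 * W v ^ 1" for v
      using component_le_norm_cart[of "\<xi> v" i] xi_bound[of v] by simp
    show "(\<lambda>v. complex_of_real (\<xi> v $ i)) \<in> borel_measurable \<mu>"
      unfolding cart_eq_inner_axis by measurable
  qed auto
  have ww: "kernel_ok \<mu> W \<Omega> N (\<lambda>v p. (w v)\<^sup>2)"
    by (rule kernel_okI'[where B = A and m = a]) (use A w_bound in \<open>auto simp: norm_power\<close>)
  have zz: "kernel_ok \<mu> W \<Omega> N (\<lambda>v p. \<zeta> v)"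
  proof (rule kernel_okI'[where B = "A\<^sup>2" and m = "2 * a"])
    fix v
    have "sqrt (norm (\<zeta> v)) \<le> exp (sqrt (norm (\<zeta> v)))" using exp_ge_add_one_self[of "sqrt (norm (\<zeta> v))"] by linarith
    also note zeta_bound
    finally have "(sqrt (norm (\<zeta> v)))\<^sup>2 \<le> (A * W v ^ a)\<^sup>2" by (rule power_mono) simp
    thus "norm (\<zeta> v) \<le> A\<^sup>2 * W v ^ (2 * a)" by (simp add: power_mult_distrib power_mult[symmetric] mult.commute)
  qed auto
  have kx: "kernel_ok \<mu> W \<Omega> N Kx"
  proof (rule kernel_okI'[where B = 1 and m = 0])
    show "(\<lambda>v. Kx v p) \<in> borel_measurable \<mu>" for p unfolding Kx_def by measurable
    show "continuous_on \<Omega> (Kx v)" for v unfolding Kx_def by (intro continuous_intros)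
  qed (auto simp: Kx_def)
  have kt: "kernel_ok \<mu> W \<Omega> N Kt"
  proof (rule kernel_okI'[where B = "4 * (T / t0)" and m = 0])
    show "(\<lambda>v. Kt v p) \<in> borel_measurable \<mu>" for p
      unfolding Kt_def by (rule measurable_compose[OF meas(2) mode_measurable(1)])
    show "continuous_on \<Omega> (Kt v)" for v
      unfolding Kt_def
    proof (rule continuous_t[where X = "{- t0..- T}"])
      show "continuous_on {- t0..- T} (mode (- t0) (- T) (w v))"
        unfolding continuous_on_eq_continuous_within using T
        by (auto intro!: has_vector_derivative_continuous[OF mode_derivs(1)])
    qed (use time_in in auto)
    show "norm (Kt v p) \<le> 4 * (T / t0) * W v ^ 0" if p: "p \<in> \<Omega>" for v p
    proof -
      have "norm (Kt v p) \<le> 4 * (- T / - t0) * exp (- 2 * Re (w v) * (sqrt (- T) - sqrt (- fst p)))"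
        unfolding Kt_def by (rule mode_bounds(1)[OF s0 Re_w time_in(1)[OF p]])
      also have "\<dots> \<le> 4 * (- T / - t0) * 1"
        using T Re_w[of v] time_in(1)[OF p] by (intro mult_left_mono) (auto simp: divide_nonpos_nonpos)
      finally show ?thesis by simp
    qed
  qed (use T in \<open>auto simp: divide_nonpos_nonpos\<close>)
  have kt': "kernel_ok \<mu> W \<Omega> N Kt'"
  proof (rule kernel_okI'[where B = "4 * (T / t0) / sqrt (- t0) * (2 * A)" and m = a])
    show "(\<lambda>v. Kt' v p) \<in> borel_measurable \<mu>" for p
      unfolding Kt'_def by (rule measurable_compose[OF meas(2) mode_measurable(2)])
    show "continuous_on \<Omega> (Kt' v)" for v
      unfolding Kt'_def
    proof (rule continuous_t[where X = "{- t0..- T}"])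
      show "continuous_on {- t0..- T} (mode' (- t0) (- T) (w v))"
        unfolding continuous_on_eq_continuous_within using T
        by (auto intro!: has_vector_derivative_continuous[OF mode_derivs(2)])
    qed (use time_in in auto)
    have c: "0 \<le> 4 * (T / t0) / sqrt (- t0)"
      using T by (intro divide_nonneg_nonneg mult_nonneg_nonneg divide_nonpos_nonpos) auto
    show "norm (Kt' v p) \<le> 4 * (T / t0) / sqrt (- t0) * (2 * A) * W v ^ a" if p: "p \<in> \<Omega>" for v p
    proof -
      \<comment> \<open>The hypotheses bound w^2 only; (a - 1/2)^2 >= 0 gives a <= 1 + a^2.\<close>
      have "norm (w v) \<le> 1 + (norm (w v))\<^sup>2"
        using sum_power2_ge_zero[of "norm (w v) - 1/2" 0] by (simp add: power2_eq_square algebra_simps)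
      also have "\<dots> \<le> A * W v ^ a + A * W v ^ a"
        using w_bound[of v] mult_mono[OF A W0[of v a]] A by (intro add_mono) auto
      finally have w: "norm (w v) \<le> 2 * A * W v ^ a" by simp
      have "norm (Kt' v p) \<le> 4 * (- T / - t0) / sqrt (- t0) * norm (w v)"
        unfolding Kt'_def by (rule mode_bounds(2)[OF s0 Re_w time_in(1)[OF p]])
      also have "\<dots> \<le> 4 * (T / t0) / sqrt (- t0) * (2 * A * W v ^ a)"
        using mult_left_mono[OF w c] by simp
      finally show ?thesis by (simp add: mult.assoc)
    qed
    show "0 \<le> 4 * (T / t0) / sqrt (- t0) * (2 * A)" using c A by (intro mult_nonneg_nonneg) auto
  qed
  have kr: "kernel_ok \<mu> W \<Omega> N Kr"
  proof (rule kernel_okI'[where B = "1 / - t0" and m = 0])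
    show "continuous_on \<Omega> (Kr v)" for v
      unfolding Kr_def using time_in T by (intro continuous_intros) force
    show "norm (Kr v p) \<le> 1 / - t0 * W v ^ 0" if "p \<in> \<Omega>" for v p
      using time_in(2)[OF that] T unfolding Kr_def norm_of_real
      by (simp add: abs_if field_simps)
  qed (use T in \<open>auto simp: Kr_def\<close>)
  have ky: "kernel_ok \<mu> W \<Omega> N (Ky j)" for j
  proof (rule kernel_okI)
    show "continuous_on \<Omega> (Ky j v)" for v
      unfolding Ky_def by (intro continuous_on_of_real continuous_on_y_coord)
    show "\<exists>B\<ge>0. \<exists>m. \<forall>v. \<forall>p\<in>\<Omega>. psize N p \<le> R \<longrightarrow> norm (Ky j v p) \<le> B * W v ^ m" if "R \<ge> 0" for R
    proof (intro exI[of _ "1 + R"] exI[of _ 0] conjI allI ballI impI)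
      fix v p assume p: "p \<in> \<Omega>" "psize N p \<le> R"
      show "norm (Ky j v p) \<le> (1 + R) * W v ^ 0"
      proof (cases "j < N")
        case True
        have "(snd (snd p) j)\<^sup>2 \<le> (\<Sum>j<N. (snd (snd p) j)\<^sup>2)" using True by (intro member_le_sum) auto
        also have "\<dots> \<le> R" using p(2) unfolding psize_def by (smt (verit) norm_ge_zero)
        finally have "\<bar>snd (snd p) j\<bar>\<^sup>2 \<le> R" by simp
        moreover have "\<bar>snd (snd p) j\<bar> \<le> 1 + \<bar>snd (snd p) j\<bar>\<^sup>2"
          using sum_power2_ge_zero[of "\<bar>snd (snd p) j\<bar> - 1/2" 0] by (simp add: power2_eq_square algebra_simps)
        ultimately show ?thesis unfolding Ky_def norm_of_real by simp
      next
        case False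
        thus ?thesis using p that by (auto simp: Ky_def dom_def RN_def)
      qed
    qed (use that in auto)
  qed (auto simp: Ky_def)
  have kj: "kernel_ok \<mu> W \<Omega> N (KJ m)" for m
  proof (rule kernel_okI)
    have \<nu>: "real N / 2 + real m \<ge> 1 / 2" "real N / 2 + real m > 0" using N by auto
    show "(\<lambda>v. KJ m v p) \<in> borel_measurable \<mu>" for p
      unfolding KJ_def by (rule measurable_compose[OF _ J01_measurable]) measurable
    show "continuous_on \<Omega> (KJ m v)" for v
    proof -
      have "continuous_on UNIV (J01 (real N / 2 + real m))"
        using J01_has_field_derivative[OF \<nu>(2)] DERIV_isCont continuous_at_imp_continuous_on by blast
      moreover have "continuous_on \<Omega> (\<lambda>p. \<zeta> v * complex_of_real (rho N (snd (snd p))))"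
        unfolding rho_def using N by (intro continuous_intros continuous_on_y_coord) auto
      ultimately show ?thesis unfolding KJ_def by (rule continuous_on_compose2) auto
    qed
    show "\<exists>B\<ge>0. \<exists>m'. \<forall>v. \<forall>p\<in>\<Omega>. psize N p \<le> R \<longrightarrow> norm (KJ m v p) \<le> B * W v ^ m'" if "R \<ge> 0" for R
    proof -
      \<comment> \<open>With this \<open>n\<close>, exp(2 sqrt(rho |zeta|)) is at most the n-th
        power of exp(sqrt|zeta|) whenever rho <= R. The power of \<open>W\<close> therefore depends
        on the region, as \<open>kernel_ok\<close> permits.\<close>
      obtain n :: nat where n: "2 * sqrt R \<le> real n" using real_arch_simple by blast
      have "norm (KJ m v p) \<le> A ^ n * W v ^ (a * n)" if p: "psize N p \<le> R" for v p
      proof -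
        have r: "rho N (snd (snd p)) \<le> R"
        proof -
          have "(\<Sum>j<N. (snd (snd p) j)\<^sup>2) \<le> R" using p unfolding psize_def by (smt (verit) norm_ge_zero)
          moreover have "(\<Sum>j<N. (snd (snd p) j)\<^sup>2) / (2 * real N) \<le> (\<Sum>j<N. (snd (snd p) j)\<^sup>2) / 1"
            using N by (intro divide_left_mono sum_nonneg) auto
          ultimately show ?thesis by (simp add: rho_def)
        qed
        have "norm (KJ m v p) \<le> exp (2 * sqrt (norm (\<zeta> v * of_real (rho N (snd (snd p))))))"
          unfolding KJ_def by (rule J01_norm_le_exp_sqrt[OF \<nu>(1)])
        also have "2 * sqrt (norm (\<zeta> v * of_real (rho N (snd (snd p))))) = (2 * sqrt (rho N (snd (snd p)))) * sqrt (norm (\<zeta> v))"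
          using rho_nonneg by (simp add: norm_mult real_sqrt_mult abs_of_nonneg)
        also have "\<dots> \<le> real n * sqrt (norm (\<zeta> v))"
        proof (rule mult_right_mono)
          have "sqrt (rho N (snd (snd p))) \<le> sqrt R" using r by simp
          thus "2 * sqrt (rho N (snd (snd p))) \<le> real n" using n by linarith
        qed simp
        also have "exp (real n * sqrt (norm (\<zeta> v))) = exp (sqrt (norm (\<zeta> v))) ^ n"
          by (rule exp_of_nat_mult)
        also have "\<dots> \<le> (A * W v ^ a) ^ n" by (intro power_mono zeta_bound) simp
        finally show ?thesis by (simp add: power_mult_distrib power_mult)
      qed
      thus ?thesis using A by (intro exI[of _ "A ^ n"] exI[of _ "a * n"] conjI) auto
    qed
  qed
  show "K \<in> gens \<Longrightarrow> kernel_ok \<mu> W \<Omega> N K"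
    unfolding gens_def using xi ww zz kx kt kt' kr ky kj kconst_ok[of W, OF W] by auto
qed

end

lemma pderiv_on_mult3:
  fixes f g h :: "('n::finite) pt \<Rightarrow> complex"
  assumes "pderiv_on \<Omega> d f f'" "pderiv_on \<Omega> d g g'" "pderiv_on \<Omega> d h h'"
  shows "pderiv_on \<Omega> d (\<lambda>p. f p * g p * h p) (\<lambda>p. f' p * g p * h p + f p * g' p * h p + f p * g p * h' p)"
  unfolding pderiv_on_def
proof
  fix p assume p: "p \<in> \<Omega>"
  note D = assms[unfolded pderiv_on_def, rule_format, OF p]
  show "((\<lambda>s. f (shift d p s) * g (shift d p s) * h (shift d p s)) has_vector_derivative
      f' p * g p * h p + f p * g' p * h p + f p * g p * h' p) (at (coord d p) within {s. shift d p s \<in> \<Omega>})"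
    using has_vector_derivative_mult[OF has_vector_derivative_mult[OF D(1,2)] D(3)]
    by (simp add: algebra_simps)
qed

lemma pderiv_on_cmult:
  fixes f :: "('n::finite) pt \<Rightarrow> complex"
  shows "pderiv_on \<Omega> d f f' \<Longrightarrow> pderiv_on \<Omega> d (\<lambda>p. c * f p) (\<lambda>p. c * f' p)"
  unfolding pderiv_on_def by (auto intro: has_vector_derivative_mult_right)

lemma pderiv_on_eq: "pderiv_on \<Omega> d f g \<Longrightarrow> (\<And>p. p \<in> \<Omega> \<Longrightarrow> g p = g' p) \<Longrightarrow> pderiv_on \<Omega> d f g'"
  unfolding pderiv_on_def by auto

context wave_family
begin

lemma gens_kgen: "kgen \<mu> W T t0 N gens"
  unfolding kgen_def
proof (intro conjI ballI allI)
  show "W v \<ge> 1" for v by (rule W)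
  fix K assume K: "K \<in> gens"
  show "kernel_ok \<mu> W \<Omega> N K" by (rule gens_ok[OF K])
  fix d :: "'n dir" assume d: "d \<in> dirs N"
  \<comment> \<open>All generators that do not depend on the point are merged into one case with
    derivative 0.\<close>
  consider c where "K = (\<lambda>v p. c v)" | "K = Kx" | "K = Kt" | "K = Kt'" | "K = Kr" | k where "K = Ky k" | m where "K = KJ m"
  proof -
    let ?C = "range (\<lambda>c v (p :: 'n pt). c) \<union> range (\<lambda>i v p. complex_of_real (\<xi> v $ i)) \<union> {\<lambda>v p. (w v)\<^sup>2, \<lambda>v p. \<zeta> v}"
    have const: "\<exists>c. K = (\<lambda>v p. c v)" if "K \<in> ?C"
      using that by (elim UnE rangeE insertE emptyE) (simp only:, rule exI, rule refl)+
    have "K \<in> ?C \<or> K = Kx \<or> K = Kt \<or> K = Kt' \<or> K = Kr \<or> K \<in> range Ky \<or> K \<in> range KJ"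
      using K unfolding gens_def by (simp only: Un_iff insert_iff empty_iff simp_thms) argo
    thus thesis
    proof (elim disjE)
      assume "K \<in> ?C"
      from const[OF this] show thesis by (elim exE) (rule that(1))
    next
      assume "K \<in> range Ky"
      thus thesis by (elim rangeE) (rule that(6))
    next
      assume "K \<in> range KJ"
      thus thesis by (elim rangeE) (rule that(7))
    qed (rule that(2) that(3) that(4) that(5); assumption)+
  qed
  thus "\<exists>K'\<in>kalg gens. \<forall>v. pderiv_on \<Omega> d (K v) (K' v)"
  proof cases
    case 1
    thus ?thesis using pderiv_zero(7) by (intro bexI[OF _ gens_mem(1)[of 0]]) auto
  next
    case 2
    show ?thesis
    proof (cases "\<exists>i. d = Dx i")
      case True
      then obtain i where "d = Dx i" by blast
      thus ?thesis using Kx_pderiv 2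
        by (intro bexI[OF _ kalg.mult[OF kalg.mult[OF gens_mem(1)[of \<i>] gens_mem(2)[of i]] gens_mem(5)]]) auto
    next
      case False
      thus ?thesis using pderiv_zero(4)[of d] 2 by (intro bexI[OF _ gens_mem(1)[of 0]]) auto
    qed
  next
    case 3
    show ?thesis
    proof (cases "d = Dt")
      case True
      thus ?thesis using Kt_pderiv 3 by (intro bexI[OF _ kalg.mult[OF gens_mem(1)[of "- 1"] gens_mem(7)]]) auto
    next
      case False
      thus ?thesis using pderiv_zero(1)[of d] 3 by (intro bexI[OF _ gens_mem(1)[of 0]]) auto
    qed
  next
    case 4
    show ?thesis
    proof (cases "d = Dt")
      case True
      thus ?thesis using Kt'_pderiv 4 by (intro bexI[OF _ kalg.mult[OF kalg.mult[OF gens_mem(3) gens_mem(8)] gens_mem(6)]]) auto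
    next
      case False
      thus ?thesis using pderiv_zero(2)[of d] 4 by (intro bexI[OF _ gens_mem(1)[of 0]]) auto
    qed
  next
    case 5
    show ?thesis
    proof (cases "d = Dt")
      case True
      thus ?thesis using Kr_pderiv 5 by (intro bexI[OF _ kalg.mult[OF gens_mem(1)[of "- 1"] kalg.mult[OF gens_mem(8) gens_mem(8)]]]) auto
    next
      case False
      thus ?thesis using pderiv_zero(3)[of d] 5 by (intro bexI[OF _ gens_mem(1)[of 0]]) auto
    qed
  next
    case 6
    show ?thesis
    proof (cases "\<exists>j. d = Dy j")
      case True
      then obtain j where "d = Dy j" by blast
      thus ?thesis using Ky_pderiv[of j k] 6
        by (intro bexI[OF _ gens_mem(1)[of "if j = k then 1 else 0"]]) auto
    next
      case False
      thus ?thesis using pderiv_zero(5)[of d k] 6 by (intro bexI[OF _ gens_mem(1)[of 0]]) auto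
    qed
  next
    case 7
    show ?thesis
    proof (cases "\<exists>j. d = Dy j")
      case True
      then obtain j where j: "d = Dy j" by blast
      hence "j < N" using d by simp
      from KJ_pderiv[OF this, of m] show ?thesis using 7 j
        by (intro bexI[OF _ kalg.mult[OF gens_mem(1)[of "of_real (1 / ((real N / 2 + real m) * real N))"]
              kalg.mult[OF gens_mem(4) kalg.mult[OF gens_mem(9)[of j] gens_mem(10)[of "Suc m"]]]]]) auto
    next
      case False
      thus ?thesis using pderiv_zero(6)[of d m] 7 by (intro bexI[OF _ gens_mem(1)[of 0]]) auto
    qed
  qed
qed

section \<open>The product kernel and the wave equation\<close>

definition K0 :: "'w \<Rightarrow> 'n pt \<Rightarrow> complex" where "K0 v p = Kx v p * Kt v p * KJ 0 v p"

definition K1 :: "'n dir \<Rightarrow> 'w \<Rightarrow> 'n pt \<Rightarrow> complex" where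
  "K1 d v p = (case d of
      Dt \<Rightarrow> - 1 * (Kx v p * Kt' v p * KJ 0 v p)
    | Dx i \<Rightarrow> \<i> * of_real (\<xi> v $ i) * (Kx v p * Kt v p * KJ 0 v p)
    | Dy j \<Rightarrow> of_real (1 / (real N / 2 * real N)) * (\<zeta> v * (Ky j v p * (Kx v p * Kt v p * KJ 1 v p))))"

definition K2 :: "'n dir \<Rightarrow> 'w \<Rightarrow> 'n pt \<Rightarrow> complex" where
  "K2 d v p = (case d of
      Dt \<Rightarrow> - 1 * (Kx v p * ((w v)\<^sup>2 * Kr v p * Kt v p) * KJ 0 v p)
    | Dx i \<Rightarrow> \<i> * of_real (\<xi> v $ i) * (\<i> * of_real (\<xi> v $ i) * (Kx v p * Kt v p * KJ 0 v p))
    | Dy j \<Rightarrow> of_real (1 / (real N / 2 * real N)) * (\<zeta> v * (Kx v p * Kt v p * KJ 1 v p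
        + Ky j v p * (Kx v p * Kt v p * (of_real (1 / ((real N / 2 + 1) * real N)) * (\<zeta> v * (Ky j v p * KJ 2 v p)))))))"

lemmas kalg_intros = kalg.add kalg.mult gens_mem

lemma K_mem: "K0 \<in> kalg gens" "K1 d \<in> kalg gens" "K2 d \<in> kalg gens"
proof -
  show "K0 \<in> kalg gens"
    unfolding K0_def[abs_def] by (intro kalg_intros)
  show "K1 d \<in> kalg gens"
    unfolding K1_def[abs_def] by (cases d) (simp_all only: dir.case, (intro kalg_intros)+)
  show "K2 d \<in> kalg gens"
    unfolding K2_def[abs_def] by (cases d) (simp_all only: dir.case, (intro kalg_intros)+)
qed

lemma K0_pderiv: "d \<in> dirs N \<Longrightarrow> pderiv_on \<Omega> d (K0 v) (K1 d v)"
proof (cases d)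
  case Dt
  show ?thesis unfolding Dt K0_def[abs_def]
    by (rule pderiv_on_eq[OF pderiv_on_mult3[OF pderiv_zero(4) Kt_pderiv pderiv_zero(6)]]) (auto simp: K1_def)
next
  case (Dx i)
  show ?thesis unfolding Dx K0_def[abs_def]
    by (rule pderiv_on_eq[OF pderiv_on_mult3[OF Kx_pderiv pderiv_zero(1) pderiv_zero(6)]]) (auto simp: K1_def)
next
  case (Dy j)
  assume "d \<in> dirs N"
  hence "j < N" using Dy by simp
  from KJ_pderiv[OF this, of 0]
  show ?thesis unfolding Dy K0_def[abs_def]
    by (intro pderiv_on_eq[OF pderiv_on_mult3[OF pderiv_zero(4) pderiv_zero(1)]]) (auto simp: K1_def mult_ac)
qed

lemma K1_pderiv: "d \<in> dirs N \<Longrightarrow> pderiv_on \<Omega> d (K1 d v) (K2 d v)"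
proof (cases d)
  case Dt
  show ?thesis unfolding Dt K1_def[abs_def] dir.case
    by (rule pderiv_on_eq[OF pderiv_on_cmult[OF pderiv_on_mult3[OF pderiv_zero(4) Kt'_pderiv pderiv_zero(6)]]]) (auto simp: K2_def)
next
  case (Dx i)
  show ?thesis unfolding Dx K1_def[abs_def] dir.case
    by (rule pderiv_on_eq[OF pderiv_on_cmult[OF pderiv_on_mult3[OF Kx_pderiv pderiv_zero(1) pderiv_zero(6)]]]) (auto simp: K2_def)
next
  case (Dy j)
  assume "d \<in> dirs N"
  hence j: "j < N" using Dy by simp
  have 1: "pderiv_on \<Omega> (Dy j) (\<lambda>p. Kx v p * Kt v p * KJ 1 v p)
      (\<lambda>p. Kx v p * Kt v p * (of_real (1 / ((real N / 2 + 1) * real N)) * (\<zeta> v * (Ky j v p * KJ 2 v p))))"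
    by (rule pderiv_on_eq[OF pderiv_on_mult3[OF pderiv_zero(4) pderiv_zero(1) KJ_pderiv[OF j, of 1]]])
       (auto simp: numeral_2_eq_2)
  \<comment> \<open>The inserted factor 1 only brings the product into the shape of
    \<open>pderiv_on_mult3\<close>.\<close>
  have 2: "pderiv_on \<Omega> (Dy j) (\<lambda>p. Ky j v p * 1 * (Kx v p * Kt v p * KJ 1 v p))
     (\<lambda>p. Kx v p * Kt v p * KJ 1 v p + Ky j v p * (Kx v p * Kt v p * (of_real (1 / ((real N / 2 + 1) * real N)) * (\<zeta> v * (Ky j v p * KJ 2 v p)))))"
    by (rule pderiv_on_eq[OF pderiv_on_mult3[OF Ky_pderiv pderiv_zero(7) 1]]) simp
  have 3: "pderiv_on \<Omega> (Dy j) (\<lambda>p. Ky j v p * (Kx v p * Kt v p * KJ 1 v p))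
     (\<lambda>p. Kx v p * Kt v p * KJ 1 v p + Ky j v p * (Kx v p * Kt v p * (of_real (1 / ((real N / 2 + 1) * real N)) * (\<zeta> v * (Ky j v p * KJ 2 v p)))))"
    using 2 by (simp only: mult_1_right)
  show ?thesis unfolding Dy K1_def[abs_def] K2_def[abs_def] dir.case
    by (rule pderiv_on_cmult[OF pderiv_on_cmult[OF 3]])
qed

text \<open>The y-Laplacian gives N equal terms with \<open>KJ 1\<close> and, because the squares of
  the y_j add up to 2 N rho, one term with \<open>KJ 2\<close>; \<open>J01_contiguous\<close> merges
  them into (2/N) zeta times the mode. The rest cancels by \<open>dispersion\<close>.\<close>

lemma K_pde:
  assumes p: "p \<in> \<Omega>"
  shows "- of_real (2 * fst p / real N) * K2 Dt v p - (\<Sum>i\<in>UNIV. K2 (Dx i) v p) - (\<Sum>j<N. K2 (Dy j) v p) = 0"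
proof -
  define M where "M = Kx v p * Kt v p"
  define n where "n = complex_of_real (real N)"
  define r where "r = complex_of_real (rho N (snd (snd p)))"
  have n0: "n \<noteq> 0" and n2: "n / 2 + 1 \<noteq> 0"
  proof -
    show "n \<noteq> 0" using N by (simp add: n_def)
    have "n / 2 + 1 = of_real (real N / 2 + 1)" by (simp add: n_def)
    also have "\<dots> \<noteq> 0" unfolding of_real_eq_0_iff using N by simp
    finally show "n / 2 + 1 \<noteq> 0" .
  qed
  have t0: "fst p \<noteq> 0" using time_in[OF p] T by auto
  have tt: "- of_real (2 * fst p / real N) * K2 Dt v p = 2 / n * (w v)\<^sup>2 * (M * KJ 0 v p)"
    using t0 n0 by (simp add: K2_def Kr_def M_def n_def field_simps)
  have "(\<Sum>i\<in>UNIV. K2 (Dx i) v p) = (\<Sum>i\<in>UNIV. of_real (- ((\<xi> v $ i)\<^sup>2)) * (M * KJ 0 v p))"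
    by (simp add: K2_def M_def power2_eq_square mult.assoc[symmetric])
       (simp add: mult_ac)
  also have "\<dots> = - of_real ((norm (\<xi> v))\<^sup>2) * (M * KJ 0 v p)"
    unfolding sum_distrib_right[symmetric] of_real_sum[symmetric] sum_negf norm_vec_def L2_set_def
    by (simp add: sum_nonneg)
  finally have xx: "(\<Sum>i\<in>UNIV. K2 (Dx i) v p) = - of_real ((norm (\<xi> v))\<^sup>2) * (M * KJ 0 v p)" .
  have y2: "(\<Sum>j<N. (Ky j v p)\<^sup>2) = 2 * n * r"
    unfolding Ky_def of_real_power[symmetric] of_real_sum[symmetric] r_def n_def rho_def using N by simp
  have "(\<Sum>j<N. K2 (Dy j) v p) = (\<Sum>j<N. (1 / (n / 2 * n)) * \<zeta> v * M * KJ 1 v p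
      + (1 / (n / 2 * n)) * (1 / ((n / 2 + 1) * n)) * (\<zeta> v)\<^sup>2 * M * KJ 2 v p * (Ky j v p)\<^sup>2)"
    by (intro sum.cong refl) (simp add: K2_def M_def n_def power2_eq_square algebra_simps)
  also have "\<dots> = n * ((1 / (n / 2 * n)) * \<zeta> v * M * KJ 1 v p)
     + (1 / (n / 2 * n)) * (1 / ((n / 2 + 1) * n)) * (\<zeta> v)\<^sup>2 * M * KJ 2 v p * (2 * n * r)"
    unfolding sum.distrib sum_distrib_left[symmetric] y2 by (simp add: n_def)
  also have "\<dots> = (2 / n) * \<zeta> v * M * ((\<zeta> v * r) * KJ 2 v p / ((n / 2) * (n / 2 + 1)) + KJ 1 v p)"
  proof -
    have a: "n * ((1 / (n / 2 * n)) * \<zeta> v * M * KJ 1 v p) = (2 / n) * \<zeta> v * M * KJ 1 v p"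
      using n0 by (simp add: field_simps)
    have b: "(1 / (n / 2 * n)) * (1 / ((n / 2 + 1) * n)) * (\<zeta> v)\<^sup>2 * M * KJ 2 v p * (2 * n * r)
       = (2 / n) * \<zeta> v * M * ((\<zeta> v * r) * KJ 2 v p / ((n / 2) * (n / 2 + 1)))"
      using n0 n2 by (simp add: divide_simps power2_eq_square)
    show ?thesis unfolding a b by (simp add: algebra_simps)
  qed
  also have "(\<zeta> v * r) * KJ 2 v p / ((n / 2) * (n / 2 + 1)) + KJ 1 v p = KJ 0 v p"
    using J01_contiguous[of "real N / 2" "\<zeta> v * r"] N
    unfolding KJ_def r_def n_def by simp
  finally have yy: "(\<Sum>j<N. K2 (Dy j) v p) = (2 / n) * \<zeta> v * (M * KJ 0 v p)" by (simp add: mult.assoc)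
  have disp: "2 / n * (w v)\<^sup>2 = 2 / n * \<zeta> v - of_real ((norm (\<xi> v))\<^sup>2)"
    unfolding dispersion n_def using N by (simp add: field_simps)
  show ?thesis unfolding tt xx yy disp by (simp add: algebra_simps)
qed

text \<open>The equation holds for each mode and has real coefficients, so it survives integration
  and the passage to real parts.\<close>

lemma kint_wave_part:
  assumes g: "weight_ok \<mu> W g"
  shows "wave_part T t0 N (kint \<mu> g K0)"
proof -
  have ok: "kernel_ok \<mu> W \<Omega> N K0" "kernel_ok \<mu> W \<Omega> N (K1 d)" "kernel_ok \<mu> W \<Omega> N (K2 d)" for d
    using kalg_kernel[OF gens_kgen K_mem(1)] kalg_kernel[OF gens_kgen K_mem(2)] kalg_kernel[OF gens_kgen K_mem(3)] by blast+
  have pde: "- (2 * fst p / real N) * kint \<mu> g (K2 Dt) p - (\<Sum>i\<in>UNIV. kint \<mu> g (K2 (Dx i)) p)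
      - (\<Sum>j<N. kint \<mu> g (K2 (Dy j)) p) = 0" if p: "p \<in> \<Omega>" for p
  proof -
    note int = kernel_integrable[OF ok(3) g p]
    let ?c = "- of_real (2 * fst p / real N) :: complex"
    have "0 = (\<integral>v. g v * (?c * K2 Dt v p - (\<Sum>i\<in>UNIV. K2 (Dx i) v p) - (\<Sum>j<N. K2 (Dy j) v p)) \<partial>\<mu>)"
      unfolding K_pde[OF p] by simp
    also have "\<dots> = (\<integral>v. ?c * (g v * K2 Dt v p) - (\<Sum>i\<in>UNIV. g v * K2 (Dx i) v p) - (\<Sum>j<N. g v * K2 (Dy j) v p) \<partial>\<mu>)"
      by (simp add: algebra_simps sum_distrib_left)
    also have "\<dots> = ?c * (\<integral>v. g v * K2 Dt v p \<partial>\<mu>) - (\<Sum>i\<in>UNIV. \<integral>v. g v * K2 (Dx i) v p \<partial>\<mu>)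
        - (\<Sum>j<N. \<integral>v. g v * K2 (Dy j) v p \<partial>\<mu>)"
      using int by (simp add: Bochner_Integration.integral_diff Bochner_Integration.integral_sum del: of_real_divide of_real_mult)
    finally have "Re (?c * (\<integral>v. g v * K2 Dt v p \<partial>\<mu>) - (\<Sum>i\<in>UNIV. \<integral>v. g v * K2 (Dx i) v p \<partial>\<mu>)
        - (\<Sum>j<N. \<integral>v. g v * K2 (Dy j) v p \<partial>\<mu>)) = 0" by simp
    thus ?thesis unfolding kint_def of_real_minus[symmetric] by (simp del: of_real_divide of_real_mult of_real_minus)
  qed
  show ?thesis
    unfolding wave_part_def
  proof (rule conjI)
    show "\<exists>\<F>. deriv_closed T t0 N \<F> \<and> kint \<mu> g K0 \<in> \<F>"
      using kint_deriv_closed[OF gens_kgen g] K_mem(1) by blast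
    have "\<forall>d\<in>dirs N. pderiv_on \<Omega> d (kint \<mu> g K0) (kint \<mu> g (K1 d)) \<and> pderiv_on \<Omega> d (kint \<mu> g (K1 d)) (kint \<mu> g (K2 d))"
      by (intro ballI conjI kint_pderiv[OF ok(1) ok(2) g] kint_pderiv[OF ok(2) ok(3) g] K0_pderiv K1_pderiv)
    with pde show "\<exists>f1 f2. (\<forall>d\<in>dirs N. pderiv_on \<Omega> d (kint \<mu> g K0) (f1 d) \<and> pderiv_on \<Omega> d (f1 d) (f2 d)) \<and>
        (\<forall>p\<in>\<Omega>. - (2 * fst p / real N) * f2 Dt p - (\<Sum>i\<in>UNIV. f2 (Dx i) p) - (\<Sum>j<N. f2 (Dy j) p) = 0)"
      by (intro exI[where x = "\<lambda>d. kint \<mu> g (K2 d)", THEN exI[where x = "\<lambda>d. kint \<mu> g (K1 d)"]]) blast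
  qed
qed

lemma K0_integrable: "weight_ok \<mu> W g \<Longrightarrow> p \<in> \<Omega> \<Longrightarrow> integrable \<mu> (\<lambda>v. g v * K0 v p)"
  using kernel_integrable kalg_kernel[OF gens_kgen K_mem(1)] by blast

end

section \<open>The heat flow\<close>

definition heat_kernel :: "real \<Rightarrow> real^'n \<Rightarrow> 'n pt \<Rightarrow> complex" where
  "heat_kernel T \<xi> p = cis (\<xi> \<bullet> fst (snd p)) * of_real (exp (- (norm \<xi>)\<^sup>2 * (fst p - T)))"

text \<open>The kernel calculus is reused without y-variables (N = 0) and with weight 1 + |xi|: the
  exponential is at most 1 because t >= T, and each time derivative costs just a factor
  |xi|^2.\<close>

lemma heat_kernel_solution:
  fixes H :: "real^'n \<Rightarrow> complex"
  assumes T: "T < t0" and H: "H \<in> borel_measurable borel" "\<And>m. integrable lborel (\<lambda>\<xi>. norm (H \<xi>) * (1 + norm \<xi>) ^ m)"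
    and h: "\<And>x. (\<integral>\<xi>. H \<xi> * cis (\<xi> \<bullet> x) \<partial>lborel) = of_real (h x)"
  shows "heat_solution T t0 h (\<lambda>t x. kint lborel H (heat_kernel T) (t, x, \<lambda>_. 0))"
proof -
  let ?\<Omega> = "dom T t0 0 :: 'n pt set" and ?W = "\<lambda>\<xi> :: real^'n. 1 + norm \<xi>"
  define Kx where "Kx = (\<lambda>\<xi> (p :: 'n pt). cis (\<xi> \<bullet> fst (snd p)))"
  define Ke where "Ke = (\<lambda>(\<xi> :: real^'n) (p :: 'n pt). complex_of_real (exp (- (norm \<xi>)\<^sup>2 * (fst p - T))))"
  define Kn where "Kn = (\<lambda>(\<xi> :: real^'n) (p :: 'n pt). complex_of_real (- (norm \<xi>)\<^sup>2))"
  define Ki where "Ki i = (\<lambda>(\<xi> :: real^'n) (p :: 'n pt). \<i> * complex_of_real (\<xi> $ i))" for i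
  define G where "G = {Kx, Ke, Kn, \<lambda>\<xi> p. 0} \<union> range Ki"
  have mem: "Kx \<in> kalg G" "Ke \<in> kalg G" "Kn \<in> kalg G" "Ki i \<in> kalg G" "(\<lambda>\<xi> p. 0) \<in> kalg G" for i
    by (auto intro!: kalg.gen simp: G_def)
  have W: "?W \<xi> \<ge> 1" for \<xi> by simp
  have okI: "kernel_ok lborel ?W ?\<Omega> 0 K" if "\<And>p. (\<lambda>\<xi>. K \<xi> p) \<in> borel_measurable lborel" "\<And>\<xi>. continuous_on ?\<Omega> (K \<xi>)"
    "\<And>\<xi> p. p \<in> ?\<Omega> \<Longrightarrow> norm (K \<xi> p) \<le> 1 * ?W \<xi> ^ m" for K m
    unfolding kernel_ok_def using that by (intro conjI ballI allI exI[of _ 1] exI[of _ m] impI) auto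
  have tin: "T \<le> fst p" if "p \<in> ?\<Omega>" for p using that by (auto simp: dom_def)
  have ok: "kernel_ok lborel ?W ?\<Omega> 0 K" if "K \<in> G" for K
  proof -
    have "kernel_ok lborel ?W ?\<Omega> 0 Kx"
      by (rule okI[where m = 0]) (auto simp: Kx_def intro!: continuous_intros)
    moreover have "kernel_ok lborel ?W ?\<Omega> 0 Ke"
      by (rule okI[where m = 0]) (use tin in \<open>auto simp: Ke_def intro!: continuous_intros\<close>)
    moreover have "kernel_ok lborel ?W ?\<Omega> 0 Kn"
      by (rule okI[where m = 2]) (auto simp: Kn_def norm_power power_mono simp del: of_real_minus of_real_power)
    moreover have "kernel_ok lborel ?W ?\<Omega> 0 (Ki i)" for i
    proof (rule okI[where m = 1])
      show "norm (Ki i \<xi> p) \<le> 1 * (1 + norm \<xi>) ^ 1" for \<xi> p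
        using component_le_norm_cart[of \<xi> i] by (simp add: Ki_def norm_mult)
      show "(\<lambda>\<xi>. Ki i \<xi> p) \<in> borel_measurable lborel" for p
        unfolding Ki_def cart_eq_inner_axis by measurable
    qed (auto simp: Ki_def)
    moreover have "kernel_ok lborel ?W ?\<Omega> 0 (\<lambda>\<xi> p. 0)" by (rule kconst_ok) (rule W)
    ultimately show ?thesis using that unfolding G_def by auto
  qed
  have dx: "pderiv_on ?\<Omega> (Dx i) (Kx \<xi>) (\<lambda>p. Ki i \<xi> p * Kx \<xi> p)" for i \<xi>
    unfolding Kx_def Ki_def by (rule cis_pderiv)
  have dt: "pderiv_on ?\<Omega> Dt (Ke \<xi>) (\<lambda>p. Kn \<xi> p * Ke \<xi> p)" for \<xi>
    unfolding pderiv_on_def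
  proof
    fix p :: "'n pt"
    have "((\<lambda>s. complex_of_real (exp (- (norm \<xi>)\<^sup>2 * (s - T)))) has_vector_derivative
        of_real (- (norm \<xi>)\<^sup>2 * exp (- (norm \<xi>)\<^sup>2 * (fst p - T)))) (at (fst p) within {s. shift Dt p s \<in> ?\<Omega>})"
      by (rule has_vector_derivative_of_real) (auto intro!: derivative_eq_intros)
    thus "((\<lambda>s. Ke \<xi> (shift Dt p s)) has_vector_derivative Kn \<xi> p * Ke \<xi> p)
       (at (coord Dt p) within {s. shift Dt p s \<in> ?\<Omega>})"
      by (cases p) (simp add: Ke_def Kn_def)
  qed
  have z: "pderiv_on ?\<Omega> Dt (Kx \<xi>) (\<lambda>p. 0)" "pderiv_on ?\<Omega> (Dx i) (Ke \<xi>) (\<lambda>p. 0)"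
    "pderiv_on ?\<Omega> d (Kn \<xi>) (\<lambda>p. 0)" "pderiv_on ?\<Omega> d (Ki j \<xi>) (\<lambda>p. 0)" "pderiv_on ?\<Omega> d (\<lambda>p. 0 :: complex) (\<lambda>p. 0)" for \<xi> i j d
    by (intro pderiv_on_zero, auto simp: Kx_def Ke_def Kn_def Ki_def)+
  have kg: "kgen lborel ?W T t0 0 G"
    unfolding kgen_def
  proof (intro conjI allI ballI)
    fix K and d :: "'n dir" assume K: "K \<in> G" and d: "d \<in> dirs 0"
    from d consider "d = Dt" | i where "d = Dx i" by (auto simp: dirs_def)
    note dc = this
    have Z: "\<exists>K'\<in>kalg G. \<forall>v. pderiv_on ?\<Omega> d (K v) (K' v)" if "\<And>v. pderiv_on ?\<Omega> d (K v) (\<lambda>p. 0)"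
      using that by (intro bexI[OF _ mem(5)]) auto
    consider "K = Kx" | "K = Ke" | "K = Kn" | i where "K = Ki i" | "K = (\<lambda>\<xi> p. 0)" using K unfolding G_def by auto
    thus "\<exists>K'\<in>kalg G. \<forall>v. pderiv_on ?\<Omega> d (K v) (K' v)"
    proof cases
      case 1
      show ?thesis using dc
      proof cases
        case 2
        with 1 show ?thesis using dx by (intro bexI[OF _ kalg.mult[OF mem(4)[of i] mem(1)]]) auto
      qed (rule Z, simp add: 1 z)
    next
      case 2
      show ?thesis using dc
      proof cases
        case 1
        with 2 show ?thesis using dt by (intro bexI[OF _ kalg.mult[OF mem(3) mem(2)]]) auto
      qed (rule Z, simp add: 2 z)
    qed (rule Z, simp add: z)+
  qed (use W ok in auto)
  have g: "weight_ok lborel ?W H" unfolding weight_ok_def using H by simp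
  define K where "K = (\<lambda>\<xi> p. Kx \<xi> p * Ke \<xi> p)"
  define Kt where "Kt = (\<lambda>\<xi> p. Kn \<xi> p * (Kx \<xi> p * Ke \<xi> p))"
  define K1 where "K1 i = (\<lambda>\<xi> p. Ki i \<xi> p * (Kx \<xi> p * Ke \<xi> p))" for i
  define K2 where "K2 i = (\<lambda>\<xi> p. Ki i \<xi> p * (Ki i \<xi> p * (Kx \<xi> p * Ke \<xi> p)))" for i
  have K: "K \<in> kalg G" "Kt \<in> kalg G" "K1 i \<in> kalg G" "K2 i \<in> kalg G" for i
    unfolding K_def Kt_def K1_def K2_def by (intro kalg.mult mem)+
  have ok': "kernel_ok lborel ?W ?\<Omega> 0 L" if "L \<in> kalg G" for L using kalg_kernel[OF kg that] by blast
  have mult: "pderiv_on ?\<Omega> d f f' \<Longrightarrow> pderiv_on ?\<Omega> d k k' \<Longrightarrow> (\<And>p. k p * f' p + k' p * f p = l p) \<Longrightarrow> pderiv_on ?\<Omega> d (\<lambda>p. k p * f p) l"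
    for d and f f' k k' l :: "'n pt \<Rightarrow> complex"
    by (rule pderiv_on_eq[OF pderiv_on_mult])
  have dK: "pderiv_on ?\<Omega> Dt (K \<xi>) (Kt \<xi>)" "pderiv_on ?\<Omega> (Dx i) (K \<xi>) (K1 i \<xi>)" "pderiv_on ?\<Omega> (Dx i) (K1 i \<xi>) (K2 i \<xi>)" for \<xi> i
  proof -
    show "pderiv_on ?\<Omega> Dt (K \<xi>) (Kt \<xi>)"
      unfolding K_def by (rule mult[OF dt z(1)]) (simp add: Kt_def)
    show 1: "pderiv_on ?\<Omega> (Dx i) (K \<xi>) (K1 i \<xi>)"
      unfolding K_def by (rule mult[OF z(2) dx]) (simp add: K1_def)
    have "pderiv_on ?\<Omega> (Dx i) (\<lambda>p. Ki i \<xi> p * K \<xi> p) (K2 i \<xi>)"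
      by (rule mult[OF 1 z(4)]) (simp add: K1_def K2_def)
    thus "pderiv_on ?\<Omega> (Dx i) (K1 i \<xi>) (K2 i \<xi>)" by (simp add: K1_def K_def)
  qed
  have dI: "pderiv_on ?\<Omega> Dt (kint lborel H K) (kint lborel H Kt)" "pderiv_on ?\<Omega> (Dx i) (kint lborel H K) (kint lborel H (K1 i))"
    "pderiv_on ?\<Omega> (Dx i) (kint lborel H (K1 i)) (kint lborel H (K2 i))" for i
    by (rule kint_pderiv[OF ok' ok' g], (intro K dK dirs_simps)+)+
  have pde: "kint lborel H Kt p - (\<Sum>i\<in>UNIV. kint lborel H (K2 i) p) = 0" if p: "p \<in> ?\<Omega>" for p
  proof -
    have "H \<xi> * Kt \<xi> p = (\<Sum>i\<in>UNIV. H \<xi> * K2 i \<xi> p)" for \<xi>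
    proof -
      have "(\<Sum>i\<in>UNIV. H \<xi> * K2 i \<xi> p) = (\<Sum>i\<in>UNIV. of_real (- ((\<xi> $ i)\<^sup>2)) * (H \<xi> * (Kx \<xi> p * Ke \<xi> p)))"
        by (intro sum.cong refl) (simp add: K2_def Ki_def power2_eq_square mult.assoc[symmetric], simp add: mult_ac)
      also have "\<dots> = - of_real ((norm \<xi>)\<^sup>2) * (H \<xi> * (Kx \<xi> p * Ke \<xi> p))"
        unfolding sum_distrib_right[symmetric] of_real_sum[symmetric] sum_negf norm_vec_def L2_set_def
        by (simp add: sum_nonneg)
      finally show ?thesis by (simp add: Kt_def Kn_def)
    qed
    hence "(\<integral>\<xi>. H \<xi> * Kt \<xi> p \<partial>lborel) = (\<Sum>i\<in>UNIV. \<integral>\<xi>. H \<xi> * K2 i \<xi> p \<partial>lborel)"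
      using kernel_integrable[OF ok'[OF K(4)] g p] by simp
    thus ?thesis unfolding kint_def by simp
  qed
  have V: "(\<lambda>(t, x, y). kint lborel H (heat_kernel T) (t, x, \<lambda>_. 0)) = kint lborel H K"
    by (auto simp: fun_eq_iff kint_def heat_kernel_def K_def Kx_def Ke_def)
  have "smooth_on_dom (dirs 0) ?\<Omega> (kint lborel H K)"
    by (rule deriv_closed_smooth[OF T kint_deriv_closed[OF kg g]]) (use K in blast)
  moreover have "pdiff ?\<Omega> Dt (kint lborel H K) p - (\<Sum>i\<in>UNIV. pdiff ?\<Omega> (Dx i) (pdiff ?\<Omega> (Dx i) (kint lborel H K)) p) = 0"
    if "p \<in> ?\<Omega>" for p
    using pde[OF that] pderiv_on_pdiff(1)[OF T _ dI(1) that] pderiv_on_pdiff2[OF T _ dI(2) dI(3) that] by simp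
  moreover have "kint lborel H (heat_kernel T) (T, x, \<lambda>_. 0) = h x" for x
    using h[of x] by (simp add: kint_def heat_kernel_def)
  ultimately show ?thesis unfolding heat_solution_def Let_def V by blast
qed

section \<open>Circles of modes and the limit\<close>

text \<open>$A^TA - I$ has Frobenius norm $0$ because $\|A^TA\|^2 = \|AA^T\|^2$.\<close>

lemma SO_norm_preserving:
  assumes "A \<in> SO N"
  shows "(\<Sum>j<N. (mat_vec N A y j)\<^sup>2) = (\<Sum>j<N. (y j)\<^sup>2)"
proof -
  have row: "(\<Sum>k<N. A i k * A j k) = (if i = j then 1 else 0)" if "i < N" "j < N" for i j
    using assms that unfolding SO_def by blast
  define P where "P k l = (\<Sum>i<N. A i k * A i l)" for k l
  define e :: "nat \<Rightarrow> nat \<Rightarrow> real" where "e k l = (if k = l then 1 else 0)" for k l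
  have PP: "(\<Sum>k<N. \<Sum>l<N. P k l * P k l) = real N"
  proof -
    have "(\<Sum>k<N. \<Sum>l<N. P k l * P k l) = (\<Sum>k<N. \<Sum>l<N. \<Sum>i<N. \<Sum>j<N. (A i k * A j k) * (A i l * A j l))"
      unfolding P_def sum_product by (intro sum.cong refl) (simp add: mult_ac)
    also have "\<dots> = (\<Sum>k<N. \<Sum>i<N. \<Sum>l<N. \<Sum>j<N. (A i k * A j k) * (A i l * A j l))"
      by (intro sum.cong refl sum.swap)
    also have "\<dots> = (\<Sum>i<N. \<Sum>k<N. \<Sum>j<N. \<Sum>l<N. (A i k * A j k) * (A i l * A j l))"
      by (subst sum.swap) (intro sum.cong refl sum.swap)
    also have "\<dots> = (\<Sum>i<N. \<Sum>j<N. \<Sum>k<N. \<Sum>l<N. (A i k * A j k) * (A i l * A j l))"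
      by (intro sum.cong refl sum.swap)
    also have "\<dots> = (\<Sum>i<N. \<Sum>j<N. (\<Sum>k<N. A i k * A j k) * (\<Sum>l<N. A i l * A j l))"
      unfolding sum_product ..
    also have "\<dots> = (\<Sum>i<N. \<Sum>j<N. if i = j then 1 else 0)"
      by (intro sum.cong refl) (simp add: row)
    finally show ?thesis by simp
  qed
  have Pe: "(\<Sum>k<N. \<Sum>l<N. P k l * e k l) = real N"
  proof -
    have "(\<Sum>k<N. \<Sum>l<N. P k l * e k l) = (\<Sum>k<N. P k k)"
      by (intro sum.cong refl) (simp add: e_def if_distrib cong: if_cong)
    also have "\<dots> = (\<Sum>i<N. \<Sum>k<N. A i k * A i k)" unfolding P_def by (rule sum.swap)
    also have "\<dots> = (\<Sum>i<N. 1)" by (intro sum.cong refl) (simp add: row)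
    finally show ?thesis by simp
  qed
  have ee: "(\<Sum>k<N. \<Sum>l<N. e k l * e k l) = real N"
    by (simp add: e_def if_distrib cong: if_cong)
  have "(\<Sum>k<N. \<Sum>l<N. (P k l - e k l)\<^sup>2) = (\<Sum>k<N. \<Sum>l<N. P k l * P k l) - 2 * (\<Sum>k<N. \<Sum>l<N. P k l * e k l) + (\<Sum>k<N. \<Sum>l<N. e k l * e k l)"
    unfolding sum_distrib_left sum_subtractf[symmetric] sum.distrib[symmetric]
    by (intro sum.cong refl) (simp add: power2_eq_square algebra_simps)
  also have "\<dots> = 0" unfolding PP Pe ee by simp
  finally have zero: "(\<Sum>k<N. \<Sum>l<N. (P k l - e k l)\<^sup>2) = 0" .
  have Pkl: "P k l = e k l" if "k < N" "l < N" for k l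
  proof -
    have "(\<Sum>l<N. (P k l - e k l)\<^sup>2) = 0"
      using zero that by (subst (asm) sum_nonneg_eq_0_iff) (auto intro: sum_nonneg)
    hence "(P k l - e k l)\<^sup>2 = 0"
      using that by (subst (asm) sum_nonneg_eq_0_iff) auto
    thus ?thesis by simp
  qed
  have "(\<Sum>j<N. (mat_vec N A y j)\<^sup>2) = (\<Sum>j<N. \<Sum>k<N. \<Sum>l<N. (A j k * A j l) * (y k * y l))"
    unfolding mat_vec_def power2_eq_square by (intro sum.cong refl) (simp add: sum_product mult_ac)
  also have "\<dots> = (\<Sum>k<N. \<Sum>j<N. \<Sum>l<N. (A j k * A j l) * (y k * y l))" by (rule sum.swap)
  also have "\<dots> = (\<Sum>k<N. \<Sum>l<N. \<Sum>j<N. (A j k * A j l) * (y k * y l))" by (intro sum.cong refl sum.swap)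
  also have "\<dots> = (\<Sum>k<N. \<Sum>l<N. P k l * (y k * y l))" unfolding P_def sum_distrib_right ..
  also have "\<dots> = (\<Sum>k<N. \<Sum>l<N. e k l * (y k * y l))" by (intro sum.cong refl) (simp add: Pkl)
  also have "\<dots> = (\<Sum>k<N. \<Sum>l<N. if k = l then (y l)\<^sup>2 else 0)"
    by (intro sum.cong refl) (simp add: e_def power2_eq_square)
  also have "\<dots> = (\<Sum>k<N. (y k)\<^sup>2)" by simp
  finally show ?thesis .
qed

text \<open>\<open>csqrt\<close> jumps across the negative axis, so measurability comes from its
  real and imaginary parts rather than from continuity.\<close>

lemma csqrt_measurable [measurable]: "csqrt \<in> borel_measurable borel"
proof -
  have "csqrt = (\<lambda>z. of_real (sqrt ((cmod z + Re z) / 2))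
      + \<i> * of_real ((if Im z = 0 then 1 else sgn (Im z)) * sqrt ((cmod z - Re z) / 2)))"
    by (auto simp: fun_eq_iff complex_eq_iff)
  also have "\<dots> \<in> borel_measurable borel" unfolding sgn_if by measurable
  finally show ?thesis .
qed

text \<open>For z = csqrt v one has Im v = 2 Re z Im z and |Im z| <= sqrt|v|, so a large imaginary
  part of v forces a large real part of z.\<close>

lemma Re_csqrt_lower:
  assumes "0 \<le> b" "0 < C"
  shows "C * \<bar>sin \<phi>\<bar> / (2 * sqrt (b + C)) \<le> Re (csqrt (- (of_real b + of_real C * cis \<phi>)))"
proof -
  let ?v = "- (of_real b + of_real C * cis \<phi>)" let ?z = "csqrt ?v"
  have "norm ?v \<le> norm (complex_of_real b) + norm (of_real C * cis \<phi>)"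
    unfolding norm_minus_cancel by (rule norm_triangle_ineq)
  hence nv: "norm ?v \<le> b + C" using assms by (simp add: norm_mult)
  have "\<bar>Im ?z\<bar> \<le> norm ?z" by (rule abs_Im_le_cmod)
  also have "\<dots> = sqrt (norm ?v)" by (rule norm_csqrt)
  also have "\<dots> \<le> sqrt (b + C)" using nv by simp
  finally have im: "\<bar>Im ?z\<bar> \<le> sqrt (b + C)" .
  have "Im (?z\<^sup>2) = 2 * Re ?z * Im ?z" by (simp add: power2_eq_square)
  moreover have "Im (?z\<^sup>2) = - (C * sin \<phi>)" by (simp only: power2_csqrt) simp
  ultimately have "C * \<bar>sin \<phi>\<bar> = 2 * Re ?z * \<bar>Im ?z\<bar>"
    using assms Re_csqrt[of ?v] by (metis abs_minus_cancel abs_mult abs_numeral abs_of_nonneg less_imp_le)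
  also have "\<dots> \<le> 2 * Re ?z * sqrt (b + C)"
    using im Re_csqrt[of ?v] by (intro mult_left_mono) auto
  finally show ?thesis using assms by (simp add: field_simps)
qed

text \<open>The points left out of [0,1] are the zeros of sin(2 pi theta), where the lower bound for
  Re w degenerates; they form a null set.\<close>

definition circ_dom :: "real set" where "circ_dom = {0<..<1} - {1/2}"

lemma circ_dom_measurable [measurable]: "circ_dom \<in> sets borel"
  by (simp add: circ_dom_def)

lemma sin_circ_dom:
  assumes "\<theta> \<in> circ_dom"
  shows "sin (2 * pi * \<theta>) \<noteq> 0"
proof
  assume "sin (2 * pi * \<theta>) = 0"
  then obtain i :: int where "2 * pi * \<theta> = of_int i * pi" unfolding sin_zero_iff_int2 by blast
  hence i: "2 * \<theta> = of_int i" by simp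
  hence "0 < i" "i < 2" using assms by (auto simp: circ_dom_def) 
  hence "i = 1" by simp
  thus False using i assms by (simp add: circ_dom_def)
qed

lemma J01_zero [simp]: "J01 \<nu> 0 = 1"
  unfolding J01_def using powser_zero[of "\<lambda>j. 1 / complex_of_real (fact j * pochhammer \<nu> j)"] by simp

lemma J01_circle_average:
  assumes "\<nu> > 0" "C > 0"
  shows "(\<integral>\<theta>. indicator circ_dom \<theta> * J01 \<nu> ((b - of_real C * cis (2 * pi * \<theta>)) * r) \<partial>lborel) = J01 \<nu> (b * r)"
proof -
  let ?f = "\<lambda>\<theta>::real. J01 \<nu> ((b - of_real C * cis (2 * pi * \<theta>)) * r)"
  have [measurable]: "?f \<in> borel_measurable borel"
    by (rule measurable_compose[OF _ J01_measurable]) measurable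
  have ae: "AE \<theta> in lborel. \<theta> \<noteq> 0 \<and> \<theta> \<noteq> 1 \<and> \<theta> \<noteq> (1/2 :: real)"
    using AE_lborel_singleton[of "0::real"] AE_lborel_singleton[of "1::real"] AE_lborel_singleton[of "1/2::real"]
    by eventually_elim simp
  have "(\<integral>\<theta>. indicator circ_dom \<theta> * ?f \<theta> \<partial>lborel) = (\<integral>\<theta>. indicator {0..1} \<theta> *\<^sub>R ?f \<theta> \<partial>lborel)"
  proof (rule integral_cong_AE)
    show "AE \<theta> in lborel. indicator circ_dom \<theta> * ?f \<theta> = indicator {0..1} \<theta> *\<^sub>R ?f \<theta>"
      using ae by eventually_elim (auto simp: circ_dom_def indicator_def)
  qed measurable
  also have "\<dots> = integral {0..1} ?f"
  proof -
    have "continuous_on UNIV (J01 \<nu>)"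
      using J01_has_field_derivative[OF assms(1)] DERIV_isCont continuous_at_imp_continuous_on by blast
    hence "continuous_on {0..1} ?f"
      by (rule continuous_on_compose2) (auto intro!: continuous_intros)
    hence "set_integrable lborel {0..1} ?f" by (rule borel_integrable_atLeastAtMost')
    thus ?thesis using set_borel_integral_eq_integral(2) unfolding set_lebesgue_integral_def by blast
  qed
  also have "\<dots> = J01 \<nu> (b * r)" by (rule integral_unique[OF J01_mean_value[OF assms]])
  finally show ?thesis .
qed

definition wave_kernel :: "real \<Rightarrow> real \<Rightarrow> nat \<Rightarrow> ('w \<Rightarrow> real^'n) \<Rightarrow> ('w \<Rightarrow> complex) \<Rightarrow> ('w \<Rightarrow> complex) \<Rightarrow> 'w \<Rightarrow> 'n pt \<Rightarrow> complex" where
  "wave_kernel T t0 N \<xi> w \<zeta> v p = cis (\<xi> v \<bullet> fst (snd p)) * mode (- t0) (- T) (w v) (- fst p)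
     * J01 (real N / 2) (\<zeta> v * of_real (rho N (snd (snd p))))"

lemma (in wave_family) K0_eq: "K0 = wave_kernel T t0 N \<xi> w \<zeta>"
  by (simp add: fun_eq_iff K0_def wave_kernel_def Kx_def Kt_def KJ_def)

text \<open>The exponent lies strictly between 1/2 and 1: 3/4 keeps C <= N and makes Re w grow like
  N^(1/4).\<close>

definition radius :: "nat \<Rightarrow> real" where "radius N = real N powr (3/4)"

lemma radius_bounds: "N \<ge> 1 \<Longrightarrow> 0 < radius N" "N \<ge> 1 \<Longrightarrow> radius N \<le> real N"
proof -
  show "N \<ge> 1 \<Longrightarrow> 0 < radius N" by (simp add: radius_def)
  assume "N \<ge> 1"
  hence "real N powr (3/4) \<le> real N powr 1" by (intro powr_mono) auto
  thus "radius N \<le> real N" by (simp add: radius_def)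
qed

lemma exp_root_decay:
  fixes c :: real
  assumes "c > 0"
  shows "(\<lambda>i. exp (- 2 * c * real (Suc i) powr (1/4))) \<longlonglongrightarrow> 0"
  using assms by real_asymp

text \<open>The circle in the spectral plane is centred at $N|\xi|^2/2$ for \<^term>\<open>\<alpha> = True\<close>, which carries the
  initial datum $h$, and at $0$ for \<^term>\<open>\<alpha> = False\<close>, which cancels the trace of the static part at $t = T$.\<close>

definition centre :: "nat \<Rightarrow> bool \<Rightarrow> real^'n \<Rightarrow> real" where
  "centre N \<alpha> \<xi> = (if \<alpha> then real N / 2 * (norm \<xi>)\<^sup>2 else 0)"

definition circ :: "nat \<Rightarrow> real \<Rightarrow> complex" where
  "circ N \<theta> = of_real (radius N) * cis (2 * pi * \<theta>)"

text \<open>This is the exponent w, and \<open>circle_param\<close> is the corresponding zeta. In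
  terms of zeta the circle is centred at N|xi|^2/2 minus \<open>centre\<close>, so the two centres
  change places: 0 for \<alpha> = True, N|xi|^2/2 for \<alpha> = False.\<close>

definition circle_rate :: "nat \<Rightarrow> bool \<Rightarrow> (real^'n) \<times> real \<Rightarrow> complex" where
  "circle_rate N \<alpha> v = csqrt (- (of_real (centre N \<alpha> (fst v)) + circ N (snd v)))"

definition circle_param :: "nat \<Rightarrow> bool \<Rightarrow> (real^'n) \<times> real \<Rightarrow> complex" where
  "circle_param N \<alpha> v = of_real (real N / 2 * (norm (fst v))\<^sup>2 - centre N \<alpha> (fst v)) - circ N (snd v)"

definition circle_factor :: "real \<Rightarrow> bool \<Rightarrow> real^'n \<Rightarrow> real" where
  "circle_factor T \<alpha> \<xi> = (if \<alpha> then 1 else - exp ((norm \<xi>)\<^sup>2 * T))"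

text \<open>For \<alpha> = True zeta has modulus \<open>radius N\<close>, and the polynomial weight
  against which \<open>H\<close> is integrable suffices. For \<alpha> = False zeta grows like
  |xi|^2; the exponential weight is paid for by the Gaussian in
  \<open>circle_factor\<close>.\<close>

definition circle_growth :: "bool \<Rightarrow> real^'n \<Rightarrow> real" where
  "circle_growth \<alpha> \<xi> = (if \<alpha> then 1 + norm \<xi> else exp (norm \<xi>))"

definition circle_density :: "real \<Rightarrow> bool \<Rightarrow> (real^'n \<Rightarrow> complex) \<Rightarrow> (real^'n) \<times> real \<Rightarrow> complex" where
  "circle_density T \<alpha> H v = (H (fst v) * of_real (circle_factor T \<alpha> (fst v))) * indicator circ_dom (snd v)"

lemma norm_indicator_complex: "norm (indicator X x :: complex) = indicator X x"
  by (simp add: indicator_def)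

lemma circle_growth_ge: "1 + norm \<xi> \<le> circle_growth \<alpha> \<xi>"
  by (auto simp: circle_growth_def)

lemma centre_bounds: "0 \<le> centre N \<alpha> \<xi>" "centre N \<alpha> \<xi> \<le> real N / 2 * (norm \<xi>)\<^sup>2"
  by (auto simp: centre_def)

lemma norm_circ: "N \<ge> 1 \<Longrightarrow> norm (circ N \<theta>) = radius N"
  using radius_bounds[of N] by (simp add: circ_def norm_mult)

lemma sqrt_half_le: "sqrt (real N / 2) \<le> real N"
proof (cases "N = 0")
  case False
  hence "real N / 2 \<le> real N * real N" by (simp add: mult_le_cancel_left1) 
  thus ?thesis by (intro real_le_lsqrt) (auto simp: power2_eq_square)
qed simp

lemma circle_measurable [measurable]:
  "centre N \<alpha> \<in> borel_measurable borel" "circ N \<in> borel_measurable borel"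
  "circle_rate N \<alpha> \<in> borel_measurable (borel \<Otimes>\<^sub>M borel)" "circle_param N \<alpha> \<in> borel_measurable (borel \<Otimes>\<^sub>M borel)"
  "circle_factor T \<alpha> \<in> borel_measurable borel"
proof -
  show [measurable]: "centre N \<alpha> \<in> borel_measurable borel" unfolding centre_def by measurable
  show [measurable]: "circ N \<in> borel_measurable borel" unfolding circ_def by measurable
  show "circle_rate N \<alpha> \<in> borel_measurable (borel \<Otimes>\<^sub>M borel)" unfolding circle_rate_def by measurable
  show "circle_param N \<alpha> \<in> borel_measurable (borel \<Otimes>\<^sub>M borel)" unfolding circle_param_def by measurable
  show "circle_factor T \<alpha> \<in> borel_measurable borel" unfolding circle_factor_def by measurable
qed

text \<open>The exponent N + 2 covers both W^2, from the bound on w^2, and W^N, from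
  exp(sqrt(N/2)|xi|) <= exp(|xi|)^N. The last summand of the constant accounts for the radius, by
  subadditivity of the square root.\<close>

lemma circle_family:
  assumes T: "T < t0" "t0 < 0" and N: "N \<ge> 1"
  shows "wave_family (lborel \<Otimes>\<^sub>M lborel) (\<lambda>v :: (real^'n) \<times> real. circle_growth \<alpha> (fst v)) T t0 N fst
    (circle_rate N \<alpha>) (circle_param N \<alpha>) (real N + radius N + exp (sqrt (radius N))) (N + 2)"
proof
  fix v :: "(real^'n) \<times> real"
  let ?W = "circle_growth \<alpha> (fst v)" and ?A = "real N + radius N + exp (sqrt (radius N))" and ?k = "norm (fst v)"
  have W1: "1 \<le> ?W" and Wk: "?k \<le> ?W" using circle_growth_ge[of "fst v" \<alpha>] norm_ge_zero[of "fst v"] by linarith+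
  have C: "0 < radius N" using radius_bounds N by blast
  show "1 \<le> ?W" "?k \<le> ?W" by fact+
  show "1 \<le> ?A" using N C by (simp add: add_increasing2)
  show "0 \<le> Re (circle_rate N \<alpha> v)" unfolding circle_rate_def by (rule Re_csqrt)
  show "(circle_rate N \<alpha> v)\<^sup>2 = circle_param N \<alpha> v - of_real (real N / 2 * ?k\<^sup>2)"
    unfolding circle_rate_def circle_param_def power2_csqrt by (simp add: algebra_simps)
  have "(norm (circle_rate N \<alpha> v))\<^sup>2 = norm (of_real (centre N \<alpha> (fst v)) + circ N (snd v))"
    unfolding circle_rate_def norm_csqrt by (simp add: norm_minus_commute) (metis add.inverse_inverse minus_diff_eq norm_minus_cancel diff_minus_eq_add add.commute)
  also have "\<dots> \<le> norm (complex_of_real (centre N \<alpha> (fst v))) + norm (circ N (snd v))" by (rule norm_triangle_ineq)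
  also have "\<dots> \<le> real N / 2 * ?k\<^sup>2 + radius N"
    using centre_bounds[of N \<alpha> "fst v"] norm_circ[OF N] by simp
  also have "\<dots> \<le> real N * ?W\<^sup>2 + radius N * ?W\<^sup>2"
  proof (rule add_mono)
    show "real N / 2 * ?k\<^sup>2 \<le> real N * ?W\<^sup>2" using Wk by (intro mult_mono power_mono) auto
    show "radius N \<le> radius N * ?W\<^sup>2" using C W1 by (simp add: mult_le_cancel_left1 one_le_power)
  qed
  also have "\<dots> = (real N + radius N) * ?W\<^sup>2" by (simp add: algebra_simps)
  also have "\<dots> \<le> ?A * ?W ^ (N + 2)"
    using W1 C by (intro mult_mono power_increasing) auto
  finally show "(norm (circle_rate N \<alpha> v))\<^sup>2 \<le> ?A * ?W ^ (N + 2)" .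
  define b where "b = real N / 2 * ?k\<^sup>2 - centre N \<alpha> (fst v)"
  have b: "0 \<le> b" using centre_bounds[of N \<alpha> "fst v"] by (simp add: b_def)
  have eb: "exp (sqrt b) \<le> ?W ^ N"
  proof (cases \<alpha>)
    case True
    thus ?thesis using W1 by (simp add: b_def centre_def one_le_power)
  next
    case False
    have "sqrt b = sqrt (real N / 2) * ?k" using False real_sqrt_mult[of "real N / 2" "?k\<^sup>2"] by (simp add: b_def centre_def)
    also have "\<dots> \<le> real N * ?k" by (intro mult_right_mono sqrt_half_le) simp
    finally have "exp (sqrt b) \<le> exp (real N * ?k)" by simp
    also have "\<dots> = ?W ^ N" using False by (simp add: circle_growth_def exp_of_nat_mult)
    finally show ?thesis .
  qed
  have "norm (circle_param N \<alpha> v) \<le> norm (complex_of_real b) + norm (circ N (snd v))"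
    unfolding circle_param_def b_def by (rule norm_triangle_ineq4)
  hence "sqrt (norm (circle_param N \<alpha> v)) \<le> sqrt (b + radius N)" using b norm_circ[OF N] by simp
  also have "\<dots> \<le> sqrt b + sqrt (radius N)" using b C by (intro sqrt_add_le_add_sqrt) auto
  finally have "exp (sqrt (norm (circle_param N \<alpha> v))) \<le> exp (sqrt (radius N)) * exp (sqrt b)"
    by (simp add: exp_add[symmetric] add.commute)
  also have "\<dots> \<le> ?A * ?W ^ (N + 2)"
  proof (rule mult_mono)
    have "?W ^ N \<le> ?W ^ (N + 2)" using W1 by (intro power_increasing) auto
    thus "exp (sqrt b) \<le> ?W ^ (N + 2)" using eb by linarith
  qed (use C in auto)
  finally show "exp (sqrt (norm (circle_param N \<alpha> v))) \<le> ?A * ?W ^ (N + 2)" .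
next
  show "fst \<in> borel_measurable (lborel \<Otimes>\<^sub>M lborel)" by measurable
  show "circle_rate N \<alpha> \<in> borel_measurable (lborel \<Otimes>\<^sub>M lborel)" "circle_param N \<alpha> \<in> borel_measurable (lborel \<Otimes>\<^sub>M lborel)"
    using circle_measurable(3,4) by (simp_all cong: measurable_cong_sets sets_pair_measure_cong)
qed (use assms in auto)

lemma static_family:
  assumes T: "T < t0" "t0 < 0" and N: "N \<ge> 1"
  shows "wave_family lborel (\<lambda>\<xi> :: real^'n. exp (norm \<xi>)) T t0 N (\<lambda>\<xi>. \<xi>)
    (\<lambda>\<xi>. 0) (\<lambda>\<xi>. of_real (real N / 2 * (norm \<xi>)\<^sup>2)) 1 N"
proof
  fix \<xi> :: "real^'n"
  show "norm \<xi> \<le> exp (norm \<xi>)" using exp_ge_add_one_self[of "norm \<xi>"] by linarith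
  have "sqrt (norm (complex_of_real (real N / 2 * (norm \<xi>)\<^sup>2))) = sqrt (real N / 2) * norm \<xi>"
    by (simp only: norm_of_real) (simp add: real_sqrt_mult real_sqrt_divide)
  also have "\<dots> \<le> real N * norm \<xi>" by (intro mult_right_mono sqrt_half_le) simp
  finally have "exp (sqrt (norm (complex_of_real (real N / 2 * (norm \<xi>)\<^sup>2)))) \<le> exp (real N * norm \<xi>)" by simp
  thus "exp (sqrt (norm (complex_of_real (real N / 2 * (norm \<xi>)\<^sup>2)))) \<le> 1 * exp (norm \<xi>) ^ N"
    by (simp add: exp_of_nat_mult)
qed (use assms in auto)

section \<open>The solution and its limit on the paraboloid\<close>

context
  fixes T t0 :: real and H :: "real^'n \<Rightarrow> complex" and h :: "real^'n \<Rightarrow> real"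
  assumes T: "T < t0" "t0 < 0"
    and Hm [measurable]: "H \<in> borel_measurable borel"
    and Hint: "\<And>m. integrable lborel (\<lambda>\<xi>. norm (H \<xi>) * (1 + norm \<xi>) ^ m)"
    and Hinv: "\<And>x. (\<integral>\<xi>. H \<xi> * cis (\<xi> \<bullet> x) \<partial>lborel) = of_real (h x)"
begin

lemma H_integrable: "integrable lborel (\<lambda>\<xi>. norm (H \<xi>))"
  using Hint[of 0] by simp

text \<open>Completing the square in k; since T < 0 the Gaussian beats every power of exp k.\<close>

lemma gauss_absorbs: "exp (k\<^sup>2 * T) * exp k ^ m \<le> exp ((real m)\<^sup>2 / (4 * - T))"
proof -
  have "0 \<le> (2 * T * k + real m)\<^sup>2 / (4 * - T)" using T by (intro divide_nonneg_nonneg) auto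
  also have "\<dots> = (real m)\<^sup>2 / (4 * - T) - (k\<^sup>2 * T + real m * k)"
    using T by (simp add: field_simps power2_eq_square)
  finally show ?thesis by (simp add: exp_of_nat_mult[symmetric] exp_add[symmetric])
qed

lemma weight_integrable: "integrable lborel (\<lambda>\<xi>. norm (H \<xi>) * \<bar>circle_factor T \<alpha> \<xi>\<bar> * circle_growth \<alpha> \<xi> ^ m)"
proof (cases \<alpha>)
  case True
  thus ?thesis using Hint[of m] by (simp add: circle_factor_def circle_growth_def)
next
  case False
  show ?thesis
  proof (rule Bochner_Integration.integrable_bound)
    show "integrable lborel (\<lambda>\<xi>. norm (H \<xi>) * exp ((real m)\<^sup>2 / (4 * - T)))"
      using H_integrable by simp
    show "AE \<xi> in lborel. norm (norm (H \<xi>) * \<bar>circle_factor T \<alpha> \<xi>\<bar> * circle_growth \<alpha> \<xi> ^ m) \<le> norm (norm (H \<xi>) * exp ((real m)\<^sup>2 / (4 * - T)))"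
    proof (rule AE_I2)
      fix \<xi> :: "real^'n"
      show "norm (norm (H \<xi>) * \<bar>circle_factor T \<alpha> \<xi>\<bar> * circle_growth \<alpha> \<xi> ^ m) \<le> norm (norm (H \<xi>) * exp ((real m)\<^sup>2 / (4 * - T)))"
        using mult_left_mono[OF gauss_absorbs[of "norm \<xi>" m] norm_ge_zero[of "H \<xi>"]] False
        by (simp add: circle_factor_def circle_growth_def abs_mult mult.assoc)
    qed
  qed (use False in \<open>simp add: circle_factor_def circle_growth_def\<close>)
qed

lemma circle_weight_ok: "weight_ok (lborel \<Otimes>\<^sub>M lborel) (\<lambda>v. circle_growth \<alpha> (fst v)) (circle_density T \<alpha> H)"
  unfolding weight_ok_def
proof (intro conjI allI)
  show "circle_density T \<alpha> H \<in> borel_measurable (lborel \<Otimes>\<^sub>M lborel)"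
    unfolding circle_density_def by measurable
  fix m
  have "integrable lborel (indicator circ_dom :: real \<Rightarrow> real)"
    by (rule Bochner_Integration.integrable_bound[where f = "indicator {0..1::real} :: real \<Rightarrow> real"])
       (auto simp: circ_dom_def indicator_def)
  from integrable_pair_mult[OF weight_integrable[of \<alpha> m] this]
  show "integrable (lborel \<Otimes>\<^sub>M lborel) (\<lambda>v. norm (circle_density T \<alpha> H v) * circle_growth \<alpha> (fst v) ^ m)"
    by (rule Bochner_Integration.integrable_cong[THEN iffD1, rotated 2])
       (auto simp: circle_density_def norm_mult norm_indicator_complex split_beta mult_ac)
qed

definition static_density :: "real^'n \<Rightarrow> complex" where "static_density \<xi> = H \<xi> * of_real (exp ((norm \<xi>)\<^sup>2 * T))"

lemma static_weight_ok: "weight_ok lborel (\<lambda>\<xi>. exp (norm \<xi>)) static_density"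
  unfolding weight_ok_def
proof (intro conjI allI)
  show "static_density \<in> borel_measurable lborel" unfolding static_density_def by measurable
  show "integrable lborel (\<lambda>\<xi>. norm (static_density \<xi>) * exp (norm \<xi>) ^ m)" for m
    using weight_integrable[of False m] by (simp add: static_density_def circle_factor_def circle_growth_def norm_mult)
qed

definition u_static :: "nat \<Rightarrow> 'n pt \<Rightarrow> complex" where
  "u_static N p = (\<integral>\<xi>. static_density \<xi> * wave_kernel T t0 N (\<lambda>\<xi>. \<xi>) (\<lambda>\<xi>. 0) (\<lambda>\<xi>. of_real (real N / 2 * (norm \<xi>)\<^sup>2)) \<xi> p \<partial>lborel)"

definition u_circle :: "nat \<Rightarrow> bool \<Rightarrow> 'n pt \<Rightarrow> complex" where
  "u_circle N \<alpha> p = (\<integral>v. circle_density T \<alpha> H v * wave_kernel T t0 N fst (circle_rate N \<alpha>) (circle_param N \<alpha>) v p \<partial>(lborel \<Otimes>\<^sub>M lborel))"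

definition u_wave :: "nat \<Rightarrow> 'n pt \<Rightarrow> real" where
  "u_wave N p = Re (u_static N p) + Re (u_circle N True p) + Re (u_circle N False p)"

lemma u_wave_part: "N \<ge> 1 \<Longrightarrow> wave_part T t0 N (u_wave N)"
proof -
  assume N: "N \<ge> 1"
  interpret st: wave_family lborel "\<lambda>\<xi> :: real^'n. exp (norm \<xi>)" T t0 N "\<lambda>\<xi>. \<xi>"
    "\<lambda>\<xi>. 0" "\<lambda>\<xi>. of_real (real N / 2 * (norm \<xi>)\<^sup>2)" 1 N
    by (rule static_family[OF T N])
  have c: "wave_part T t0 N (\<lambda>p. Re (u_circle N \<alpha> p))" for \<alpha>
    using wave_family.kint_wave_part[OF circle_family[OF T N] circle_weight_ok[of \<alpha>]]
    unfolding wave_family.K0_eq[OF circle_family[OF T N]] kint_def[abs_def] u_circle_def .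
  have "wave_part T t0 N (\<lambda>p. Re (u_static N p))"
    using st.kint_wave_part[OF static_weight_ok] unfolding st.K0_eq kint_def[abs_def] u_static_def .
  thus ?thesis unfolding u_wave_def by (intro wave_part_add c)
qed

lemma u_wave_radial: "radial_y T t0 N (u_wave N)"
proof -
  have "rho N (mat_vec N A y) = rho N y" if "A \<in> SO N" for A y
    unfolding rho_def SO_norm_preserving[OF that] ..
  thus ?thesis
    unfolding radial_y_def u_wave_def u_static_def u_circle_def wave_kernel_def by simp
qed

lemma u_circle_integrable:
  assumes N: "N \<ge> 1" and p: "p \<in> dom T t0 N"
  shows "integrable (lborel \<Otimes>\<^sub>M lborel) (\<lambda>v. circle_density T \<alpha> H v * wave_kernel T t0 N fst (circle_rate N \<alpha>) (circle_param N \<alpha>) v p)"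
  using wave_family.K0_integrable[OF circle_family[OF T N] circle_weight_ok[of \<alpha>] p]
  unfolding wave_family.K0_eq[OF circle_family[OF T N]] .

lemma u_static_integrable:
  assumes N: "N \<ge> 1" and p: "p \<in> dom T t0 N"
  shows "integrable lborel (\<lambda>\<xi>. static_density \<xi> * wave_kernel T t0 N (\<lambda>\<xi>. \<xi>) (\<lambda>\<xi>. 0) (\<lambda>\<xi>. of_real (real N / 2 * (norm \<xi>)\<^sup>2)) \<xi> p)"
  using wave_family.K0_integrable[OF static_family[OF T N] static_weight_ok p]
  unfolding wave_family.K0_eq[OF static_family[OF T N]] .

text \<open>At t = T every mode has time factor 1, so after Fubini the integral over the circle is a
  pure mean value of \<open>J01\<close>. It equals J01(0) = 1 for the first circle, and minus the
  static part remains for the second.\<close>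

lemma u_wave_initial:
  assumes N: "N \<ge> 1" and y: "y \<in> RN N"
  shows "u_wave N (T, x, y) = h x"
proof -
  have p: "(T, x, y) \<in> dom T t0 N" using y T by (auto simp: dom_def)
  have S: "- T > 0" using T by simp
  have \<nu>: "real N / 2 > 0" using N by simp
  let ?r = "complex_of_real (rho N y)"
  have circle: "u_circle N \<alpha> (T, x, y) = (\<integral>\<xi>. H \<xi> * of_real (circle_factor T \<alpha> \<xi>) * cis (\<xi> \<bullet> x)
      * J01 (real N / 2) (of_real (real N / 2 * (norm \<xi>)\<^sup>2 - centre N \<alpha> \<xi>) * ?r) \<partial>lborel)" for \<alpha>
  proof -
    have "u_circle N \<alpha> (T, x, y) = (\<integral>\<xi>. \<integral>\<theta>. circle_density T \<alpha> H (\<xi>, \<theta>) * wave_kernel T t0 N fst (circle_rate N \<alpha>) (circle_param N \<alpha>) (\<xi>, \<theta>) (T, x, y) \<partial>lborel \<partial>lborel)"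
      unfolding u_circle_def by (rule lborel_pair.integral_fst'[OF u_circle_integrable[OF N p], symmetric])
    also have "\<dots> = (\<integral>\<xi>. H \<xi> * of_real (circle_factor T \<alpha> \<xi>) * cis (\<xi> \<bullet> x)
      * J01 (real N / 2) (of_real (real N / 2 * (norm \<xi>)\<^sup>2 - centre N \<alpha> \<xi>) * ?r) \<partial>lborel)"
    proof (rule Bochner_Integration.integral_cong[OF refl])
      fix \<xi> :: "real^'n"
      let ?b = "complex_of_real (real N / 2 * (norm \<xi>)\<^sup>2 - centre N \<alpha> \<xi>)"
      have "(\<integral>\<theta>. circle_density T \<alpha> H (\<xi>, \<theta>) * wave_kernel T t0 N fst (circle_rate N \<alpha>) (circle_param N \<alpha>) (\<xi>, \<theta>) (T, x, y) \<partial>lborel)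
        = (\<integral>\<theta>. (H \<xi> * of_real (circle_factor T \<alpha> \<xi>) * cis (\<xi> \<bullet> x)) *
            (indicator circ_dom \<theta> * J01 (real N / 2) ((?b - of_real (radius N) * cis (2 * pi * \<theta>)) * ?r)) \<partial>lborel)"
        by (intro Bochner_Integration.integral_cong refl)
           (simp only: circle_density_def wave_kernel_def circle_param_def circ_def fst_conv snd_conv mode_at_S[OF S] mult_1_left mult_1_right mult_ac)
      also have "\<dots> = H \<xi> * of_real (circle_factor T \<alpha> \<xi>) * cis (\<xi> \<bullet> x) * J01 (real N / 2) (?b * ?r)"
        using J01_circle_average[OF \<nu> radius_bounds(1)[OF N], of ?b ?r] by simp
      finally show "(\<integral>\<theta>. circle_density T \<alpha> H (\<xi>, \<theta>) * wave_kernel T t0 N fst (circle_rate N \<alpha>) (circle_param N \<alpha>) (\<xi>, \<theta>) (T, x, y) \<partial>lborel)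
        = H \<xi> * of_real (circle_factor T \<alpha> \<xi>) * cis (\<xi> \<bullet> x) * J01 (real N / 2) (?b * ?r)" .
    qed
    finally show ?thesis .
  qed
  have 1: "u_circle N True (T, x, y) = of_real (h x)"
    unfolding circle using Hinv[of x] by (simp add: centre_def circle_factor_def)
  have "u_circle N False (T, x, y) = (\<integral>\<xi>. - (static_density \<xi> * wave_kernel T t0 N (\<lambda>\<xi>. \<xi>) (\<lambda>\<xi>. 0) (\<lambda>\<xi>. of_real (real N / 2 * (norm \<xi>)\<^sup>2)) \<xi> (T, x, y)) \<partial>lborel)"
    unfolding circle static_density_def wave_kernel_def
    by (intro Bochner_Integration.integral_cong refl) (simp add: centre_def circle_factor_def mode_at_S[OF S])
  hence "u_circle N False (T, x, y) = - u_static N (T, x, y)"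
    unfolding u_static_def by simp
  thus ?thesis using 1 by (simp add: u_wave_def)
qed

lemma rho_yN: "N \<ge> 1 \<Longrightarrow> t \<le> 0 \<Longrightarrow> rho N (yN N t) = - t"
proof -
  assume N: "N \<ge> 1" and t: "t \<le> 0"
  have "(\<Sum>j<N. (yN N t j)\<^sup>2) = (\<Sum>j<N. if j = 0 then 2 * real N * - t else 0)"
    using t by (intro sum.cong refl) (auto simp: yN_def mult_nonneg_nonpos)
  thus ?thesis using N by (simp add: rho_def)
qed

lemma yN_dom: "N \<ge> 1 \<Longrightarrow> t \<in> {T..t0} \<Longrightarrow> (t, x, yN N t) \<in> dom T t0 N"
  by (auto simp: dom_def RN_def yN_def)

text \<open>On the paraboloid the damping exp(|xi|^2 T) and the bound exp(-|xi|^2 t) for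
  \<open>J01\<close> multiply to at most 1 because t >= T, so |H| is a majorant uniform in
  N.\<close>

lemma u_static_limit:
  assumes t: "t \<in> {T..t0}"
  shows "(\<lambda>i. u_static (Suc i) (t, x, yN (Suc i) t)) \<longlonglongrightarrow> (\<integral>\<xi>. H \<xi> * heat_kernel T \<xi> (t, x, \<lambda>_. 0) \<partial>lborel)"
  unfolding u_static_def
proof -
  let ?f = "\<lambda>i \<xi>. static_density \<xi> * wave_kernel T t0 (Suc i) (\<lambda>\<xi>. \<xi>) (\<lambda>\<xi>. 0) (\<lambda>\<xi>. of_real (real (Suc i) / 2 * (norm \<xi>)\<^sup>2)) \<xi> (t, x, yN (Suc i) t)"
  show "(\<lambda>i. \<integral>\<xi>. ?f i \<xi> \<partial>lborel) \<longlonglongrightarrow> (\<integral>\<xi>. H \<xi> * heat_kernel T \<xi> (t, x, \<lambda>_. 0) \<partial>lborel)"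
  proof (rule integral_dominated_convergence[where w = "\<lambda>\<xi>. norm (H \<xi>)"])
    have S: "- T > 0" and t0: "t \<le> 0" using T t by auto
    have eq: "?f i \<xi>
       = H \<xi> * cis (\<xi> \<bullet> x) * of_real (exp ((norm \<xi>)\<^sup>2 * T)) * J01 (real (Suc i) / 2) (of_real (real (Suc i) / 2) * of_real ((norm \<xi>)\<^sup>2 * - t))" for \<xi> i
      using rho_yN[of "Suc i" t] t0 by (simp add: static_density_def wave_kernel_def mode_zero[OF S] mult_ac)
    show "(\<lambda>\<xi>. H \<xi> * heat_kernel T \<xi> (t, x, \<lambda>_. 0)) \<in> borel_measurable lborel"
      unfolding heat_kernel_def by measurable
    show "(\<lambda>\<xi>. ?f i \<xi>) \<in> borel_measurable lborel" for i
      using u_static_integrable[OF _ yN_dom[OF _ t], of "Suc i"] by simp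
    show "integrable lborel (\<lambda>\<xi>. norm (H \<xi>))" by (rule H_integrable)
    show "AE \<xi> in lborel. (\<lambda>i. ?f i \<xi>)
        \<longlonglongrightarrow> H \<xi> * heat_kernel T \<xi> (t, x, \<lambda>_. 0)"
    proof (rule AE_I2)
      fix \<xi> :: "real^'n"
      let ?z = "complex_of_real ((norm \<xi>)\<^sup>2 * - t)" and ?c = "H \<xi> * cis (\<xi> \<bullet> x) * of_real (exp ((norm \<xi>)\<^sup>2 * T))"
      have "(\<lambda>i. ?c * J01 (real (Suc i) / 2) (of_real (real (Suc i) / 2) * ?z)) \<longlonglongrightarrow> ?c * exp ?z"
        by (intro tendsto_mult_left LIMSEQ_Suc[OF J01_tendsto_exp])
      moreover have "?c * exp ?z = H \<xi> * heat_kernel T \<xi> (t, x, \<lambda>_. 0)"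
      proof -
        have "complex_of_real (exp ((norm \<xi>)\<^sup>2 * T)) * exp ?z = of_real (exp (- (norm \<xi>)\<^sup>2 * (t - T)))"
          unfolding exp_of_real of_real_mult[symmetric] exp_add[symmetric] by (simp add: algebra_simps)
        thus ?thesis by (simp add: heat_kernel_def mult.assoc)
      qed
      ultimately show "(\<lambda>i. ?f i \<xi>)
        \<longlonglongrightarrow> H \<xi> * heat_kernel T \<xi> (t, x, \<lambda>_. 0)" unfolding eq by (simp only:)
    qed
    show "AE \<xi> in lborel. norm (?f i \<xi>) \<le> norm (H \<xi>)" for i
    proof (rule AE_I2)
      fix \<xi> :: "real^'n"
      let ?z = "complex_of_real ((norm \<xi>)\<^sup>2 * - t)"
      have "norm (J01 (real (Suc i) / 2) (of_real (real (Suc i) / 2) * ?z)) \<le> exp (norm (of_real (real (Suc i) / 2) * ?z) / (real (Suc i) / 2))"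
        by (rule J01_norm_le_exp) simp
      also have "norm (of_real (real (Suc i) / 2) * ?z) / (real (Suc i) / 2) = (norm \<xi>)\<^sup>2 * - t"
        unfolding norm_mult norm_of_real using t0 by (simp add: abs_mult)
      finally have "exp ((norm \<xi>)\<^sup>2 * T) * norm (J01 (real (Suc i) / 2) (of_real (real (Suc i) / 2) * ?z)) \<le> exp ((norm \<xi>)\<^sup>2 * T) * exp ((norm \<xi>)\<^sup>2 * - t)"
        by (rule mult_left_mono) simp
      also have "\<dots> = exp ((norm \<xi>)\<^sup>2 * (T - t))" by (simp add: exp_add[symmetric] algebra_simps)
      also have "\<dots> \<le> 1" using t by (simp add: mult_nonneg_nonpos)
      finally have "norm (H \<xi>) * (exp ((norm \<xi>)\<^sup>2 * T) * norm (J01 (real (Suc i) / 2) (of_real (real (Suc i) / 2) * ?z))) \<le> norm (H \<xi>) * 1"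
        by (rule mult_left_mono) simp
      thus "norm (?f i \<xi>) \<le> norm (H \<xi>)"
        unfolding eq norm_mult norm_cis norm_of_real by (simp only: abs_exp_cancel mult_1_right mult.assoc)
    qed
  qed
qed

text \<open>Growth of \<open>J01\<close> and damping are governed by the same quantity b/(N/2),
  which is 0 or |xi|^2, and cancel up to exp(-2T), the contribution of the radius C <= N. All
  remaining dependence on N sits in the rate.\<close>

lemma circle_kernel_bound:
  assumes t: "t \<in> {T..t0}" and N: "N \<ge> 1"
  shows "norm (circle_density T \<alpha> H v * wave_kernel T t0 N fst (circle_rate N \<alpha>) (circle_param N \<alpha>) v (t, x, yN N t))
     \<le> norm (H (fst v)) * indicator circ_dom (snd v) * (4 * (T / t0) * exp (2 * - T)) * exp (- 2 * Re (circle_rate N \<alpha> v) * (sqrt (- T) - sqrt (- t)))"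
proof -
  let ?k = "norm (fst v)" and ?E = "exp (- 2 * Re (circle_rate N \<alpha> v) * (sqrt (- T) - sqrt (- t)))"
  let ?J = "J01 (real N / 2) (circle_param N \<alpha> v * of_real (- t))"
  define b where "b = real N / 2 * ?k\<^sup>2 - centre N \<alpha> (fst v)"
  have b: "0 \<le> b" using centre_bounds[of N \<alpha> "fst v"] by (simp add: b_def)
  have s0: "0 < - t0" "- t0 \<le> - T" "- t \<in> {- t0..- T}" using T t by auto
  have m: "norm (mode (- t0) (- T) (circle_rate N \<alpha> v) (- t)) \<le> 4 * (T / t0) * ?E"
  proof -
    have "0 \<le> Re (circle_rate N \<alpha> v)" unfolding circle_rate_def by (rule Re_csqrt)
    from mode_bounds(1)[OF s0(1,2) this s0(3)] show ?thesis by simp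
  qed
  have "norm (circle_param N \<alpha> v) \<le> norm (complex_of_real b) + norm (circ N (snd v))"
    unfolding circle_param_def b_def by (rule norm_triangle_ineq4)
  hence z: "norm (circle_param N \<alpha> v) \<le> b + real N" using b norm_circ[OF N] radius_bounds(2)[OF N] by simp
  have "norm ?J \<le> exp (norm (circle_param N \<alpha> v * of_real (- t)) / (real N / 2))"
    by (rule J01_norm_le_exp) (use N in simp)
  also have "norm (circle_param N \<alpha> v * of_real (- t)) / (real N / 2) \<le> (b + real N) * - t / (real N / 2)"
    unfolding norm_mult norm_of_real using z t T b by (intro divide_right_mono mult_mono) auto
  also have "(b + real N) * - t / (real N / 2) = b / (real N / 2) * - t + 2 * - t"
    using N by (simp add: field_simps)
  also have "\<dots> \<le> b / (real N / 2) * - T + 2 * - T"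
    using b t N by (intro add_mono mult_left_mono) auto
  finally have J: "norm ?J \<le> exp (b / (real N / 2) * - T + 2 * - T)" by simp
  have "\<bar>circle_factor T \<alpha> (fst v)\<bar> = exp (b / (real N / 2) * T)"
    using N by (auto simp: circle_factor_def b_def centre_def)
  hence "\<bar>circle_factor T \<alpha> (fst v)\<bar> * norm ?J \<le> exp (b / (real N / 2) * T) * exp (b / (real N / 2) * - T + 2 * - T)"
    using J by simp
  also have "\<dots> = exp (2 * - T)" by (simp add: exp_add[symmetric])
  finally have qJ: "\<bar>circle_factor T \<alpha> (fst v)\<bar> * norm ?J \<le> exp (2 * - T)" .
  have "norm (circle_density T \<alpha> H v * wave_kernel T t0 N fst (circle_rate N \<alpha>) (circle_param N \<alpha>) v (t, x, yN N t))
    = (norm (H (fst v)) * indicator circ_dom (snd v)) * (norm (mode (- t0) (- T) (circle_rate N \<alpha> v) (- t)) * (\<bar>circle_factor T \<alpha> (fst v)\<bar> * norm ?J))"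
    using rho_yN[OF N, of t] t T
    by (simp add: circle_density_def wave_kernel_def norm_mult norm_indicator_complex mult_ac)
  also have "\<dots> \<le> (norm (H (fst v)) * indicator circ_dom (snd v)) * ((4 * (T / t0) * ?E) * exp (2 * - T))"
    using m qJ T by (intro mult_left_mono mult_mono mult_nonneg_nonneg divide_nonpos_nonpos) auto
  finally show ?thesis by (simp add: mult_ac)
qed

text \<open>Excluding t = T makes the gap d positive; at t = T itself the mode factors are 1 and
  nothing decays. The bound on Re w then gives pointwise decay off the exceptional angles, with an
  integrable majorant.\<close>

lemma u_circle_limit:
  assumes t: "t \<in> {T<..t0}"
  shows "(\<lambda>i. u_circle (Suc i) \<alpha> (t, x, yN (Suc i) t)) \<longlonglongrightarrow> 0"
proof -
  have t': "t \<in> {T..t0}" using t by auto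
  define d where "d = sqrt (- T) - sqrt (- t)"
  have d: "d > 0" using t by (simp add: d_def)
  define M where "M = 4 * (T / t0) * exp (2 * - T)"
  have M: "M \<ge> 0" unfolding M_def using T by (intro mult_nonneg_nonneg divide_nonpos_nonpos) auto
  have Re_rate: "0 \<le> Re (circle_rate N \<alpha> v)" for N and v :: "(real^'n) \<times> real"
    unfolding circle_rate_def by (rule Re_csqrt)
  let ?f = "\<lambda>i v. circle_density T \<alpha> H v * wave_kernel T t0 (Suc i) fst (circle_rate (Suc i) \<alpha>) (circle_param (Suc i) \<alpha>) v (t, x, yN (Suc i) t)"
  have "(\<lambda>i. \<integral>v. ?f i v \<partial>(lborel \<Otimes>\<^sub>M lborel)) \<longlonglongrightarrow> (\<integral>v. 0 \<partial>(lborel \<Otimes>\<^sub>M lborel :: ((real^'n) \<times> real) measure))"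
  proof (rule integral_dominated_convergence[where w = "\<lambda>v. norm (H (fst v)) * indicator circ_dom (snd v) * M"])
    show "?f i \<in> borel_measurable (lborel \<Otimes>\<^sub>M lborel)" for i
      using u_circle_integrable[OF _ yN_dom[OF _ t'], of "Suc i"] by simp
    have "integrable lborel (indicator circ_dom :: real \<Rightarrow> real)"
      by (rule Bochner_Integration.integrable_bound[where f = "indicator {0..1::real} :: real \<Rightarrow> real"])
         (auto simp: circ_dom_def indicator_def)
    from integrable_pair_mult[OF H_integrable this]
    show "integrable (lborel \<Otimes>\<^sub>M lborel) (\<lambda>v. norm (H (fst v)) * indicator circ_dom (snd v) * M)"
      by (intro integrable_mult_left) (simp add: case_prod_unfold)
    show "AE v in lborel \<Otimes>\<^sub>M lborel. norm (?f i v) \<le> norm (H (fst v)) * indicator circ_dom (snd v) * M" for i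
    proof (rule AE_I2)
      fix v :: "(real^'n) \<times> real"
      have "norm (?f i v) \<le> norm (H (fst v)) * indicator circ_dom (snd v) * M * exp (- 2 * Re (circle_rate (Suc i) \<alpha> v) * d)"
        unfolding d_def M_def by (rule circle_kernel_bound[OF t']) simp
      also have "\<dots> \<le> norm (H (fst v)) * indicator circ_dom (snd v) * M * 1"
        using M d Re_rate[of "Suc i" v] by (intro mult_left_mono mult_nonneg_nonneg) auto
      finally show "norm (?f i v) \<le> norm (H (fst v)) * indicator circ_dom (snd v) * M" by simp
    qed
    show "AE v in lborel \<Otimes>\<^sub>M lborel. (\<lambda>i. ?f i v) \<longlonglongrightarrow> 0"
    proof (rule AE_I2)
      fix v :: "(real^'n) \<times> real"
      obtain \<xi> \<theta> where v: "v = (\<xi>, \<theta>)" by (cases v)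
      show "(\<lambda>i. ?f i v) \<longlonglongrightarrow> 0"
      proof (cases "\<theta> \<in> circ_dom")
        case False
        thus ?thesis by (simp add: circle_density_def v)
      next
        case True
        \<comment> \<open>What is left of the bound in \<open>Re_csqrt_lower\<close> when centre
          plus radius is replaced by N(|xi|^2/2 + 1) and the radius is written as N^(1/4) sqrt
          N.\<close>
        define \<sigma> where "\<sigma> = \<bar>sin (2 * pi * \<theta>)\<bar> / (2 * sqrt ((norm \<xi>)\<^sup>2 / 2 + 1))"
        have \<sigma>: "\<sigma> > 0" unfolding \<sigma>_def using sin_circ_dom[OF True] by (intro divide_pos_pos) (auto simp: add_nonneg_pos)
        have low: "real (Suc i) powr (1/4) * \<sigma> \<le> Re (circle_rate (Suc i) \<alpha> v)" for i
        proof -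
          let ?N = "Suc i"
          have C: "0 < radius ?N" "radius ?N \<le> real ?N" using radius_bounds[of ?N] by auto
          have le: "centre ?N \<alpha> \<xi> + radius ?N \<le> real ?N * ((norm \<xi>)\<^sup>2 / 2 + 1)"
          proof -
            have "real ?N * ((norm \<xi>)\<^sup>2 / 2 + 1) = real ?N / 2 * (norm \<xi>)\<^sup>2 + real ?N"
              by (simp add: distrib_left del: of_nat_Suc)
            thus ?thesis using centre_bounds(2)[of ?N \<alpha> \<xi>] C(2) by linarith
          qed
          have pos: "0 < centre ?N \<alpha> \<xi> + radius ?N" using centre_bounds(1)[of ?N \<alpha> \<xi>] C(1) by linarith
          have "real ?N powr (1/4) * \<sigma> = radius ?N * \<bar>sin (2 * pi * \<theta>)\<bar> / (2 * sqrt (real ?N * ((norm \<xi>)\<^sup>2 / 2 + 1)))"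
          proof -
            have "radius ?N = real ?N powr (1/4) * sqrt (real ?N)"
              unfolding radius_def by (simp add: powr_half_sqrt[symmetric] powr_add[symmetric])
            thus ?thesis unfolding \<sigma>_def real_sqrt_mult by simp
          qed
          also have "\<dots> \<le> radius ?N * \<bar>sin (2 * pi * \<theta>)\<bar> / (2 * sqrt (centre ?N \<alpha> \<xi> + radius ?N))"
            using le pos C(1) by (intro divide_left_mono mult_left_mono mult_pos_pos real_sqrt_le_mono)
              (auto simp: add_nonneg_pos)
          also have "\<dots> \<le> Re (circle_rate ?N \<alpha> v)"
            unfolding circle_rate_def circ_def v fst_conv snd_conv by (rule Re_csqrt_lower[OF centre_bounds(1) C(1)])
          finally show ?thesis .
        qed
        have "(\<lambda>i. norm (H \<xi>) * indicator circ_dom \<theta> * M * exp (- 2 * (real (Suc i) powr (1/4) * \<sigma>) * d)) \<longlonglongrightarrow> norm (H \<xi>) * indicator circ_dom \<theta> * M * 0"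
        proof (rule tendsto_mult_left)
          have "\<sigma> * d > 0" using \<sigma> d by simp
          hence "(\<lambda>i. exp (- 2 * (\<sigma> * d) * real (Suc i) powr (1/4))) \<longlonglongrightarrow> 0" by (rule exp_root_decay)
          thus "(\<lambda>i. exp (- 2 * (real (Suc i) powr (1/4) * \<sigma>) * d)) \<longlonglongrightarrow> 0" by (simp add: mult_ac)
        qed
        hence "(\<lambda>i. norm (H \<xi>) * indicator circ_dom \<theta> * M * exp (- 2 * (real (Suc i) powr (1/4) * \<sigma>) * d)) \<longlonglongrightarrow> 0" by simp
        thus ?thesis
        proof (rule Lim_null_comparison[rotated], intro always_eventually allI)
          fix i
          have "norm (?f i v) \<le> norm (H \<xi>) * indicator circ_dom \<theta> * M * exp (- 2 * Re (circle_rate (Suc i) \<alpha> v) * d)"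
            using circle_kernel_bound[OF t', of "Suc i" \<alpha> v x] unfolding d_def M_def v by simp
          also have "\<dots> \<le> norm (H \<xi>) * indicator circ_dom \<theta> * M * exp (- 2 * (real (Suc i) powr (1/4) * \<sigma>) * d)"
            using M d low[of i] by (intro mult_left_mono mult_nonneg_nonneg) auto
          finally show "norm (?f i v) \<le> norm (H \<xi>) * indicator circ_dom \<theta> * M * exp (- 2 * (real (Suc i) powr (1/4) * \<sigma>) * d)" .
        qed
      qed
    qed
  qed auto
  thus ?thesis unfolding u_circle_def by simp
qed

text \<open>At t = T the sequence is constantly h; for later t only the static part survives. The
  limits are taken along \<open>Suc i\<close> because the estimates start at N = 1.\<close>

lemma u_wave_limit:
  assumes t: "t \<in> {T..t0}"
  shows "(\<lambda>N. u_wave N (t, x, yN N t)) \<longlonglongrightarrow> kint lborel H (heat_kernel T) (t, x, \<lambda>_. 0)"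
proof (cases "t = T")
  case True
  have "u_wave (Suc i) (T, x, yN (Suc i) T) = h x" for i
    by (rule u_wave_initial) (auto simp: RN_def yN_def)
  moreover have "kint lborel H (heat_kernel T) (T, x, \<lambda>_. 0) = h x"
    using Hinv[of x] by (simp add: kint_def heat_kernel_def)
  ultimately have "(\<lambda>i. u_wave (Suc i) (T, x, yN (Suc i) T)) \<longlonglongrightarrow> kint lborel H (heat_kernel T) (T, x, \<lambda>_. 0)"
    by simp
  thus ?thesis unfolding True by (rule LIMSEQ_imp_Suc)
next
  case False
  hence t': "t \<in> {T<..t0}" using t by auto
  have "(\<lambda>i. u_wave (Suc i) (t, x, yN (Suc i) t)) \<longlonglongrightarrow> Re (\<integral>\<xi>. H \<xi> * heat_kernel T \<xi> (t, x, \<lambda>_. 0) \<partial>lborel) + Re 0 + Re 0"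
    unfolding u_wave_def by (intro tendsto_add tendsto_Re u_static_limit[OF t] u_circle_limit[OF t'])
  hence "(\<lambda>i. u_wave (Suc i) (t, x, yN (Suc i) t)) \<longlonglongrightarrow> kint lborel H (heat_kernel T) (t, x, \<lambda>_. 0)"
    by (simp add: kint_def)
  thus ?thesis by (rule LIMSEQ_imp_Suc)
qed

end

theorem theorem4p4:
  fixes T t0 :: real and h :: "real^'n \<Rightarrow> real"
  assumes "T < t0" and "t0 < 0" and "C0_inf h"
  shows "\<exists>(u :: nat \<Rightarrow> 'n pt \<Rightarrow> real) (U :: real \<Rightarrow> real^'n \<Rightarrow> real).
           (\<forall>N\<ge>1. wave_solution T t0 N h (u N) \<and> radial_y T t0 N (u N)) \<and>
           (\<forall>t\<in>{T..t0}. \<forall>x. (\<lambda>N. u N (t, x, yN N t)) \<longlonglongrightarrow> U t x) \<and>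
           heat_solution T t0 h U"
proof -
  obtain H :: "real^'n \<Rightarrow> complex" where H: "H \<in> borel_measurable borel"
    "\<And>m. integrable lborel (\<lambda>\<xi>. norm (H \<xi>) * (1 + norm \<xi>) ^ m)"
    "\<And>x. (\<integral>\<xi>. H \<xi> * cis (\<xi> \<bullet> x) \<partial>lborel) = of_real (h x)"
    using fourier_representation[OF assms(3)] by blast
  show ?thesis
  proof (intro exI[of _ "u_wave T t0 H"] exI[of _ "\<lambda>t x. kint lborel H (heat_kernel T) (t, x, \<lambda>_. 0)"] conjI allI ballI impI)
    fix N :: nat assume N: "N \<ge> 1"
    show "wave_solution T t0 N h (u_wave T t0 H N)"
      by (rule wave_part_solution[OF assms(1) u_wave_part[OF assms(1,2) H N] u_wave_initial[OF assms(1,2) H N]])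
    show "radial_y T t0 N (u_wave T t0 H N)" by (rule u_wave_radial[OF assms(1,2) H])
  next
    fix t x assume "t \<in> {T..t0}"
    thus "(\<lambda>N. u_wave T t0 H N (t, x, yN N t)) \<longlonglongrightarrow> kint lborel H (heat_kernel T) (t, x, \<lambda>_. 0)"
      by (rule u_wave_limit[OF assms(1,2) H])
  next
    show "heat_solution T t0 h (\<lambda>t x. kint lborel H (heat_kernel T) (t, x, \<lambda>_. 0))"
      by (rule heat_kernel_solution[OF assms(1) H])
  qed
qed

end
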